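(* Let $\mathfrak{p}$ be a prime ideal in a commutative noetherian ring $R$ and let $M$ be an $R$-module. If $\operatorname{Tor}_{n}^{R}(k(\mathfrak{p}),M)=0$ for some integer $n \geqslant \dim R_{\mathfrak{p}}$, then $\operatorname{Tor}_i^R(k(\mathfrak{p}),M) = 0$ for all $i \geqslant n$.
   Context: For a prime ideal $\mathfrak{p}$ of $R$, $k(\mathfrak{p}) := R_{\mathfrak{p}}/\mathfrak{p}R_{\mathfrak{p}}$ denotes the residue field at $\mathfrak{p}$. $\dim$ denotes Krull dimension. The module $M$ is not assumed finitely generated. *)

theory Defs
  imports "HOL-Algebra.Algebra" "HOL-Library.Extended_Nat"
begin

section \<open>Krull dimension, localization, residue field\<close>

text \<open>As the supremum is taken in the extended naturals, the zero ring gets dimension 0.\<close>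

definition krull_dim :: "('a, 'c) ring_scheme \<Rightarrow> enat" where
  "krull_dim R = Sup {enat n | n. \<exists>P :: nat \<Rightarrow> 'a set.
     (\<forall>i\<le>n. primeideal (P i) R) \<and> (\<forall>i<n. P i \<subset> P (Suc i))}"

definition fraction_rel ::
  "('a, 'c) ring_scheme \<Rightarrow> 'a set \<Rightarrow> (('a \<times> 'a) \<times> ('a \<times> 'a)) set" where
  "fraction_rel R S = {((a, s), (b, t)) | a s b t.
     a \<in> carrier R \<and> s \<in> S \<and> b \<in> carrier R \<and> t \<in> S \<and>
     (\<exists>u\<in>S. u \<otimes>\<^bsub>R\<^esub> (t \<otimes>\<^bsub>R\<^esub> a \<ominus>\<^bsub>R\<^esub> s \<otimes>\<^bsub>R\<^esub> b) = \<zero>\<^bsub>R\<^esub>)}"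

definition fraction :: "('a, 'c) ring_scheme \<Rightarrow> 'a set \<Rightarrow> 'a \<Rightarrow> 'a \<Rightarrow> ('a \<times> 'a) set" where
  "fraction R S a s = fraction_rel R S `` {(a, s)}"

definition localization :: "('a, 'c) ring_scheme \<Rightarrow> 'a set \<Rightarrow> ('a \<times> 'a) set ring" where
  "localization R S =
    \<lparr>carrier = (carrier R \<times> S) // fraction_rel R S,
     monoid.mult = (\<lambda>U V. \<Union>x\<in>U. \<Union>y\<in>V. fraction R S (fst x \<otimes>\<^bsub>R\<^esub> fst y) (snd x \<otimes>\<^bsub>R\<^esub> snd y)),
     one = fraction R S \<one>\<^bsub>R\<^esub> \<one>\<^bsub>R\<^esub>,
     ring.zero = fraction R S \<zero>\<^bsub>R\<^esub> \<one>\<^bsub>R\<^esub>,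
     ring.add = (\<lambda>U V. \<Union>x\<in>U. \<Union>y\<in>V.
       fraction R S (fst x \<otimes>\<^bsub>R\<^esub> snd y \<oplus>\<^bsub>R\<^esub> fst y \<otimes>\<^bsub>R\<^esub> snd x) (snd x \<otimes>\<^bsub>R\<^esub> snd y))\<rparr>"

definition local_ring_at :: "('a, 'c) ring_scheme \<Rightarrow> 'a set \<Rightarrow> ('a \<times> 'a) set ring" where
  "local_ring_at R p = localization R (carrier R - p)"

definition to_local_ring_at :: "('a, 'c) ring_scheme \<Rightarrow> 'a set \<Rightarrow> 'a \<Rightarrow> ('a \<times> 'a) set" where
  "to_local_ring_at R p a = fraction R (carrier R - p) a \<one>\<^bsub>R\<^esub>"

definition extended_ideal :: "('a, 'c) ring_scheme \<Rightarrow> 'a set \<Rightarrow> ('a \<times> 'a) set set" where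
  "extended_ideal R p = Idl\<^bsub>local_ring_at R p\<^esub> (to_local_ring_at R p ` p)"

definition residue_field :: "('a, 'c) ring_scheme \<Rightarrow> 'a set \<Rightarrow> ('a \<times> 'a) set set ring" where
  "residue_field R p = local_ring_at R p Quot extended_ideal R p"

definition restrict_scalars :: "('a \<Rightarrow> 'b) \<Rightarrow> ('b, 'c) ring_scheme \<Rightarrow> ('a, 'b) module" where
  "restrict_scalars \<phi> A =
    \<lparr>carrier = carrier A, monoid.mult = monoid.mult A, one = one A,
     ring.zero = ring.zero A, ring.add = ring.add A,
     smult = (\<lambda>r x. \<phi> r \<otimes>\<^bsub>A\<^esub> x)\<rparr>"

definition residue_field_module ::
  "('a, 'c) ring_scheme \<Rightarrow> 'a set \<Rightarrow> ('a, ('a \<times> 'a) set set) module" where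
  "residue_field_module R p =
    restrict_scalars
      (\<lambda>r. extended_ideal R p +>\<^bsub>local_ring_at R p\<^esub> to_local_ring_at R p r)
      (residue_field R p)"


section \<open>Free modules, quotient modules, tensor products\<close>

text \<open>Module records of \<open>HOL-Algebra\<close> inherit the fields \<open>mult\<close> and \<open>one\<close> of ring records;
  the locale \<open>module\<close> does not constrain them, and they are left unspecified below.\<close>

definition free_module :: "('a, 'c) ring_scheme \<Rightarrow> 'x set \<Rightarrow> ('a, 'x \<Rightarrow> 'a) module" where
  "free_module R U =
    \<lparr>carrier = {f. (\<forall>x. f x \<in> carrier R) \<and> finite {x. f x \<noteq> \<zero>\<^bsub>R\<^esub>} \<and> {x. f x \<noteq> \<zero>\<^bsub>R\<^esub>} \<subseteq> U},
     monoid.mult = undefined, one = undefined,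
     ring.zero = (\<lambda>x. \<zero>\<^bsub>R\<^esub>),
     ring.add = (\<lambda>f g x. f x \<oplus>\<^bsub>R\<^esub> g x),
     smult = (\<lambda>r f x. r \<otimes>\<^bsub>R\<^esub> f x)\<rparr>"

definition basis_elem :: "('a, 'c) ring_scheme \<Rightarrow> 'x \<Rightarrow> 'x \<Rightarrow> 'a" where
  "basis_elem R x = (\<lambda>y. if y = x then \<one>\<^bsub>R\<^esub> else \<zero>\<^bsub>R\<^esub>)"

definition lin_ext ::
  "('a, 'c) ring_scheme \<Rightarrow> ('a, 'b, 'd) module_scheme \<Rightarrow> ('x \<Rightarrow> 'b) \<Rightarrow> ('x \<Rightarrow> 'a) \<Rightarrow> 'b" where
  "lin_ext R M g f = (\<Oplus>\<^bsub>M\<^esub>x\<in>{x. f x \<noteq> \<zero>\<^bsub>R\<^esub>}. f x \<odot>\<^bsub>M\<^esub> g x)"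

definition submodule_span ::
  "('a, 'c) ring_scheme \<Rightarrow> ('a, 'b, 'd) module_scheme \<Rightarrow> 'b set \<Rightarrow> 'b set" where
  "submodule_span R M S = \<Inter>{H. submodule H R M \<and> S \<subseteq> H}"

definition quotient_module ::
  "('a, 'b, 'd) module_scheme \<Rightarrow> 'b set \<Rightarrow> ('a, 'b set) module" where
  "quotient_module M L =
    \<lparr>carrier = a_rcosets\<^bsub>M\<^esub> L,
     monoid.mult = undefined, one = undefined,
     ring.zero = L,
     ring.add = set_add M,
     smult = (\<lambda>r U. \<Union>x\<in>U. L +>\<^bsub>M\<^esub> (r \<odot>\<^bsub>M\<^esub> x))\<rparr>"

definition tensor_free ::
  "('a, 'c) ring_scheme \<Rightarrow> ('a, 'n, 'd) module_scheme \<Rightarrow> ('a, 'b, 'e) module_scheme \<Rightarrow>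
   ('a, 'n \<times> 'b \<Rightarrow> 'a) module" where
  "tensor_free R N M = free_module R (carrier N \<times> carrier M)"

definition tensor_relators ::
  "('a, 'c) ring_scheme \<Rightarrow> ('a, 'n, 'd) module_scheme \<Rightarrow> ('a, 'b, 'e) module_scheme \<Rightarrow>
   ('n \<times> 'b \<Rightarrow> 'a) set" where
  "tensor_relators R N M = (let F = tensor_free R N M; e = basis_elem R in
     {e (x \<oplus>\<^bsub>N\<^esub> x', y) \<ominus>\<^bsub>F\<^esub> (e (x, y) \<oplus>\<^bsub>F\<^esub> e (x', y)) | x x' y.
        x \<in> carrier N \<and> x' \<in> carrier N \<and> y \<in> carrier M} \<union>
     {e (x, y \<oplus>\<^bsub>M\<^esub> y') \<ominus>\<^bsub>F\<^esub> (e (x, y) \<oplus>\<^bsub>F\<^esub> e (x, y')) | x y y'.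
        x \<in> carrier N \<and> y \<in> carrier M \<and> y' \<in> carrier M} \<union>
     {e (r \<odot>\<^bsub>N\<^esub> x, y) \<ominus>\<^bsub>F\<^esub> (r \<odot>\<^bsub>F\<^esub> e (x, y)) | r x y.
        r \<in> carrier R \<and> x \<in> carrier N \<and> y \<in> carrier M} \<union>
     {e (x, r \<odot>\<^bsub>M\<^esub> y) \<ominus>\<^bsub>F\<^esub> (r \<odot>\<^bsub>F\<^esub> e (x, y)) | r x y.
        r \<in> carrier R \<and> x \<in> carrier N \<and> y \<in> carrier M})"

definition tensor_kernel ::
  "('a, 'c) ring_scheme \<Rightarrow> ('a, 'n, 'd) module_scheme \<Rightarrow> ('a, 'b, 'e) module_scheme \<Rightarrow>
   ('n \<times> 'b \<Rightarrow> 'a) set" where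
  "tensor_kernel R N M = submodule_span R (tensor_free R N M) (tensor_relators R N M)"

definition tensor_product ::
  "('a, 'c) ring_scheme \<Rightarrow> ('a, 'n, 'd) module_scheme \<Rightarrow> ('a, 'b, 'e) module_scheme \<Rightarrow>
   ('a, ('n \<times> 'b \<Rightarrow> 'a) set) module" where
  "tensor_product R N M = quotient_module (tensor_free R N M) (tensor_kernel R N M)"

text \<open>The map \<open>N \<otimes> f : N \<otimes> M \<rightarrow> N \<otimes> M'\<close> induced by an \<open>R\<close>-linear map \<open>f : M \<rightarrow> M'\<close>, sending the
  class of \<open>x \<otimes> y\<close> to the class of \<open>x \<otimes> f y\<close>.\<close>

definition tensor_map ::
  "('a, 'c) ring_scheme \<Rightarrow> ('a, 'n, 'd) module_scheme \<Rightarrow> ('a, 'b2, 'e) module_scheme \<Rightarrow>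
   ('b \<Rightarrow> 'b2) \<Rightarrow> ('n \<times> 'b \<Rightarrow> 'a) set \<Rightarrow> ('n \<times> 'b2 \<Rightarrow> 'a) set" where
  "tensor_map R N M' f U = (\<Union>c\<in>U. tensor_kernel R N M' +>\<^bsub>tensor_free R N M'\<^esub>
     lin_ext R (tensor_free R N M') (\<lambda>(x, y). basis_elem R (x, f y)) c)"


section \<open>Homology of a complex\<close>

text \<open>A complex \<open>\<cdots> \<rightarrow> C 2 \<rightarrow> C 1 \<rightarrow> C 0 \<rightarrow> 0\<close> is given by modules \<open>C n\<close> and by differentials
  indexed by their target, \<open>d n : C (Suc n) \<rightarrow> C n\<close>.\<close>

primrec cycles :: "(nat \<Rightarrow> ('a, 'b) module) \<Rightarrow> (nat \<Rightarrow> 'b \<Rightarrow> 'b) \<Rightarrow> nat \<Rightarrow> 'b set" where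
  "cycles C d 0 = carrier (C 0)"
| "cycles C d (Suc n) = {x \<in> carrier (C (Suc n)). d n x = \<zero>\<^bsub>C n\<^esub>}"

definition boundaries :: "(nat \<Rightarrow> ('a, 'b) module) \<Rightarrow> (nat \<Rightarrow> 'b \<Rightarrow> 'b) \<Rightarrow> nat \<Rightarrow> 'b set" where
  "boundaries C d n = d n ` carrier (C (Suc n))"

definition homology ::
  "(nat \<Rightarrow> ('a, 'b) module) \<Rightarrow> (nat \<Rightarrow> 'b \<Rightarrow> 'b) \<Rightarrow> nat \<Rightarrow> ('a, 'b set) module" where
  "homology C d n = quotient_module ((C n)\<lparr>carrier := cycles C d n\<rparr>) (boundaries C d n)"


section \<open>A free resolution\<close>

text \<open>We use a resolution \<open>\<cdots> \<rightarrow> F 2 \<rightarrow> F 1 \<rightarrow> F 0 \<rightarrow> M\<close> that exists for every module and involves no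
  choices: \<open>F 0\<close> is free on the elements of \<open>M\<close>, and \<open>F (Suc n)\<close> is free on all presentations of
  elements of the kernel of the preceding map as formal linear combinations of basis elements
  of \<open>F n\<close>.  All bases live in the one type of cells, so that the \<open>F n\<close> can be indexed by \<open>n\<close>:
  \<open>Gen m\<close> is the basis element of \<open>F 0\<close> lying over \<open>m\<close>, and \<open>Syz [(r1, c1), \<dots>, (rk, ck)]\<close> is a
  basis element with boundary \<open>r1 c1 + \<cdots> + rk ck\<close>.\<close>

datatype ('a, 'b) cell = Gen 'b | Syz "('a \<times> ('a, 'b) cell) list"

definition list_chain :: "('a, 'c) ring_scheme \<Rightarrow> ('a \<times> 'x) list \<Rightarrow> 'x \<Rightarrow> 'a" where
  "list_chain R l = (\<lambda>x. foldr (\<lambda>(r, y) s. (if y = x then r else \<zero>\<^bsub>R\<^esub>) \<oplus>\<^bsub>R\<^esub> s) l \<zero>\<^bsub>R\<^esub>)"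

definition gen_value :: "('a, 'b) cell \<Rightarrow> 'b" where
  "gen_value c = (case c of Gen m \<Rightarrow> m | Syz l \<Rightarrow> undefined)"

definition cell_boundary :: "('a, 'c) ring_scheme \<Rightarrow> ('a, 'b) cell \<Rightarrow> ('a, 'b) cell \<Rightarrow> 'a" where
  "cell_boundary R c = (case c of Gen m \<Rightarrow> undefined | Syz l \<Rightarrow> list_chain R l)"

fun res_basis ::
  "('a, 'c) ring_scheme \<Rightarrow> ('a, 'b, 'd) module_scheme \<Rightarrow> nat \<Rightarrow> ('a, 'b) cell set" where
  "res_basis R M 0 = Gen ` carrier M"
| "res_basis R M (Suc 0) = {Syz l | l. set l \<subseteq> carrier R \<times> res_basis R M 0 \<and>
     lin_ext R M gen_value (list_chain R l) = \<zero>\<^bsub>M\<^esub>}"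
| "res_basis R M (Suc (Suc n)) = {Syz l | l. set l \<subseteq> carrier R \<times> res_basis R M (Suc n) \<and>
     lin_ext R (free_module R (res_basis R M n)) (cell_boundary R) (list_chain R l) =
       \<zero>\<^bsub>free_module R (res_basis R M n)\<^esub>}"

definition res_module ::
  "('a, 'c) ring_scheme \<Rightarrow> ('a, 'b, 'd) module_scheme \<Rightarrow> nat \<Rightarrow> ('a, ('a, 'b) cell \<Rightarrow> 'a) module"
  where "res_module R M n = free_module R (res_basis R M n)"

definition res_augmentation ::
  "('a, 'c) ring_scheme \<Rightarrow> ('a, 'b, 'd) module_scheme \<Rightarrow> (('a, 'b) cell \<Rightarrow> 'a) \<Rightarrow> 'b" where
  "res_augmentation R M = lin_ext R M gen_value"

definition res_differential ::
  "('a, 'c) ring_scheme \<Rightarrow> ('a, 'b, 'd) module_scheme \<Rightarrow> nat \<Rightarrow>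
   (('a, 'b) cell \<Rightarrow> 'a) \<Rightarrow> ('a, 'b) cell \<Rightarrow> 'a" where
  "res_differential R M n = lin_ext R (res_module R M n) (cell_boundary R)"


subsection \<open>Exactness\<close>

text \<open>The facts \<open>res_augmentation_surj\<close>, \<open>res_exact_0\<close> and \<open>res_exact_Suc\<close> at the end say that the
  free modules \<open>res_module R M n\<close> do form a resolution of \<open>M\<close>.\<close>

lemma free_module_module:
  fixes R (structure)
  assumes "cring R" shows "module R (free_module R B)"
proof -
  interpret cring R by fact
  have fin: "finite {x. f x \<oplus> g x \<noteq> \<zero>}"
    if "finite {x. f x \<noteq> \<zero>}" "finite {x. g x \<noteq> \<zero>}" for f g :: "'c \<Rightarrow> 'a"
    by (rule finite_subset[OF _ finite_UnI[OF that]]) auto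
  have fin': "finite {x. r \<otimes> f x \<noteq> \<zero>}"
    if "finite {x. f x \<noteq> \<zero>}" "r \<in> carrier R" for r and f :: "'c \<Rightarrow> 'a"
    by (rule finite_subset[OF _ that(1)]) (use that in auto)
  have neg: "\<exists>g. ((\<forall>x. g x \<in> carrier R) \<and> finite {x. g x \<noteq> \<zero>} \<and> {x. g x \<noteq> \<zero>} \<subseteq> B) \<and>
      (\<lambda>x. g x \<oplus> f x) = (\<lambda>x. \<zero>)"
    if "\<forall>x. f x \<in> carrier R" "finite {x. f x \<noteq> \<zero>}" "{x. f x \<noteq> \<zero>} \<subseteq> B" for f :: "'c \<Rightarrow> 'a"
  proof (rule exI[of _ "\<lambda>x. \<ominus> f x"])
    have "{x. \<ominus> f x \<noteq> \<zero>} \<subseteq> {x. f x \<noteq> \<zero>}" by auto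
    then show "((\<forall>x. \<ominus> f x \<in> carrier R) \<and> finite {x. \<ominus> f x \<noteq> \<zero>} \<and> {x. \<ominus> f x \<noteq> \<zero>} \<subseteq> B) \<and>
      (\<lambda>x. \<ominus> f x \<oplus> f x) = (\<lambda>x. \<zero>)"
      using that by (auto simp: l_neg intro: finite_subset)
  qed
  show ?thesis
    apply (rule moduleI)
    subgoal by fact
    subgoal
      apply (rule abelian_groupI)
      subgoal by (auto simp: free_module_def fin)
        (metis (mono_tags, lifting) l_zero mem_Collect_eq subsetD zero_closed)
      subgoal by (simp add: free_module_def)
      subgoal by (auto simp: free_module_def a_assoc)
      subgoal by (auto simp: free_module_def a_comm)
      subgoal by (auto simp: free_module_def)
      subgoal using neg by (simp add: free_module_def Bex_def)
      done
    by (auto simp: free_module_def fun_eq_iff l_distr r_distr m_assoc fin')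
qed

context module begin

lemma lin_ext_superset:
  assumes "f \<in> carrier (free_module R B)" "g \<in> B \<rightarrow> carrier M"
    and "finite A" "{x. f x \<noteq> \<zero>} \<subseteq> A" "A \<subseteq> B"
  shows "lin_ext R M g f = (\<Oplus>\<^bsub>M\<^esub>x\<in>A. f x \<odot>\<^bsub>M\<^esub> g x)"
  unfolding lin_ext_def
  apply (rule M.add.finprod_mono_neutral_cong_left)
  using assms by (auto simp: free_module_def Pi_iff subset_iff intro!: smult_closed)

lemma lin_ext_closed:
  assumes "f \<in> carrier (free_module R B)" "g \<in> B \<rightarrow> carrier M"
  shows "lin_ext R M g f \<in> carrier M"
  unfolding lin_ext_def
  apply (rule M.finsum_closed)
  using assms by (auto simp: free_module_def Pi_iff subset_iff intro!: smult_closed)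

lemma lin_ext_add:
  assumes f: "f \<in> carrier (free_module R B)" and f': "f' \<in> carrier (free_module R B)"
    and g: "g \<in> B \<rightarrow> carrier M"
  shows "lin_ext R M g (f \<oplus>\<^bsub>free_module R B\<^esub> f') = lin_ext R M g f \<oplus>\<^bsub>M\<^esub> lin_ext R M g f'"
proof -
  interpret F: module R "free_module R B" by (rule free_module_module) (rule R.cring_axioms)
  let ?A = "{x. f x \<noteq> \<zero>} \<union> {x. f' x \<noteq> \<zero>}"
  have A: "finite ?A" "?A \<subseteq> B" using f f' by (auto simp: free_module_def)
  have ff: "f \<oplus>\<^bsub>free_module R B\<^esub> f' \<in> carrier (free_module R B)" using f f' by simp
  have c: "f x \<in> carrier R" "f' x \<in> carrier R" for x using f f' by (auto simp: free_module_def)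
  have "lin_ext R M g (f \<oplus>\<^bsub>free_module R B\<^esub> f') = (\<Oplus>\<^bsub>M\<^esub>x\<in>?A. (f x \<oplus> f' x) \<odot>\<^bsub>M\<^esub> g x)"
    apply (subst lin_ext_superset[OF ff g A(1) _ A(2)])
    using c by (auto simp: free_module_def)
  also have "\<dots> = (\<Oplus>\<^bsub>M\<^esub>x\<in>?A. f x \<odot>\<^bsub>M\<^esub> g x \<oplus>\<^bsub>M\<^esub> f' x \<odot>\<^bsub>M\<^esub> g x)"
    by (rule M.finsum_cong') (use c g A in \<open>auto simp: smult_l_distr Pi_iff subset_iff\<close>)
  also have "\<dots> = lin_ext R M g f \<oplus>\<^bsub>M\<^esub> lin_ext R M g f'"
    apply (subst lin_ext_superset[OF f g A(1) _ A(2)], blast)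
    apply (subst lin_ext_superset[OF f' g A(1) _ A(2)], blast)
    apply (rule M.finsum_addf)
    using c g A by (auto simp: Pi_iff subset_iff)
  finally show ?thesis .
qed

lemma lin_ext_smult:
  assumes f: "f \<in> carrier (free_module R B)" and r: "r \<in> carrier R"
    and g: "g \<in> B \<rightarrow> carrier M"
  shows "lin_ext R M g (r \<odot>\<^bsub>free_module R B\<^esub> f) = r \<odot>\<^bsub>M\<^esub> lin_ext R M g f"
proof -
  interpret F: module R "free_module R B" by (rule free_module_module) (rule R.cring_axioms)
  let ?A = "{x. f x \<noteq> \<zero>}"
  have A: "finite ?A" "?A \<subseteq> B" using f by (auto simp: free_module_def)
  have ff: "r \<odot>\<^bsub>free_module R B\<^esub> f \<in> carrier (free_module R B)" using f r by simp
  have c: "f x \<in> carrier R" for x using f by (auto simp: free_module_def)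
  have "lin_ext R M g (r \<odot>\<^bsub>free_module R B\<^esub> f) = (\<Oplus>\<^bsub>M\<^esub>x\<in>?A. (r \<otimes> f x) \<odot>\<^bsub>M\<^esub> g x)"
    apply (subst lin_ext_superset[OF ff g A(1) _ A(2)])
    using c r by (auto simp: free_module_def)
  also have "\<dots> = (\<Oplus>\<^bsub>M\<^esub>x\<in>?A. r \<odot>\<^bsub>M\<^esub> (f x \<odot>\<^bsub>M\<^esub> g x))"
    by (rule M.finsum_cong') (use c g A r in \<open>auto simp: smult_assoc1 Pi_iff subset_iff\<close>)
  also have "\<dots> = r \<odot>\<^bsub>M\<^esub> lin_ext R M g f" unfolding lin_ext_def
    apply (rule finsum_smult_ldistr[symmetric])
    using c g A r by (auto simp: Pi_iff subset_iff)
  finally show ?thesis .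
qed

lemma lin_ext_basis_elem:
  assumes "g x \<in> carrier M"
  shows "lin_ext R M g (basis_elem R x) = g x"
proof (cases "\<one> = \<zero>")
  case True
  then have "g x = \<zero>\<^bsub>M\<^esub>" using assms by (metis smult_l_null smult_one)
  moreover have "{y. basis_elem R x y \<noteq> \<zero>} = {}" using True by (auto simp: basis_elem_def)
  ultimately show ?thesis by (simp add: lin_ext_def)
next
  case False
  then have "{y. basis_elem R x y \<noteq> \<zero>} = {x}" by (auto simp: basis_elem_def)
  then show ?thesis using assms by (simp add: lin_ext_def basis_elem_def)
qed

end

lemma basis_elem_closed:
  assumes "cring R" "x \<in> B" shows "basis_elem R x \<in> carrier (free_module R B)"
proof -
  interpret cring R by fact
  show ?thesis using assms(2)
    by (auto simp: free_module_def basis_elem_def intro: finite_subset[of _ "{x}"])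
qed

lemma list_chain_closed:
  assumes "cring R" "set l \<subseteq> carrier R \<times> B"
  shows "list_chain R l \<in> carrier (free_module R B)"
  using assms(2)
proof (induction l)
  interpret cring R by fact
  case Nil then show ?case by (simp add: list_chain_def free_module_def)
next
  interpret cring R by fact
  interpret F: module R "free_module R B" by (rule free_module_module) (rule cring_axioms)
  case (Cons a l)
  obtain r y where a: "a = (r, y)" "r \<in> carrier R" "y \<in> B" using Cons.prems by auto
  have "list_chain R (a # l) = (r \<odot>\<^bsub>free_module R B\<^esub> basis_elem R y) \<oplus>\<^bsub>free_module R B\<^esub> list_chain R l"
    using a by (auto simp: list_chain_def free_module_def basis_elem_def fun_eq_iff)
  also have "\<dots> \<in> carrier (free_module R B)"
    using Cons a basis_elem_closed[OF assms(1)] by (intro F.M.a_closed F.smult_closed) auto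
  finally show ?case .
qed

lemma list_chain_surj:
  fixes R (structure)
  assumes "cring R" "f \<in> carrier (free_module R B)"
  shows "\<exists>l. set l \<subseteq> carrier R \<times> B \<and> list_chain R l = f"
proof -
  interpret cring R by fact
  have "finite A \<Longrightarrow> A \<subseteq> B \<Longrightarrow>
      \<exists>l. set l \<subseteq> carrier R \<times> B \<and> list_chain R l = (\<lambda>x. if x \<in> A then f x else \<zero>)" for A
  proof (induction A rule: finite_induct)
    case empty
    show ?case by (rule exI[of _ "[]"]) (simp add: list_chain_def)
  next
    case (insert a A)
    then obtain l where l: "set l \<subseteq> carrier R \<times> B"
      "list_chain R l = (\<lambda>x. if x \<in> A then f x else \<zero>)" by auto
    have fc: "f x \<in> carrier R" for x using assms(2) by (simp add: free_module_def)
    have "list_chain R ((f a, a) # l) = (\<lambda>x. (if a = x then f a else \<zero>) \<oplus> list_chain R l x)"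
      by (auto simp: list_chain_def)
    then show ?case using l insert fc by (intro exI[of _ "(f a, a) # l"]) (auto simp: fun_eq_iff)
  qed
  moreover have "finite {x. f x \<noteq> \<zero>}" "{x. f x \<noteq> \<zero>} \<subseteq> B"
    using assms(2) by (auto simp: free_module_def)
  moreover have "(\<lambda>x. if x \<in> {x. f x \<noteq> \<zero>} then f x else \<zero>) = f" by auto
  ultimately show ?thesis by metis
qed

lemma (in module) finsum_linear:
  assumes "module R N" and "finite A" and "u \<in> A \<rightarrow> carrier M"
    and "\<And>x y. x \<in> carrier M \<Longrightarrow> y \<in> carrier M \<Longrightarrow> h (x \<oplus>\<^bsub>M\<^esub> y) = h x \<oplus>\<^bsub>N\<^esub> h y"
    and "\<And>x. x \<in> carrier M \<Longrightarrow> h x \<in> carrier N"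
    and "h \<zero>\<^bsub>M\<^esub> = \<zero>\<^bsub>N\<^esub>"
  shows "h (\<Oplus>\<^bsub>M\<^esub>x\<in>A. u x) = (\<Oplus>\<^bsub>N\<^esub>x\<in>A. h (u x))"
proof -
  interpret N: module R N by fact
  show ?thesis using assms(2,3)
    by (induction A rule: finite_induct) (use assms in \<open>auto simp: Pi_iff\<close>)
qed

lemma kernel_comp:
  assumes R: "cring R" and N: "module R N"
    and g: "g \<in> B \<rightarrow> carrier N"
    and bd: "\<And>c. c \<in> C \<Longrightarrow> bd c \<in> carrier (free_module R B) \<and> lin_ext R N g (bd c) = \<zero>\<^bsub>N\<^esub>"
    and f: "f \<in> carrier (free_module R C)"
  shows "lin_ext R N g (lin_ext R (free_module R B) bd f) = \<zero>\<^bsub>N\<^esub>"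
proof -
  interpret cring R by fact
  interpret N: module R N by fact
  interpret F: module R "free_module R B" by (rule free_module_module) (rule cring_axioms)
  have fc: "f x \<in> carrier R" for x using f by (simp add: free_module_def)
  have fs: "finite {x. f x \<noteq> \<zero>\<^bsub>R\<^esub>}" "{x. f x \<noteq> \<zero>\<^bsub>R\<^esub>} \<subseteq> C" using f by (auto simp: free_module_def)
  have "lin_ext R N g (lin_ext R (free_module R B) bd f) =
    (\<Oplus>\<^bsub>N\<^esub>x\<in>{x. f x \<noteq> \<zero>\<^bsub>R\<^esub>}. lin_ext R N g (f x \<odot>\<^bsub>free_module R B\<^esub> bd x))"
    unfolding lin_ext_def[of R "free_module R B"]
    apply (rule F.finsum_linear)
    subgoal by fact
    subgoal by fact
    subgoal using bd fc fs by (auto intro!: F.smult_closed)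
    subgoal by (rule N.lin_ext_add[OF _ _ g])
    subgoal by (rule N.lin_ext_closed[OF _ g])
    subgoal by (simp add: lin_ext_def free_module_def)
    done
  also have "\<dots> = (\<Oplus>\<^bsub>N\<^esub>x\<in>{x. f x \<noteq> \<zero>\<^bsub>R\<^esub>}. \<zero>\<^bsub>N\<^esub>)"
    apply (rule N.M.finsum_cong')
    using bd fc fs N.lin_ext_smult[OF _ _ g] by auto
  finally show ?thesis by simp
qed

lemma gen_value_closed: "gen_value \<in> res_basis R M 0 \<rightarrow> carrier M"
  by (auto simp: gen_value_def)

lemma cell_boundary_closed:
  assumes "cring R"
  shows "cell_boundary R \<in> res_basis R M (Suc n) \<rightarrow> carrier (res_module R M n)"
  using list_chain_closed[OF assms]
  by (cases n) (auto simp: cell_boundary_def res_module_def)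

lemma res_augmentation_surj:
  assumes "module R M"
  shows "res_augmentation R M ` carrier (res_module R M 0) = carrier M"
proof -
  interpret module R M by fact
  have "m \<in> res_augmentation R M ` carrier (res_module R M 0)" if "m \<in> carrier M" for m
  proof (rule image_eqI)
    show "m = res_augmentation R M (basis_elem R (Gen m))"
      unfolding res_augmentation_def using that
      by (subst lin_ext_basis_elem) (auto simp: gen_value_def)
    show "basis_elem R (Gen m) \<in> carrier (res_module R M 0)"
      using that by (auto simp: res_module_def intro!: basis_elem_closed R.cring_axioms)
  qed
  moreover have "res_augmentation R M f \<in> carrier M" if "f \<in> carrier (res_module R M 0)" for f
    using lin_ext_closed[OF _ gen_value_closed] that
    unfolding res_augmentation_def res_module_def by blast
  ultimately show ?thesis by blast
qed

lemma res_exact_0: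
  assumes "module R M"
  shows "res_differential R M 0 ` carrier (res_module R M 1) =
    {f \<in> carrier (res_module R M 0). res_augmentation R M f = \<zero>\<^bsub>M\<^esub>}"
proof -
  interpret module R M by fact
  have R: "cring R" ..
  interpret F: module R "res_module R M 0" unfolding res_module_def by (rule free_module_module[OF R])
  show ?thesis
  proof (intro equalityI subsetI)
    fix h assume "h \<in> res_differential R M 0 ` carrier (res_module R M 1)"
    then obtain f where f: "f \<in> carrier (res_module R M 1)" "h = res_differential R M 0 f" by auto
    have "res_augmentation R M h = \<zero>\<^bsub>M\<^esub>"
      unfolding f(2) res_augmentation_def res_differential_def res_module_def
      apply (rule kernel_comp[OF R assms gen_value_closed _ f(1)[unfolded res_module_def]])
      by (auto simp: cell_boundary_def simp del: res_basis.simps(1) intro!: list_chain_closed R)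
    moreover have "h \<in> carrier (res_module R M 0)"
      unfolding f(2) res_differential_def
      by (rule F.lin_ext_closed[OF f(1)[unfolded res_module_def]])
        (use cell_boundary_closed[OF R, of M 0] in \<open>simp del: res_basis.simps\<close>)
    ultimately show "h \<in> {f \<in> carrier (res_module R M 0). res_augmentation R M f = \<zero>\<^bsub>M\<^esub>}" by auto
  next
    fix f assume f: "f \<in> {f \<in> carrier (res_module R M 0). res_augmentation R M f = \<zero>\<^bsub>M\<^esub>}"
    then obtain l where l: "set l \<subseteq> carrier R \<times> res_basis R M 0" "list_chain R l = f"
      using list_chain_surj[OF R] by (auto simp: res_module_def simp del: res_basis.simps)
    have S: "Syz l \<in> res_basis R M 1" using l f by (auto simp: res_augmentation_def)
    have "f = res_differential R M 0 (basis_elem R (Syz l))"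
      unfolding res_differential_def
      by (subst F.lin_ext_basis_elem) (use l f in \<open>auto simp: cell_boundary_def\<close>)
    then show "f \<in> res_differential R M 0 ` carrier (res_module R M 1)"
      using basis_elem_closed[OF R S] by (auto simp: res_module_def)
  qed
qed

lemma res_exact_Suc:
  assumes "module R M"
  shows "res_differential R M (Suc n) ` carrier (res_module R M (Suc (Suc n))) =
    {f \<in> carrier (res_module R M (Suc n)). res_differential R M n f = \<zero>\<^bsub>res_module R M n\<^esub>}"
proof -
  interpret module R M by fact
  have R: "cring R" ..
  interpret F: module R "res_module R M (Suc n)"
    unfolding res_module_def by (rule free_module_module[OF R])
  have G: "module R (res_module R M n)" unfolding res_module_def by (rule free_module_module[OF R])
  show ?thesis
  proof (intro equalityI subsetI)
    fix h assume "h \<in> res_differential R M (Suc n) ` carrier (res_module R M (Suc (Suc n)))"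
    then obtain f where f: "f \<in> carrier (res_module R M (Suc (Suc n)))"
      "h = res_differential R M (Suc n) f" by auto
    have "res_differential R M n h = \<zero>\<^bsub>res_module R M n\<^esub>"
      unfolding f(2) res_differential_def res_module_def[of R M "Suc n"]
      apply (rule kernel_comp[OF R G cell_boundary_closed[OF R] _ f(1)[unfolded res_module_def]])
      by (auto simp: cell_boundary_def res_module_def intro!: list_chain_closed R)
    moreover have "h \<in> carrier (res_module R M (Suc n))"
      unfolding f(2) res_differential_def
      by (rule F.lin_ext_closed[OF f(1)[unfolded res_module_def] cell_boundary_closed[OF R]])
    ultimately show "h \<in> {f \<in> carrier (res_module R M (Suc n)).
        res_differential R M n f = \<zero>\<^bsub>res_module R M n\<^esub>}" by auto
  next
    fix f assume f: "f \<in> {f \<in> carrier (res_module R M (Suc n)).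
        res_differential R M n f = \<zero>\<^bsub>res_module R M n\<^esub>}"
    then obtain l where l: "set l \<subseteq> carrier R \<times> res_basis R M (Suc n)" "list_chain R l = f"
      using list_chain_surj[OF R] by (auto simp: res_module_def simp del: res_basis.simps)
    have S: "Syz l \<in> res_basis R M (Suc (Suc n))"
      using l f by (auto simp: res_differential_def res_module_def)
    have "f = res_differential R M (Suc n) (basis_elem R (Syz l))"
      unfolding res_differential_def
      by (subst F.lin_ext_basis_elem) (use l f in \<open>auto simp: cell_boundary_def\<close>)
    then show "f \<in> res_differential R M (Suc n) ` carrier (res_module R M (Suc (Suc n)))"
      using basis_elem_closed[OF R S] by (auto simp: res_module_def)
  qed
qed


section \<open>Tor\<close>

text \<open>The resolved argument is the second one.\<close>

definition Tor ::
  "('a, 'c) ring_scheme \<Rightarrow> nat \<Rightarrow> ('a, 'n, 'd) module_scheme \<Rightarrow> ('a, 'b, 'e) module_scheme \<Rightarrow>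
   ('a, ('n \<times> (('a, 'b) cell \<Rightarrow> 'a) \<Rightarrow> 'a) set set) module" where
  "Tor R n N M = homology
     (\<lambda>i. tensor_product R N (res_module R M i))
     (\<lambda>i. tensor_map R N (res_module R M i) (res_differential R M i)) n"

definition zero_module :: "('a, 'b, 'd) module_scheme \<Rightarrow> bool" where
  "zero_module M \<longleftrightarrow> carrier M = {\<zero>\<^bsub>M\<^esub>}"

end

theory Submission
  imports Defs
begin

text \<open>
  Let \<open>F\<close> be a free resolution of \<open>M\<close>. Clearing denominators,
  \<open>Tor\<^sub>i(k(p), M) = 0\<close> says that every \<open>f \<in> F\<^sub>i\<close> with \<open>d f \<in> p F\<close> has a multiple \<open>u f\<close>, \<open>u \<notin> p\<close>,
  in \<open>d F + p F\<close>, so that only ideals of \<open>R\<close> and coefficients of elements of free modules matter.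

  If \<open>n \<ge> dim R\<^sub>p\<close>, prime avoidance gives \<open>x\<^sub>1, \<dots>, x\<^sub>n \<in> p\<close> such that \<open>p\<close> is minimal over
  \<open>J\<^sub>s = (x\<^sub>1\<^sup>s, \<dots>, x\<^sub>n\<^sup>s)\<close> for all \<open>s \<ge> 1\<close>. By devissage, \<open>Tor\<^sub>n(k(p), M) = 0\<close> implies that
  \<open>Tor\<^sub>n(p/J, M)\<close> vanishes at \<open>p\<close> for every ideal \<open>J\<close> over which \<open>p\<close> is minimal, so that
  \<open>Tor\<^sub>n\<^sub>+\<^sub>1(R/J\<^sub>s, M) \<rightarrow> Tor\<^sub>n\<^sub>+\<^sub>1(R/p, M)\<close> is surjective at \<open>p\<close> for all \<open>s\<close>. On the other hand
  \<open>Tor\<^sub>i(R/J\<^sub>s, M) \<rightarrow> Tor\<^sub>i(R/J\<^sub>1, M)\<close> is zero for \<open>s\<close> large as soon as \<open>i > n\<close>, by induction on \<open>n\<close>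
  and the stabilization of \<open>(J : x\<^sup>k)\<close>. Hence \<open>Tor\<^sub>n\<^sub>+\<^sub>1(k(p), M) = 0\<close>.
\<close>

text \<open>The obstacle is that M is arbitrary, so Nakayama's lemma and minimal resolutions are out
  of reach. If x_1, ..., x_n were a regular sequence, R/J_1 would have a resolution of length n and
  Tor_{n+1}(R/J_1, M) would be zero. In general only the transition maps between the levels s
  vanish, because each x_i may have power torsion modulo the others; this torsion is bounded, and
  raising s absorbs it. Raising s costs nothing on the other side, since the primes over J_s do not
  depend on s. The composite Tor_{n+1}(R/J_s, M) -> Tor_{n+1}(R/J_1, M) -> Tor_{n+1}(R/p, M) is then
  both zero and onto at p.

  No long exact sequence is formed. The sequences that matter are 0 -> R/(J : a) -> R/J -> R/(J +
  Ra) -> 0, and for free modules both outer terms can be read off coefficients. Connecting maps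
  become equations d z = j + a w with j in J F, and localization at p becomes a multiplier u outside
  p.\<close>

section \<open>Ideals of a Noetherian ring\<close>

text \<open>A nonempty chain of ideals contains its union, so Zorn's lemma gives a maximal
  counterexample, which \<open>step\<close> refutes. The devissage below uses this in place of an
  induction on length.\<close>

lemma (in noetherian_ring) noetherian_induct [consumes 1, case_names step]:
  assumes "ideal J R"
    and step: "\<And>J. ideal J R \<Longrightarrow> (\<And>K. ideal K R \<Longrightarrow> J \<subset> K \<Longrightarrow> P K) \<Longrightarrow> P J"
  shows "P J"
proof (rule ccontr)
  assume "\<not> P J"
  define \<F> where "\<F> = {J. ideal J R \<and> \<not> P J}"
  have "\<F> \<noteq> {}" using assms(1) \<open>\<not> P J\<close> by (auto simp: \<F>_def)
  have "\<exists>K\<in>\<F>. \<forall>L\<in>\<F>. K \<subseteq> L \<longrightarrow> L = K"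
  proof (rule subset_Zorn_nonempty[OF \<open>\<F> \<noteq> {}\<close>])
    fix C assume C: "C \<noteq> {}" "subset.chain \<F> C"
    then have "subset.chain {I. ideal I R} C"
      by (auto simp: subset_chain_def \<F>_def)
    then show "\<Union>C \<in> \<F>"
      using ideal_chain_is_trivial[OF C(1)] C(2) by (auto simp: subset_chain_def)
  qed
  then obtain K where "K \<in> \<F>" "\<And>L. L \<in> \<F> \<Longrightarrow> K \<subseteq> L \<Longrightarrow> L = K" by blast
  then show False using step[of K] by (auto simp: \<F>_def)
qed

section \<open>Sums, colon ideals and primes in a commutative ring\<close>

context cring begin

text \<open>The ideal J + Ra, written out as sums and not as a generated ideal, because later
  arguments start by splitting a coefficient into its two summands.\<close>

definition adjoin :: "'a set \<Rightarrow> 'a \<Rightarrow> 'a set" where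
  "adjoin J a = {j \<oplus> r \<otimes> a | j r. j \<in> J \<and> r \<in> carrier R}"

text \<open>The colon ideal (J : a); multiplication by a identifies R/(J : a) with (J +
  Ra)/J.\<close>

definition colon :: "'a set \<Rightarrow> 'a \<Rightarrow> 'a set" where
  "colon J a = {r \<in> carrier R. a \<otimes> r \<in> J}"

lemma ideal_of_closed:
  assumes "J \<subseteq> carrier R" "\<zero> \<in> J"
    and "\<And>a b. a \<in> J \<Longrightarrow> b \<in> J \<Longrightarrow> a \<oplus> b \<in> J"
    and "\<And>a r. a \<in> J \<Longrightarrow> r \<in> carrier R \<Longrightarrow> r \<otimes> a \<in> J"
  shows "ideal J R"
proof (rule idealI)
  show "subgroup J (add_monoid R)"
  proof (rule add.subgroupI)
    show "\<ominus> a \<in> J" if "a \<in> J" for a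
      using assms(4)[OF that, of "\<ominus> \<one>"] that assms(1) by (auto simp: l_minus)
  qed (use assms in auto)
  show "a \<otimes> x \<in> J" if "a \<in> J" "x \<in> carrier R" for a x
    using assms(4)[OF that] that assms(1) m_comm by (metis subsetD)
qed (use assms in \<open>auto intro: ring_axioms\<close>)

lemma ideal_closed:
  assumes "ideal J R"
  shows "J \<subseteq> carrier R" "\<zero> \<in> J"
    and "\<And>a b. a \<in> J \<Longrightarrow> b \<in> J \<Longrightarrow> a \<oplus> b \<in> J"
    and "\<And>a. a \<in> J \<Longrightarrow> \<ominus> a \<in> J"
    and "\<And>a r. a \<in> J \<Longrightarrow> r \<in> carrier R \<Longrightarrow> r \<otimes> a \<in> J"
proof -
  interpret ideal J R by fact
  show "J \<subseteq> carrier R" "\<zero> \<in> J"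
    "\<And>a b. a \<in> J \<Longrightarrow> b \<in> J \<Longrightarrow> a \<oplus> b \<in> J" "\<And>a. a \<in> J \<Longrightarrow> \<ominus> a \<in> J"
    "\<And>a r. a \<in> J \<Longrightarrow> r \<in> carrier R \<Longrightarrow> r \<otimes> a \<in> J"
    using a_subset by (auto intro: I_l_closed)
qed

lemma adjoin_ideal:
  assumes "ideal J R" "a \<in> carrier R" shows "ideal (adjoin J a) R"
proof (rule ideal_of_closed)
  note J = ideal_closed[OF assms(1)]
  note [simp] = subsetD[OF J(1)]
  show "adjoin J a \<subseteq> carrier R" using assms(2) by (auto simp: adjoin_def)
  show "\<zero> \<in> adjoin J a"
    unfolding adjoin_def by (rule CollectI, rule exI[of _ \<zero>], rule exI[of _ \<zero>]) (use J(2) assms(2) in simp)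
  fix x assume "x \<in> adjoin J a"
  then obtain j r where x: "x = j \<oplus> r \<otimes> a" "j \<in> J" "r \<in> carrier R" by (auto simp: adjoin_def)
  {
    fix y assume "y \<in> adjoin J a"
    then obtain k s where y: "y = k \<oplus> s \<otimes> a" "k \<in> J" "s \<in> carrier R" by (auto simp: adjoin_def)
    have "j \<in> carrier R" "k \<in> carrier R" using x y by auto
    then have "x \<oplus> y = (j \<oplus> k) \<oplus> (r \<oplus> s) \<otimes> a" unfolding x(1) y(1) using x(3) y(3) assms(2) by algebra
    then show "x \<oplus> y \<in> adjoin J a" using x y J(3) by (auto simp: adjoin_def)
  }
  fix s assume s: "s \<in> carrier R"
  have "j \<in> carrier R" using x by auto
  then have "s \<otimes> x = s \<otimes> j \<oplus> (s \<otimes> r) \<otimes> a" unfolding x(1) using x(3) s assms(2) by algebra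
  then show "s \<otimes> x \<in> adjoin J a" using x s J(5) by (auto simp: adjoin_def)
qed

lemma adjoin_subset: "a \<in> carrier R \<Longrightarrow> J \<subseteq> carrier R \<Longrightarrow> J \<subseteq> adjoin J a"
proof
  fix j assume "a \<in> carrier R" "J \<subseteq> carrier R" "j \<in> J"
  then show "j \<in> adjoin J a"
    unfolding adjoin_def by (intro CollectI exI[of _ j] exI[of _ \<zero>]) auto
qed

lemma adjoin_mem: "ideal J R \<Longrightarrow> a \<in> carrier R \<Longrightarrow> a \<in> adjoin J a"
  unfolding adjoin_def using ideal_closed(2)[of J] by (intro CollectI exI[of _ \<zero>] exI[of _ \<one>]) auto

lemma adjoin_least:
  assumes "ideal K R" "J \<subseteq> K" "a \<in> K" shows "adjoin J a \<subseteq> K"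
  using assms(2,3) ideal_closed[OF assms(1)] by (auto simp: adjoin_def)

lemma colon_ideal:
  assumes "ideal J R" "a \<in> carrier R" shows "ideal (colon J a) R"
proof (rule ideal_of_closed)
  note J = ideal_closed[OF assms(1)]
  show "s \<otimes> x \<in> colon J a" if "x \<in> colon J a" "s \<in> carrier R" for x s
    using that J(5)[of "a \<otimes> x" s] assms(2) by (auto simp: colon_def m_lcomm)
qed (use ideal_closed[OF assms(1)] assms(2) in \<open>auto simp: colon_def r_distr\<close>)

lemma colon_superset: "ideal J R \<Longrightarrow> a \<in> carrier R \<Longrightarrow> J \<subseteq> colon J a"
  using ideal_closed[of J] by (auto simp: colon_def)

lemma primeideal_unit_complement:
  assumes "primeideal p R"
  shows "\<one> \<in> carrier R - p"
    and "\<And>u v. u \<in> carrier R - p \<Longrightarrow> v \<in> carrier R - p \<Longrightarrow> u \<otimes> v \<in> carrier R - p"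
proof -
  interpret primeideal p R by fact
  show "\<one> \<in> carrier R - p" using one_imp_carrier I_notcarr by auto
  show "\<And>u v. u \<in> carrier R - p \<Longrightarrow> v \<in> carrier R - p \<Longrightarrow> u \<otimes> v \<in> carrier R - p"
    using I_prime by auto
qed

lemma prime_pow_mem:
  assumes "primeideal p R" "a \<in> carrier R" "a [^] (k::nat) \<in> p" shows "a \<in> p"
proof -
  interpret primeideal p R by fact
  show ?thesis using assms(3)
  proof (induction k)
    case 0
    then show ?case using primeideal_unit_complement(1)[OF assms(1)] by simp
  next
    case (Suc k)
    then show ?case using I_prime[of "a [^] k" a] assms(2) by auto
  qed
qed

lemma nonprime_witness:
  assumes "ideal J R" "J \<noteq> carrier R" "\<not> primeideal J R"
  obtains a b where "a \<in> carrier R" "b \<in> carrier R" "a \<otimes> b \<in> J" "a \<notin> J" "b \<notin> J"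
proof (rule ccontr)
  note w = that
  assume c: "\<not> thesis"
  have "a \<in> J \<or> b \<in> J" if "a \<in> carrier R" "b \<in> carrier R" "a \<otimes> b \<in> J" for a b
    using c w[of a b] that(1,2,3) by metis
  then have "primeideal J R"
    using assms(2) by (intro primeidealI[OF assms(1) cring_axioms]) auto
  then show False using assms(3) by blast
qed

text \<open>The exponents stay uniform, so that the towers for \<open>y # ys\<close> and \<open>ys\<close> share their index.\<close>

primrec pow_ideal :: "'a list \<Rightarrow> nat \<Rightarrow> 'a set" where
  "pow_ideal [] s = {\<zero>}"
| "pow_ideal (y # ys) s = adjoin (pow_ideal ys s) (y [^] s)"

lemma pow_ideal_ideal: "set xs \<subseteq> carrier R \<Longrightarrow> ideal (pow_ideal xs s) R"
  by (induction xs) (auto intro!: zeroideal adjoin_ideal)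

lemma pow_ideal_antimono:
  assumes "set xs \<subseteq> carrier R" "s \<le> t" shows "pow_ideal xs t \<subseteq> pow_ideal xs s"
  using assms(1)
proof (induction xs)
  case (Cons y ys)
  have c: "y \<in> carrier R" "set ys \<subseteq> carrier R" using Cons.prems by auto
  have id: "ideal (pow_ideal (y # ys) s) R" by (rule pow_ideal_ideal[OF Cons.prems])
  have "y [^] t = y [^] (t - s) \<otimes> y [^] s" using c assms(2) by (simp add: nat_pow_mult)
  moreover have "y [^] s \<in> pow_ideal (y # ys) s"
    using adjoin_mem pow_ideal_ideal c by simp
  ultimately have "y [^] t \<in> pow_ideal (y # ys) s"
    using ideal_closed(5)[OF id] c by simp
  moreover have "pow_ideal ys s \<subseteq> pow_ideal (y # ys) s"
    using adjoin_subset ideal_closed(1)[OF pow_ideal_ideal] c by simp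
  ultimately show ?case using Cons.IH[OF c(2)] adjoin_least[OF id] by auto
qed simp

text \<open>A prime does not distinguish y from y^s for positive s. Hence minimality of p over one
  level of the tower passes to all positive levels.\<close>

lemma pow_ideal_subset_prime:
  assumes "primeideal p R" "set xs \<subseteq> carrier R" "0 < s"
  shows "pow_ideal xs s \<subseteq> p \<longleftrightarrow> set xs \<subseteq> p"
  using assms(2)
proof (induction xs)
  case Nil
  then show ?case using ideal_closed(2)[OF primeideal.axioms(1)[OF assms(1)]] by simp
next
  case (Cons y ys)
  have p: "ideal p R" using assms(1) by (rule primeideal.axioms(1))
  have c: "y \<in> carrier R" "set ys \<subseteq> carrier R" using Cons.prems by auto
  note K = pow_ideal_ideal[OF c(2), of s]
  have "adjoin (pow_ideal ys s) (y [^] s) \<subseteq> p \<longleftrightarrow> pow_ideal ys s \<subseteq> p \<and> y [^] s \<in> p"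
    using adjoin_least[OF p] adjoin_subset[of "y [^] s" "pow_ideal ys s"] ideal_closed(1)[OF K]
      adjoin_mem[OF K] c by blast
  moreover have "y [^] s \<in> p \<longleftrightarrow> y \<in> p"
  proof
    assume "y \<in> p"
    then show "y [^] s \<in> p"
      using ideal_closed(5)[OF p, of y "y [^] (s - 1)"] c assms(3) by (cases s) auto
  qed (use prime_pow_mem assms(1) c in blast)
  ultimately show ?case using Cons.IH[OF c(2)] by auto
qed

text \<open>In the essential case no other member of the family lies below Q. Some x in J avoids all
  members but Q. If x is in Q, a product y of an element of J outside Q with one element of each
  other member outside Q lies in J and in every other member, but not in Q, as Q is prime. Then x +
  y avoids them all.\<close>

lemma prime_avoidance:
  assumes "finite \<Q>" "\<And>Q. Q \<in> \<Q> \<Longrightarrow> primeideal Q R" "ideal J R" "\<And>Q. Q \<in> \<Q> \<Longrightarrow> \<not> J \<subseteq> Q"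
  shows "\<exists>x\<in>J. \<forall>Q\<in>\<Q>. x \<notin> Q"
  using assms(1,2,4)
proof (induction \<Q> rule: finite_psubset_induct)
  case (psubset \<Q>)
  note J = ideal_closed[OF assms(3)]
  show ?case
  proof (cases "\<Q> = {}")
    case True
    then show ?thesis using J(2) by auto
  next
    case False
    then obtain Q where Q: "Q \<in> \<Q>" by blast
    have IH: "\<exists>x\<in>J. \<forall>Q''\<in>\<Q> - {Q'}. x \<notin> Q''" if "Q' \<in> \<Q>" for Q'
    proof (rule psubset.IH)
      show "\<Q> - {Q'} \<subset> \<Q>" using that by blast
    qed (use psubset.prems in auto)
    show ?thesis
    proof (cases "\<exists>Q'\<in>\<Q>. Q' \<noteq> Q \<and> Q' \<subseteq> Q")
      case True
      then obtain Q' where Q': "Q' \<in> \<Q>" "Q' \<noteq> Q" "Q' \<subseteq> Q" by blast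
      \<comment> \<open>Leaving out the smaller prime \<open>Q'\<close> is harmless: what avoids
        \<open>Q\<close> avoids \<open>Q'\<close>.\<close>
      obtain x where "x \<in> J" "\<forall>Q''\<in>\<Q> - {Q'}. x \<notin> Q''" using IH[OF Q'(1)] by blast
      then show ?thesis using Q Q' by (intro bexI[of _ x]) auto
    next
      case incomparable: False
      obtain x where x: "x \<in> J" "\<forall>Q'\<in>\<Q> - {Q}. x \<notin> Q'" using IH[OF Q] by blast
      show ?thesis
      proof (cases "x \<in> Q")
        case False
        then show ?thesis using x by (intro bexI[of _ x]) auto
      next
        case True
        have pQ: "primeideal Q R" using psubset.prems Q by blast
        then interpret Q: primeideal Q R .
        have "\<exists>y\<in>J. y \<notin> Q \<and> (\<forall>Q'\<in>\<T>. y \<in> Q')" if "finite \<T>" "\<T> \<subseteq> \<Q> - {Q}" for \<T>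
          using that
        proof (induction \<T> rule: finite_induct)
          case empty
          then show ?case using psubset.prems(2)[OF Q] by auto
        next
          case (insert T \<T>)
          then obtain y where y: "y \<in> J" "y \<notin> Q" "\<forall>Q'\<in>\<T>. y \<in> Q'" by auto
          have T: "T \<in> \<Q>" "T \<noteq> Q" using insert.prems by auto
          then obtain z where z: "z \<in> T" "z \<notin> Q" using incomparable by blast
          have idT: "ideal Q' R" if "Q' \<in> \<Q>" for Q'
            using psubset.prems(1)[OF that] by (rule primeideal.axioms(1))
          have c: "y \<in> carrier R" "z \<in> carrier R"
            using y(1) J(1) z(1) ideal_closed(1)[OF idT[OF T(1)]] by auto
          have "z \<otimes> y \<notin> Q" using Q.I_prime[OF c(2) c(1)] y z by blast
          moreover have "z \<otimes> y \<in> T" using ideal_closed(5)[OF idT[OF T(1)] z(1) c(1)] c m_comm by simp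
          moreover have "z \<otimes> y \<in> Q'" if "Q' \<in> \<T>" for Q'
            using ideal_closed(5)[OF idT, of Q' y z] that insert.prems y c by blast
          moreover have "z \<otimes> y \<in> J" using J(5) y c by blast
          ultimately show ?case by blast
        qed
        from this[of "\<Q> - {Q}"] obtain y where
          y: "y \<in> J" "y \<notin> Q" "\<forall>Q'\<in>\<Q> - {Q}. y \<in> Q'" using psubset.hyps by auto
        have sum: "b \<in> Q'" if "primeideal Q' R" "a \<in> Q'" "a \<oplus> b \<in> Q'" "b \<in> carrier R" for a b Q'
        proof -
          have i: "ideal Q' R" using that(1) by (rule primeideal.axioms(1))
          have "a \<in> carrier R" using ideal_closed(1)[OF i] that(2) by blast
          then have "b = \<ominus> a \<oplus> (a \<oplus> b)" using that(4) by algebra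
          then show ?thesis using ideal_closed(3)[OF i ideal_closed(4)[OF i that(2)] that(3)] by metis
        qed
        have c: "x \<in> carrier R" "y \<in> carrier R" using x y J(1) by auto
        have "x \<oplus> y \<notin> Q" using sum[OF pQ True _ c(2)] y(2) by blast
        moreover have "x \<oplus> y \<notin> Q'" if "Q' \<in> \<Q> - {Q}" for Q'
          using sum[of Q' y x] psubset.prems(1)[of Q'] that c x y by (auto simp: a_comm)
        moreover have "x \<oplus> y \<in> J" using J(3) x y by blast
        ultimately show ?thesis by (intro bexI[of _ "x \<oplus> y"]) auto
      qed
    qed
  qed
qed

text \<open>Says that the height of \<open>Q\<close> is at least \<open>k\<close>. Lower bounds
  suffice for the argument, so height is not introduced as a number.\<close>

definition prime_chain_below :: "nat \<Rightarrow> 'a set \<Rightarrow> bool" where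
  "prime_chain_below k Q \<longleftrightarrow> (\<exists>P :: nat \<Rightarrow> 'a set.
     (\<forall>i\<le>k. primeideal (P i) R) \<and> (\<forall>i<k. P i \<subset> P (Suc i)) \<and> P k = Q)"

lemma prime_chain_below_0: "primeideal Q R \<Longrightarrow> prime_chain_below 0 Q"
  unfolding prime_chain_below_def by (rule exI[of _ "\<lambda>_. Q"]) auto

lemma prime_chain_below_Suc:
  assumes "prime_chain_below k Q" "Q \<subset> Q'" "primeideal Q' R"
  shows "prime_chain_below (Suc k) Q'"
proof -
  obtain P where "\<forall>i\<le>k. primeideal (P i) R" "\<forall>i<k. P i \<subset> P (Suc i)" "P k = Q"
    using assms(1) by (auto simp: prime_chain_below_def)
  then show ?thesis using assms(2,3) unfolding prime_chain_below_def
    by (intro exI[of _ "P(Suc k := Q')"]) (auto simp: le_Suc_eq less_Suc_eq)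
qed

end

section \<open>Consequences of the ascending chain condition\<close>

locale noetherian_cring = cring R + noetherian_ring R for R (structure)
begin

text \<open>The ideals (J : y^m) increase with m, so their union is one of them, and
  \<open>c\<close> is its exponent. It is uniform in \<open>r\<close>, so it serves all coefficients
  of an element of a free module at once.\<close>

lemma colon_power_stable:
  assumes "ideal J R" "y \<in> carrier R"
  shows "\<exists>c. \<forall>m r. r \<in> carrier R \<longrightarrow> y [^] (m::nat) \<otimes> r \<in> J \<longrightarrow> y [^] (c::nat) \<otimes> r \<in> J"
proof -
  define C where "C = range (\<lambda>m::nat. colon J (y [^] m))"
  have mono: "colon J (y [^] m) \<subseteq> colon J (y [^] m')" if "m \<le> m'" for m m' :: nat
  proof
    fix r assume r: "r \<in> colon J (y [^] m)"
    have "y [^] m' = y [^] (m' - m) \<otimes> y [^] m" using that assms(2) by (simp add: nat_pow_mult)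
    then have "y [^] m' \<otimes> r = y [^] (m' - m) \<otimes> (y [^] m \<otimes> r)"
      using r assms(2) by (simp add: colon_def m_assoc)
    then show "r \<in> colon J (y [^] m')"
      using r ideal_closed(5)[OF assms(1), of "y [^] m \<otimes> r" "y [^] (m' - m)"] assms(2)
      by (simp add: colon_def)
  qed
  have "subset.chain {I. ideal I R} C"
  proof (unfold subset_chain_def, intro conjI ballI)
    show "C \<subseteq> {I. ideal I R}" using colon_ideal[OF assms(1)] assms(2) by (auto simp: C_def)
    fix U V assume "U \<in> C" "V \<in> C"
    then obtain m m' where "U = colon J (y [^] (m::nat))" "V = colon J (y [^] (m'::nat))"
      by (auto simp: C_def)
    then show "U \<subseteq> V \<or> V \<subseteq> U" using mono nat_le_linear[of m m'] by blast
  qed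
  then have "\<Union>C \<in> C" by (rule ideal_chain_is_trivial[rotated]) (auto simp: C_def)
  then obtain c where c: "\<Union>C = colon J (y [^] (c::nat))" by (auto simp: C_def)
  have "y [^] c \<otimes> r \<in> J" if "r \<in> carrier R" "y [^] m \<otimes> r \<in> J" for m :: nat and r
  proof -
    have "r \<in> \<Union>C" using that by (auto simp: C_def colon_def)
    then show ?thesis unfolding c by (simp add: colon_def)
  qed
  then show ?thesis by blast
qed

text \<open>If ab lies in J but a and b do not, a prime over J contains J + Ra or J + Rb, and both
  are larger than J. The family obtained contains the minimal primes of J but may be larger, which
  prime avoidance tolerates.\<close>

lemma finitely_many_covering_primes:
  assumes "ideal J R"
  shows "\<exists>\<Q>. finite \<Q> \<and> (\<forall>Q\<in>\<Q>. primeideal Q R \<and> J \<subseteq> Q) \<and>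
    (\<forall>P. primeideal P R \<longrightarrow> J \<subseteq> P \<longrightarrow> (\<exists>Q\<in>\<Q>. Q \<subseteq> P))"
  using assms
proof (induction J rule: noetherian_induct)
  case (step J)
  note J = ideal_closed[OF step(1)]
  consider "J = carrier R" | "primeideal J R"
    | a b where "a \<in> carrier R" "b \<in> carrier R" "a \<otimes> b \<in> J" "a \<notin> J" "b \<notin> J"
    using nonprime_witness[OF step(1)] by blast
  then show ?case
  proof cases
    case 1
    have "\<not> J \<subseteq> P" if "primeideal P R" for P
      using primeideal.I_notcarr[OF that] ideal_closed(1)[OF primeideal.axioms(1)[OF that]] 1 by blast
    then show ?thesis by (intro exI[of _ "{}"]) auto
  next
    case 2
    then show ?thesis by (intro exI[of _ "{J}"]) auto
  next
    case 3
    have sub: "J \<subset> adjoin J c" if "c \<in> carrier R" "c \<notin> J" for c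
      using adjoin_subset[OF that(1) J(1)] adjoin_mem[OF step(1) that(1)] that by blast
    note cover = step(2)[OF adjoin_ideal[OF step(1)] sub]
    obtain \<A> where A: "finite \<A>" "\<forall>Q\<in>\<A>. primeideal Q R \<and> adjoin J a \<subseteq> Q"
      "\<forall>P. primeideal P R \<longrightarrow> adjoin J a \<subseteq> P \<longrightarrow> (\<exists>Q\<in>\<A>. Q \<subseteq> P)"
      using cover[OF 3(1) 3(1) 3(4)] by auto
    obtain \<B> where B: "finite \<B>" "\<forall>Q\<in>\<B>. primeideal Q R \<and> adjoin J b \<subseteq> Q"
      "\<forall>P. primeideal P R \<longrightarrow> adjoin J b \<subseteq> P \<longrightarrow> (\<exists>Q\<in>\<B>. Q \<subseteq> P)"
      using cover[OF 3(2) 3(2) 3(5)] by auto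
    have "\<exists>Q\<in>\<A> \<union> \<B>. Q \<subseteq> P" if P: "primeideal P R" "J \<subseteq> P" for P
    proof -
      have "a \<in> P \<or> b \<in> P" using primeideal.I_prime[OF P(1)] 3 P(2) by blast
      then have "adjoin J a \<subseteq> P \<or> adjoin J b \<subseteq> P"
        using adjoin_least[OF primeideal.axioms(1)[OF P(1)] P(2)] by blast
      then show ?thesis using A(3) B(3) P(1) by blast
    qed
    moreover have "primeideal Q R \<and> J \<subseteq> Q" if "Q \<in> \<A> \<union> \<B>" for Q
      using that A(2) B(2) sub[OF 3(1) 3(4)] sub[OF 3(2) 3(5)]
      by (meson UnE psubset_imp_subset subset_trans)
    ultimately show ?thesis using A(1) B(1) by (intro exI[of _ "\<A> \<union> \<B>"]) auto
  qed
qed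

text \<open>Each new element avoids the finitely many primes strictly below \<open>p\<close> that cover the ideal
  generated so far, so that the remaining primes below \<open>p\<close> gain height.\<close>

lemma exists_height_raising_sequence:
  assumes "primeideal p R"
  shows "\<exists>xs. length xs = k \<and> set xs \<subseteq> p \<and>
    (\<forall>P. primeideal P R \<longrightarrow> set xs \<subseteq> P \<longrightarrow> P \<subset> p \<longrightarrow> prime_chain_below k P)"
proof (induction k)
  case 0
  then show ?case by (auto simp: prime_chain_below_0)
next
  case (Suc k)
  then obtain xs where xs: "length xs = k" "set xs \<subseteq> p"
    "\<And>P. primeideal P R \<Longrightarrow> set xs \<subseteq> P \<Longrightarrow> P \<subset> p \<Longrightarrow> prime_chain_below k P" by blast
  have p: "ideal p R" using assms by (rule primeideal.axioms(1))
  have c: "set xs \<subseteq> carrier R" using xs(2) ideal_closed(1)[OF p] by blast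
  obtain \<Q> where Q: "finite \<Q>" "\<forall>Q\<in>\<Q>. primeideal Q R \<and> pow_ideal xs 1 \<subseteq> Q"
    "\<forall>P. primeideal P R \<longrightarrow> pow_ideal xs 1 \<subseteq> P \<longrightarrow> (\<exists>Q\<in>\<Q>. Q \<subseteq> P)"
    using finitely_many_covering_primes[OF pow_ideal_ideal[OF c, of 1]] by auto
  have "\<exists>x\<in>p. \<forall>Q\<in>{Q\<in>\<Q>. Q \<subset> p}. x \<notin> Q"
    by (rule prime_avoidance) (use Q p in auto)
  then obtain x where x: "x \<in> p" "\<And>Q. Q \<in> \<Q> \<Longrightarrow> Q \<subset> p \<Longrightarrow> x \<notin> Q" by auto
  have "prime_chain_below (Suc k) P" if P: "primeideal P R" "set (x # xs) \<subseteq> P" "P \<subset> p" for P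
  proof -
    have "pow_ideal xs 1 \<subseteq> P" using pow_ideal_subset_prime[OF P(1) c] P(2) by simp
    then obtain S where S: "S \<in> \<Q>" "S \<subseteq> P" using Q(3) P(1) by blast
    have pS: "primeideal S R" using Q(2) S by blast
    then have "set xs \<subseteq> S" using pow_ideal_subset_prime[OF pS c, of 1] Q(2) S by auto
    moreover have "S \<subset> p" using S(2) P(3) by auto
    ultimately have "prime_chain_below k S" "x \<notin> S" using xs(3) pS x(2) S(1) by auto
    \<comment> \<open>\<open>x\<close> lies in \<open>P\<close> but not in \<open>S\<close>, so
      \<open>S\<close> is strictly below \<open>P\<close> and its chain can be prolonged by
      \<open>P\<close>.\<close>
    then show ?thesis using prime_chain_below_Suc[of k S P] P S by auto
  qed
  then show ?case using xs x by (intro exI[of _ "x # xs"]) auto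
qed

end

section \<open>Complexes of free modules\<close>

text \<open>Turns the coefficientwise condition "all f x lie in J" into a finite sum of terms r b
  with r in J, by letting the support grow one basis element at a time. This is how statements about
  J F are reduced to linearity.\<close>

lemma free_module_ideal_induct [consumes 3, case_names zero step]:
  fixes R (structure)
  assumes "cring R" and f: "f \<in> carrier (free_module R B)" and J: "\<And>x. f x \<in> J"
    and zero: "P \<zero>\<^bsub>free_module R B\<^esub>"
    and step: "\<And>r b g. r \<in> J \<Longrightarrow> r \<in> carrier R \<Longrightarrow> b \<in> B \<Longrightarrow> g \<in> carrier (free_module R B) \<Longrightarrow> P g \<Longrightarrow>
      P (r \<odot>\<^bsub>free_module R B\<^esub> basis_elem R b \<oplus>\<^bsub>free_module R B\<^esub> g)"
  shows "P f"
proof -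
  interpret cring R by fact
  have c: "f x \<in> carrier R" for x using f by (simp add: free_module_def)
  have "P (\<lambda>x. if x \<in> A then f x else \<zero>)" if "finite A" "A \<subseteq> B" for A
    using that
  proof (induction A rule: finite_induct)
    case empty
    then show ?case using assms(4) by (simp add: free_module_def)
  next
    case (insert a A)
    have "(\<lambda>x. if x \<in> A then f x else \<zero>) \<in> carrier (free_module R B)"
      using c insert by (auto simp: free_module_def)
    moreover have "(\<lambda>x. if x \<in> insert a A then f x else \<zero>) =
      f a \<odot>\<^bsub>free_module R B\<^esub> basis_elem R a \<oplus>\<^bsub>free_module R B\<^esub> (\<lambda>x. if x \<in> A then f x else \<zero>)"
      using c insert.hyps by (auto simp: fun_eq_iff free_module_def basis_elem_def)
    ultimately show ?case using step[OF J c] insert by simp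
  qed
  moreover have "finite {x. f x \<noteq> \<zero>}" "{x. f x \<noteq> \<zero>} \<subseteq> B"
    using f by (auto simp: free_module_def)
  moreover have "(\<lambda>x. if x \<in> {x. f x \<noteq> \<zero>} then f x else \<zero>) = f" by auto
  ultimately show ?thesis by metis
qed

lemma (in module) submodule_cancel:
  assumes "submodule H R M" "x \<in> carrier M" "h \<in> H" "x \<oplus>\<^bsub>M\<^esub> h \<in> H"
  shows "x \<in> H"
proof -
  have "h \<in> carrier M" using submoduleE(1)[OF assms(1)] assms(3) by blast
  then have "x = x \<oplus>\<^bsub>M\<^esub> h \<oplus>\<^bsub>M\<^esub> \<ominus>\<^bsub>M\<^esub> h" using assms(2) by (simp add: M.a_assoc M.r_neg)
  then show ?thesis using submoduleE(3,5)[OF assms(1)] assms(3,4) by metis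
qed

lemma (in module) submodule_of_closed:
  assumes "H \<subseteq> carrier M" "\<zero>\<^bsub>M\<^esub> \<in> H"
    and "\<And>a b. a \<in> H \<Longrightarrow> b \<in> H \<Longrightarrow> a \<oplus>\<^bsub>M\<^esub> b \<in> H"
    and "\<And>r x. r \<in> carrier R \<Longrightarrow> x \<in> H \<Longrightarrow> r \<odot>\<^bsub>M\<^esub> x \<in> H"
  shows "submodule H R M"
proof (rule submoduleI)
  show "\<ominus>\<^bsub>M\<^esub> a \<in> H" if "a \<in> H" for a
    using assms(4)[of "\<ominus> \<one>" a] that assms(1) by (simp add: smult_l_minus subset_iff)
qed (use assms in auto)

lemma (in module) zero_mem_submodule:
  assumes "submodule H R M" shows "\<zero>\<^bsub>M\<^esub> \<in> H"
  using submodule.axioms(1)[OF assms] subgroup.one_closed by fastforce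

text \<open>Exactness is asked in positive degrees, so that every free resolution fits once its
  augmentation is dropped.\<close>

locale free_complex = cring R for R (structure) +
  fixes B :: "nat \<Rightarrow> 'x set" and d :: "nat \<Rightarrow> ('x \<Rightarrow> 'a) \<Rightarrow> 'x \<Rightarrow> 'a"
  assumes d_closed: "\<And>i f. f \<in> carrier (free_module R (B (Suc i))) \<Longrightarrow> d i f \<in> carrier (free_module R (B i))"
    and d_add: "\<And>i f g. f \<in> carrier (free_module R (B (Suc i))) \<Longrightarrow>
      g \<in> carrier (free_module R (B (Suc i))) \<Longrightarrow>
      d i (f \<oplus>\<^bsub>free_module R (B (Suc i))\<^esub> g) = d i f \<oplus>\<^bsub>free_module R (B i)\<^esub> d i g"
    and d_smult: "\<And>i r f. r \<in> carrier R \<Longrightarrow> f \<in> carrier (free_module R (B (Suc i))) \<Longrightarrow>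
      d i (r \<odot>\<^bsub>free_module R (B (Suc i))\<^esub> f) = r \<odot>\<^bsub>free_module R (B i)\<^esub> d i f"
    and d_exact: "\<And>i. d (Suc i) ` carrier (free_module R (B (Suc (Suc i)))) =
      {f \<in> carrier (free_module R (B (Suc i))). d i f = \<zero>\<^bsub>free_module R (B i)\<^esub>}"
begin

abbreviation F :: "nat \<Rightarrow> ('a, 'x \<Rightarrow> 'a) module" where "F i \<equiv> free_module R (B i)"

sublocale F: module R "F i" for i
  by (rule free_module_module) (rule cring_axioms)

text \<open>For an ideal J this is J F_i; as F_i is free, membership can be tested on
  coefficients.\<close>

definition sub :: "'a set \<Rightarrow> nat \<Rightarrow> ('x \<Rightarrow> 'a) set" where
  "sub J i = {f \<in> carrier (F i). \<forall>x. f x \<in> J}"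

text \<open>Cycles and boundaries of the reduction modulo \<open>J\<close>, lifted to the complex itself.\<close>

definition cyc :: "'a set \<Rightarrow> nat \<Rightarrow> ('x \<Rightarrow> 'a) set" where
  "cyc J i = {f \<in> carrier (F i). case i of 0 \<Rightarrow> True | Suc k \<Rightarrow> d k f \<in> sub J k}"

definition bnd :: "'a set \<Rightarrow> nat \<Rightarrow> ('x \<Rightarrow> 'a) set" where
  "bnd J i = {d i v \<oplus>\<^bsub>F i\<^esub> h | v h. v \<in> carrier (F (Suc i)) \<and> h \<in> sub J i}"

lemma F_apply:
  "(f \<oplus>\<^bsub>F i\<^esub> g) x = f x \<oplus> g x" "(r \<odot>\<^bsub>F i\<^esub> f) x = r \<otimes> f x" "\<zero>\<^bsub>F i\<^esub> x = \<zero>"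
  by (simp_all add: free_module_def)

lemma F_coeff: "f \<in> carrier (F i) \<Longrightarrow> f x \<in> carrier R"
  by (simp add: free_module_def)

lemma d_zero: "d i \<zero>\<^bsub>F (Suc i)\<^esub> = \<zero>\<^bsub>F i\<^esub>"
  using d_smult[of \<zero> "\<zero>\<^bsub>F (Suc i)\<^esub>" i] d_closed[of "\<zero>\<^bsub>F (Suc i)\<^esub>" i] by simp

lemma d_d: "f \<in> carrier (F (Suc (Suc i))) \<Longrightarrow> d i (d (Suc i) f) = \<zero>\<^bsub>F i\<^esub>"
  using d_exact[of i] by blast

lemma sub_submodule:
  assumes "ideal J R" shows "submodule (sub J i) R (F i)"
proof -
  note J = ideal_closed[OF assms]
  show ?thesis
    by (rule F.submodule_of_closed) (auto simp: sub_def F_apply intro: J)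
qed

lemma sub_mono: "J \<subseteq> K \<Longrightarrow> sub J i \<subseteq> sub K i"
  by (auto simp: sub_def)

lemma sub_carrier: "f \<in> sub J i \<Longrightarrow> f \<in> carrier (F i)"
  by (simp add: sub_def)

lemma smult_mem_sub:
  assumes "ideal J R" "a \<in> J" "f \<in> carrier (F i)" shows "a \<odot>\<^bsub>F i\<^esub> f \<in> sub J i"
  using assms ideal_closed[OF assms(1)] F_coeff[OF assms(3)]
  by (auto simp: sub_def F_apply m_comm[of a])

text \<open>This is where freeness enters: multiplication by a embeds F/(J : a)F into F/JF. It
  supplies the left half of the exact sequence for J, J + Ra and (J : a).\<close>

lemma sub_colon:
  assumes "a \<in> carrier R" "f \<in> carrier (F i)"
  shows "a \<odot>\<^bsub>F i\<^esub> f \<in> sub J i \<longleftrightarrow> f \<in> sub (colon J a) i"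
  using assms F_coeff[OF assms(2)] by (auto simp: sub_def F_apply colon_def)

text \<open>Each coefficient splits by definition of \<open>adjoin\<close>, but the parts must be
  chosen with finite support; the induction over the support takes care of that.\<close>

lemma sub_adjoin:
  assumes "ideal J R" "a \<in> carrier R" "f \<in> sub (adjoin J a) i"
  obtains j w where "j \<in> sub J i" "w \<in> carrier (F i)" "f = j \<oplus>\<^bsub>F i\<^esub> a \<odot>\<^bsub>F i\<^esub> w"
proof -
  note S = sub_submodule[OF assms(1)]
  have f: "f \<in> carrier (F i)" "\<And>x. f x \<in> adjoin J a" using assms(3) by (auto simp: sub_def)
  have "\<exists>j w. j \<in> sub J i \<and> w \<in> carrier (F i) \<and> f = j \<oplus>\<^bsub>F i\<^esub> a \<odot>\<^bsub>F i\<^esub> w"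
    using cring_axioms f
  proof (induction rule: free_module_ideal_induct)
    case zero
    show ?case using assms(2) F.zero_mem_submodule[OF S]
      by (intro exI[of _ "\<zero>\<^bsub>F i\<^esub>"]) (auto simp: F.smult_r_null)
  next
    case (step r b g)
    then obtain j w where jw: "j \<in> sub J i" "w \<in> carrier (F i)" "g = j \<oplus>\<^bsub>F i\<^esub> a \<odot>\<^bsub>F i\<^esub> w" by blast
    obtain k s where ks: "k \<in> J" "s \<in> carrier R" "r = k \<oplus> s \<otimes> a"
      using step(1) by (auto simp: adjoin_def)
    have k: "k \<in> carrier R" using ks ideal_closed(1)[OF assms(1)] by blast
    let ?e = "basis_elem R b"
    have e: "?e \<in> carrier (F i)" by (rule basis_elem_closed[OF cring_axioms step(3)])
    note ec = F_coeff[OF e] F_coeff[OF jw(2)] F_coeff[OF sub_carrier[OF jw(1)]]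
    have "r \<odot>\<^bsub>F i\<^esub> ?e \<oplus>\<^bsub>F i\<^esub> g =
      (k \<odot>\<^bsub>F i\<^esub> ?e \<oplus>\<^bsub>F i\<^esub> j) \<oplus>\<^bsub>F i\<^esub> a \<odot>\<^bsub>F i\<^esub> (s \<odot>\<^bsub>F i\<^esub> ?e \<oplus>\<^bsub>F i\<^esub> w)"
    proof
      fix x
      have "(k \<oplus> s \<otimes> a) \<otimes> ?e x \<oplus> (j x \<oplus> a \<otimes> w x) =
        (k \<otimes> ?e x \<oplus> j x) \<oplus> a \<otimes> (s \<otimes> ?e x \<oplus> w x)"
        using ec[of x] k ks(2) assms(2) by algebra
      then show "(r \<odot>\<^bsub>F i\<^esub> ?e \<oplus>\<^bsub>F i\<^esub> g) x =
        ((k \<odot>\<^bsub>F i\<^esub> ?e \<oplus>\<^bsub>F i\<^esub> j) \<oplus>\<^bsub>F i\<^esub> a \<odot>\<^bsub>F i\<^esub> (s \<odot>\<^bsub>F i\<^esub> ?e \<oplus>\<^bsub>F i\<^esub> w)) x"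
        unfolding jw(3) ks(3) by (simp only: F_apply)
    qed
    moreover have "k \<odot>\<^bsub>F i\<^esub> ?e \<oplus>\<^bsub>F i\<^esub> j \<in> sub J i"
      using F.submoduleE(5)[OF S] smult_mem_sub[OF assms(1) ks(1) e] jw(1) by blast
    moreover have "s \<odot>\<^bsub>F i\<^esub> ?e \<oplus>\<^bsub>F i\<^esub> w \<in> carrier (F i)" using e jw(2) ks(2) by simp
    ultimately show ?case by metis
  qed
  then show ?thesis using that by blast
qed

lemma d_sub:
  assumes "ideal J R" "f \<in> sub J (Suc i)" shows "d i f \<in> sub J i"
proof -
  note S = sub_submodule[OF assms(1)]
  have f: "f \<in> carrier (F (Suc i))" "\<And>x. f x \<in> J" using assms(2) by (auto simp: sub_def)
  show ?thesis
    using cring_axioms f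
  proof (induction rule: free_module_ideal_induct)
    case zero
    show ?case unfolding d_zero by (rule F.zero_mem_submodule[OF S])
  next
    case (step r b g)
    have e: "basis_elem R b \<in> carrier (F (Suc i))" by (rule basis_elem_closed[OF cring_axioms step(3)])
    have "d i (r \<odot>\<^bsub>F (Suc i)\<^esub> basis_elem R b \<oplus>\<^bsub>F (Suc i)\<^esub> g) =
      r \<odot>\<^bsub>F i\<^esub> d i (basis_elem R b) \<oplus>\<^bsub>F i\<^esub> d i g"
      using step e by (simp add: d_add d_smult)
    then show ?case
      using F.submoduleE(5)[OF S smult_mem_sub[OF assms(1) step(1) d_closed[OF e]] step(5)] by simp
  qed
qed

section \<open>Cycles and boundaries modulo an ideal\<close>

lemma cyc_submodule:
  assumes "ideal J R" shows "submodule (cyc J i) R (F i)"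
proof (cases i)
  case 0
  then show ?thesis by (auto simp: cyc_def intro: F.carrier_is_submodule)
next
  case (Suc k)
  note S = sub_submodule[OF assms, of k]
  show ?thesis unfolding Suc
    using F.submoduleE(4,5)[OF S] F.zero_mem_submodule[OF S]
    by (intro F.submodule_of_closed) (auto simp: cyc_def d_add d_smult d_zero)
qed

lemma bnd_submodule:
  assumes "ideal J R" shows "submodule (bnd J i) R (F i)"
proof (rule F.submodule_of_closed)
  note S = sub_submodule[OF assms, of i]
  note c = d_closed sub_carrier
  show "bnd J i \<subseteq> carrier (F i)" by (auto simp: bnd_def c)
  show "\<zero>\<^bsub>F i\<^esub> \<in> bnd J i"
    unfolding bnd_def using F.zero_mem_submodule[OF S]
    by (intro CollectI exI[of _ "\<zero>\<^bsub>F (Suc i)\<^esub>"] exI[of _ "\<zero>\<^bsub>F i\<^esub>"]) (simp add: d_zero)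
  show "f \<oplus>\<^bsub>F i\<^esub> g \<in> bnd J i" if "f \<in> bnd J i" "g \<in> bnd J i" for f g
  proof -
    from that(1) obtain v h where v: "v \<in> carrier (F (Suc i))" "h \<in> sub J i" "f = d i v \<oplus>\<^bsub>F i\<^esub> h"
      by (auto simp: bnd_def)
    from that(2) obtain w k where w: "w \<in> carrier (F (Suc i))" "k \<in> sub J i" "g = d i w \<oplus>\<^bsub>F i\<^esub> k"
      by (auto simp: bnd_def)
    have "f \<oplus>\<^bsub>F i\<^esub> g = d i (v \<oplus>\<^bsub>F (Suc i)\<^esub> w) \<oplus>\<^bsub>F i\<^esub> (h \<oplus>\<^bsub>F i\<^esub> k)"
      using v w c by (simp add: d_add F.M.a_ac)
    then show ?thesis unfolding bnd_def using F.submoduleE(5)[OF S v(2) w(2)] v w by blast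
  qed
  show "r \<odot>\<^bsub>F i\<^esub> f \<in> bnd J i" if "r \<in> carrier R" "f \<in> bnd J i" for r f
  proof -
    from that(2) obtain v h where v: "v \<in> carrier (F (Suc i))" "h \<in> sub J i" "f = d i v \<oplus>\<^bsub>F i\<^esub> h"
      by (auto simp: bnd_def)
    have "r \<odot>\<^bsub>F i\<^esub> f = d i (r \<odot>\<^bsub>F (Suc i)\<^esub> v) \<oplus>\<^bsub>F i\<^esub> r \<odot>\<^bsub>F i\<^esub> h"
      using v c that by (simp add: d_smult F.smult_r_distr)
    then show ?thesis unfolding bnd_def using F.submoduleE(4)[OF S that(1) v(2)] v that by blast
  qed
qed

lemma sub_subset_bnd: "sub J i \<subseteq> bnd J i"
proof
  fix h assume h: "h \<in> sub J i"
  then have "h = d i \<zero>\<^bsub>F (Suc i)\<^esub> \<oplus>\<^bsub>F i\<^esub> h" by (simp add: d_zero sub_carrier)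
  then show "h \<in> bnd J i" using h unfolding bnd_def by blast
qed

lemma bnd_mono: "J \<subseteq> K \<Longrightarrow> bnd J i \<subseteq> bnd K i"
  using sub_mono[of J K i] unfolding bnd_def by blast

lemma cyc_mono: "J \<subseteq> K \<Longrightarrow> cyc J i \<subseteq> cyc K i"
  using sub_mono[of J K] unfolding cyc_def by (auto split: nat.splits)

lemma d_mem_bnd: "ideal J R \<Longrightarrow> v \<in> carrier (F (Suc i)) \<Longrightarrow> d i v \<in> bnd J i"
  unfolding bnd_def using F.zero_mem_submodule[OF sub_submodule] d_closed
  by (intro CollectI exI[of _ v] exI[of _ "\<zero>\<^bsub>F i\<^esub>"]) simp

lemma d_mem_cyc: "ideal J R \<Longrightarrow> v \<in> carrier (F (Suc i)) \<Longrightarrow> d i v \<in> cyc J i"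
  using F.zero_mem_submodule[OF sub_submodule] d_closed
  by (auto simp: cyc_def d_d split: nat.splits)

lemma sub_subset_cyc: "ideal J R \<Longrightarrow> sub J i \<subseteq> cyc J i"
  using d_sub by (auto simp: cyc_def sub_carrier split: nat.splits)

lemma bnd_subset_cyc: "ideal J R \<Longrightarrow> bnd J i \<subseteq> cyc J i"
  using F.submoduleE(5)[OF cyc_submodule] d_mem_cyc sub_subset_cyc
  unfolding bnd_def by blast

text \<open>Linearity of \<open>d\<close> carries \<open>sub_colon\<close> over to cycles. It
  governs the map on homology induced by multiplication a : R/(J : a) -> R/J.\<close>

lemma cyc_colon:
  assumes "a \<in> carrier R" "f \<in> carrier (F i)"
  shows "a \<odot>\<^bsub>F i\<^esub> f \<in> cyc J i \<longleftrightarrow> f \<in> cyc (colon J a) i"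
  using assms sub_colon[OF assms(1) d_closed] by (auto simp: cyc_def d_smult split: nat.splits)

lemma cyc_zero_subset_bnd: "cyc {\<zero>} (Suc i) \<subseteq> bnd {\<zero>} (Suc i)"
proof
  fix z assume z: "z \<in> cyc {\<zero>} (Suc i)"
  then have "d i z = \<zero>\<^bsub>F i\<^esub>" by (auto simp: cyc_def sub_def F_apply fun_eq_iff)
  then obtain v where "v \<in> carrier (F (Suc (Suc i)))" "z = d (Suc i) v"
    using d_exact[of i] z by (auto simp: cyc_def)
  then show "z \<in> bnd {\<zero>} (Suc i)" using d_mem_bnd[OF zeroideal] by simp
qed

end

subsection \<open>Vanishing of the homology of a complex modulo powers\<close>

locale noetherian_free_complex = free_complex R B d + noetherian_cring R
  for R (structure) and B d
begin

text \<open>Induction along 0 -> R/(J : y^s) -> R/J -> R/(J + Ry^s) -> 0: the differential of a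
  cycle for the right-hand term yields a cycle for the left-hand term one degree lower. Each element
  of the sequence thus costs one degree, whence the bound \<open>length xs < i\<close>. Both
  \<open>i\<close> and \<open>t\<close> vary, because the induction hypothesis is used in two
  degrees and at two levels.\<close>

lemma pow_ideal_pro_vanishing:
  assumes "set xs \<subseteq> carrier R" "length xs < i"
  shows "\<exists>s\<ge>t. cyc (pow_ideal xs s) i \<subseteq> bnd (pow_ideal xs t) i"
  using assms
proof (induction xs arbitrary: i t)
  case Nil
  then obtain k where "i = Suc k" by (cases i) auto
  \<comment> \<open>Without elements the ideal is zero, and the claim is exactness in positive
    degree.\<close>
  then show ?case using cyc_zero_subset_bnd[of k] by auto
next
  case (Cons y ys)
  define J where "J = pow_ideal ys"
  have y: "y \<in> carrier R" "\<And>k::nat. y [^] k \<in> carrier R" and ys: "set ys \<subseteq> carrier R" using Cons.prems by auto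
  have J: "ideal (J s) R" for s unfolding J_def by (rule pow_ideal_ideal[OF ys])
  have J_antimono: "J s \<subseteq> J t" if "t \<le> s" for s t
    unfolding J_def by (rule pow_ideal_antimono[OF ys that])
  have K: "ideal (pow_ideal (y # ys) t) R" by (rule pow_ideal_ideal[OF Cons.prems(1)])
  obtain k where k: "i = Suc k" "length ys < k" using Cons.prems(2) by (cases i) auto
  \<comment> \<open>The levels are fixed from the end of the argument backwards: \<open>s1\<close>
    makes the corrected cycle a boundary in degree \<open>i\<close>, \<open>s2\<close> provides the
    correction in degree \<open>k\<close>, and \<open>c\<close> bounds the y-power torsion modulo
    \<open>J s2\<close>.\<close>
  obtain s1 where s1: "t \<le> s1" "cyc (J s1) i \<subseteq> bnd (J t) i"
    using Cons.IH[OF ys, of i t] Cons.prems(2) unfolding J_def by auto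
  obtain s2 where s2: "s1 \<le> s2" "cyc (J s2) k \<subseteq> bnd (J s1) k"
    using Cons.IH[OF ys, of k s1] k(2) unfolding J_def by auto
  obtain c where c: "\<And>m r. r \<in> carrier R \<Longrightarrow> y [^] (m::nat) \<otimes> r \<in> J s2 \<Longrightarrow> y [^] (c::nat) \<otimes> r \<in> J s2"
    using colon_power_stable[OF J y(1)] by blast
  \<comment> \<open>Of the s2 + c factors y in front of \<open>w\<close>, c bring \<open>w\<close>
    into the cycles modulo \<open>J s2\<close>. The other s2 stay in front of \<open>v\<close>, and
    s2 \<ge> t puts y^s2 v into the submodule of level t.\<close>
  define s3 where "s3 = s2 + c"
  have "z \<in> bnd (pow_ideal (y # ys) t) i" if z: "z \<in> cyc (pow_ideal (y # ys) s3) i" for z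
  proof -
    have zc: "z \<in> carrier (F i)" and dz: "d k z \<in> sub (adjoin (J s3) (y [^] s3)) k"
      using z by (auto simp: cyc_def k(1) J_def)
    obtain j w where jw: "j \<in> sub (J s3) k" "w \<in> carrier (F k)" "d k z = j \<oplus>\<^bsub>F k\<^esub> y [^] s3 \<odot>\<^bsub>F k\<^esub> w"
      by (rule sub_adjoin[OF J y(2) dz])
    have "y [^] s3 \<odot>\<^bsub>F k\<^esub> w \<in> cyc (J s3) k"
    proof (rule F.submodule_cancel[OF cyc_submodule[OF J]])
      show "j \<in> cyc (J s3) k" using sub_subset_cyc[OF J] jw by blast
      show "y [^] s3 \<odot>\<^bsub>F k\<^esub> w \<oplus>\<^bsub>F k\<^esub> j \<in> cyc (J s3) k"
        using d_mem_cyc[OF J, of z k] zc jw y(2) by (simp add: k(1) F.M.a_comm sub_carrier)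
    qed (use jw y in auto)
    then have "w \<in> cyc (colon (J s3) (y [^] s3)) k" using cyc_colon[OF y(2) jw(2)] by blast
    \<comment> \<open>An element that y^s3 multiplies into \<open>J s3\<close> is multiplied into
      the larger \<open>J s2\<close>, where stabilization lowers the exponent to c.\<close>
    moreover have "colon (J s3) (y [^] s3) \<subseteq> colon (J s2) (y [^] c)"
      using c J_antimono[of s2 s3] by (auto simp: colon_def s3_def)
    ultimately have "y [^] c \<odot>\<^bsub>F k\<^esub> w \<in> cyc (J s2) k"
      using cyc_colon[OF y(2) jw(2)] cyc_mono by blast
    then obtain v h where vh: "v \<in> carrier (F i)" "h \<in> sub (J s1) k" "y [^] c \<odot>\<^bsub>F k\<^esub> w = d k v \<oplus>\<^bsub>F k\<^esub> h"
      using s2(2) by (auto simp: bnd_def k(1))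
    \<comment> \<open>The correction removes the y-part of the differential: d z' = j + y^s2 h has
      all coefficients in \<open>J s1\<close>.\<close>
    define z' where "z' = z \<oplus>\<^bsub>F i\<^esub> (\<ominus> (y [^] s2)) \<odot>\<^bsub>F i\<^esub> v"
    have z'c: "z' \<in> carrier (F i)" using zc vh y by (simp add: z'_def)
    note cl = sub_carrier[OF vh(2)] sub_carrier[OF jw(1)] d_closed vh(1)[unfolded k(1)] zc[unfolded k(1)] y(2)
    have "y [^] s3 \<odot>\<^bsub>F k\<^esub> w = y [^] s2 \<odot>\<^bsub>F k\<^esub> d k v \<oplus>\<^bsub>F k\<^esub> y [^] s2 \<odot>\<^bsub>F k\<^esub> h"
      using jw(2) y cl unfolding s3_def
      by (simp add: nat_pow_mult[symmetric] F.smult_assoc1 vh(3) F.smult_r_distr)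
    moreover have "d k z' = d k z \<oplus>\<^bsub>F k\<^esub> \<ominus>\<^bsub>F k\<^esub> (y [^] s2 \<odot>\<^bsub>F k\<^esub> d k v)"
      using cl unfolding z'_def k(1) by (simp add: d_add d_smult) (simp add: F.smult_l_minus)
    ultimately have "d k z' = j \<oplus>\<^bsub>F k\<^esub> y [^] s2 \<odot>\<^bsub>F k\<^esub> h"
      using cl jw(3) by (simp add: F.M.a_ac F.M.r_neg)
    moreover have "j \<in> sub (J s1) k"
      using jw(1) sub_mono[OF J_antimono[of s1 s3]] s2(1) by (auto simp: s3_def)
    ultimately have "d k z' \<in> sub (J s1) k"
      using F.submoduleE(4,5)[OF sub_submodule[OF J]] vh(2) y by simp
    then have "z' \<in> cyc (J s1) i" using z'c by (simp add: cyc_def k(1))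
    then have "z' \<in> bnd (pow_ideal (y # ys) t) i"
      using s1(2) bnd_mono[OF adjoin_subset[OF y(2)[of t] ideal_closed(1)[OF J]]] by (auto simp: J_def)
    moreover have "y [^] s2 \<odot>\<^bsub>F i\<^esub> v \<in> bnd (pow_ideal (y # ys) t) i"
    proof -
      have "y [^] s2 \<in> pow_ideal (y # ys) s2"
        using adjoin_mem[OF J y(2)[of s2]] by (simp add: J_def)
      then have "y [^] s2 \<in> pow_ideal (y # ys) t"
        using pow_ideal_antimono[OF Cons.prems(1), of t s2] s1(1) s2(1) by auto
      then show ?thesis using smult_mem_sub[OF K _ vh(1)] sub_subset_bnd by blast
    qed
    moreover have "z = z' \<oplus>\<^bsub>F i\<^esub> y [^] s2 \<odot>\<^bsub>F i\<^esub> v"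
      using zc vh y by (simp add: z'_def F.M.a_assoc F.smult_l_minus F.M.l_neg)
    ultimately show ?thesis using F.submoduleE(5)[OF bnd_submodule[OF K]] by simp
  qed
  then show ?case using s1 s2 by (intro exI[of _ s3]) (auto simp: s3_def)
qed

end

subsection \<open>Rigidity\<close>

definition (in cring) minimal_prime_over :: "'a set \<Rightarrow> 'a set \<Rightarrow> bool" where
  "minimal_prime_over p J \<longleftrightarrow> primeideal p R \<and> ideal J R \<and> J \<subseteq> p \<and>
     (\<forall>P. primeideal P R \<longrightarrow> J \<subseteq> P \<longrightarrow> P \<subseteq> p \<longrightarrow> P = p)"

lemma (in cring) minimal_prime_over_larger:
  "minimal_prime_over p J \<Longrightarrow> ideal K R \<Longrightarrow> J \<subseteq> K \<Longrightarrow> K \<subseteq> p \<Longrightarrow> minimal_prime_over p K"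
  unfolding minimal_prime_over_def by (meson subset_trans)

context noetherian_free_complex begin

text \<open>The homology of the complex with coefficients in \<open>k(p)\<close> vanishes in degree \<open>n\<close>.\<close>

definition residue_acyclic :: "'a set \<Rightarrow> nat \<Rightarrow> bool" where
  "residue_acyclic p n \<longleftrightarrow> (\<forall>w\<in>cyc p n. \<exists>u\<in>carrier R - p. u \<odot>\<^bsub>F n\<^esub> w \<in> bnd p n)"

text \<open>By minimality J is not prime, so ab lies in J for some a, b outside J. One factor lies
  in p and serves as \<open>c\<close>; the other one shows that (J : c) is larger than J. Hence J +
  Rc and (J : c) are both strictly larger than J, as the Noetherian induction requires.\<close>

lemma minimal_prime_over_step:
  assumes "minimal_prime_over p J" "J \<noteq> p"
  obtains c where "c \<in> p" "c \<in> carrier R" "c \<notin> J" "\<not> colon J c \<subseteq> J"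
proof -
  have p: "primeideal p R" and J: "ideal J R" "J \<subseteq> p"
    and min: "\<And>P. primeideal P R \<Longrightarrow> J \<subseteq> P \<Longrightarrow> P \<subseteq> p \<Longrightarrow> P = p"
    using assms(1) by (auto simp: minimal_prime_over_def)
  have "J \<noteq> carrier R"
    using J(2) primeideal.I_notcarr[OF p] ideal_closed(1)[OF primeideal.axioms(1)[OF p]] by blast
  moreover have "\<not> primeideal J R" using min[of J] J(2) assms(2) by blast
  ultimately obtain a b where ab: "a \<in> carrier R" "b \<in> carrier R" "a \<otimes> b \<in> J" "a \<notin> J" "b \<notin> J"
    using nonprime_witness[OF J(1)] by blast
  have "a \<in> p \<or> b \<in> p" using primeideal.I_prime[OF p ab(1,2)] ab(3) J(2) by blast
  then show ?thesis
  proof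
    assume "a \<in> p"
    moreover have "b \<in> colon J a" using ab by (simp add: colon_def)
    ultimately show ?thesis using that[of a] ab by blast
  next
    assume "b \<in> p"
    moreover have "a \<in> colon J b" using ab by (simp add: colon_def m_comm)
    ultimately show ?thesis using that[of b] ab by blast
  qed
qed

text \<open>Devissage along \<open>0 \<rightarrow> R/(J:c) \<rightarrow> R/J \<rightarrow> R/(J + c) \<rightarrow> 0\<close>, localized at \<open>p\<close>.\<close>

lemma residue_acyclic_imp_bnd:
  assumes "residue_acyclic p n" "minimal_prime_over p J" "w \<in> cyc J n"
  shows "\<exists>u\<in>carrier R - p. u \<odot>\<^bsub>F n\<^esub> w \<in> bnd J n"
proof -
  have "ideal J R" using assms(2) by (simp add: minimal_prime_over_def)
  then show ?thesis using assms(2,3)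
  proof (induction J arbitrary: w rule: noetherian_induct)
    case (step J)
    have p: "primeideal p R" and Jp: "J \<subseteq> p" using step.prems(1) by (auto simp: minimal_prime_over_def)
    have wF: "w \<in> carrier (F n)" using step.prems(2) by (simp add: cyc_def)
    note J = step.hyps
    note closedJ = F.submoduleE[OF bnd_submodule[OF J]]
    note unit_mult = primeideal_unit_complement(2)[OF p]
    show ?case
    proof (cases "J = p")
      case True
      then show ?thesis using assms(1) step.prems(2) by (simp add: residue_acyclic_def)
    next
      case False
      obtain c where c: "c \<in> p" "c \<in> carrier R" "c \<notin> J" "\<not> colon J c \<subseteq> J"
        by (rule minimal_prime_over_step[OF step.prems(1) False])
      define K where "K = adjoin J c"
      have K: "ideal K R" "J \<subset> K" "K \<subseteq> p"
        using adjoin_ideal[OF J c(2)] adjoin_subset[OF c(2) ideal_closed(1)[OF J]]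
          adjoin_mem[OF J c(2)] adjoin_least[OF primeideal.axioms(1)[OF p] Jp c(1)] c(3)
        by (auto simp: K_def)
      obtain u where u: "u \<in> carrier R - p" "u \<odot>\<^bsub>F n\<^esub> w \<in> bnd K n"
        using step.IH[OF K(1,2) minimal_prime_over_larger[OF step.prems(1) K(1) _ K(3)]]
          cyc_mono[of J K n] step.prems(2) K(2) by blast
      then obtain v h where vh: "v \<in> carrier (F (Suc n))" "h \<in> sub K n"
        "u \<odot>\<^bsub>F n\<^esub> w = d n v \<oplus>\<^bsub>F n\<^esub> h" by (auto simp: bnd_def)
      obtain j x where jx: "j \<in> sub J n" "x \<in> carrier (F n)" "h = j \<oplus>\<^bsub>F n\<^esub> c \<odot>\<^bsub>F n\<^esub> x"
        using sub_adjoin[OF J c(2)] vh(2) unfolding K_def by blast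
      define y where "y = d n v \<oplus>\<^bsub>F n\<^esub> j"
      have y: "y \<in> bnd J n" using vh(1) jx(1) by (auto simp: y_def bnd_def)
      have yF: "y \<in> carrier (F n)" using closedJ(1) y by blast
      have uw: "u \<odot>\<^bsub>F n\<^esub> w = c \<odot>\<^bsub>F n\<^esub> x \<oplus>\<^bsub>F n\<^esub> y"
        using vh jx c(2) d_closed sub_carrier by (simp add: y_def F.M.a_ac)
      have "\<exists>u'\<in>carrier R - p. u' \<odot>\<^bsub>F n\<^esub> (c \<odot>\<^bsub>F n\<^esub> x) \<in> bnd J n"
      proof (cases "colon J c \<subseteq> p")
        case True
        have C: "ideal (colon J c) R" "J \<subset> colon J c"
          using colon_ideal[OF J c(2)] colon_superset[OF J c(2)] c(4) by auto
        \<comment> \<open>\<open>c x\<close> differs from the cycle \<open>u w\<close> by the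
          boundary \<open>y\<close>.\<close>
        have "c \<odot>\<^bsub>F n\<^esub> x \<in> cyc J n"
        proof (rule F.submodule_cancel[OF cyc_submodule[OF J]])
          show "y \<in> cyc J n" using y bnd_subset_cyc[OF J] by blast
          show "c \<odot>\<^bsub>F n\<^esub> x \<oplus>\<^bsub>F n\<^esub> y \<in> cyc J n"
            using F.submoduleE(4)[OF cyc_submodule[OF J]] u(1) step.prems(2) by (simp flip: uw)
        qed (use c jx in simp)
        then have "x \<in> cyc (colon J c) n" using cyc_colon c(2) jx(2) by blast
        then obtain u' where u': "u' \<in> carrier R - p" "u' \<odot>\<^bsub>F n\<^esub> x \<in> bnd (colon J c) n"
          using step.IH[OF C minimal_prime_over_larger[OF step.prems(1) C(1) _ True]] C(2) by blast
        then obtain v' h' where v'h': "v' \<in> carrier (F (Suc n))" "h' \<in> sub (colon J c) n"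
          "u' \<odot>\<^bsub>F n\<^esub> x = d n v' \<oplus>\<^bsub>F n\<^esub> h'" by (auto simp: bnd_def)
        have "u' \<odot>\<^bsub>F n\<^esub> (c \<odot>\<^bsub>F n\<^esub> x) = c \<odot>\<^bsub>F n\<^esub> (u' \<odot>\<^bsub>F n\<^esub> x)"
          using u'(1) c(2) jx(2) by (simp add: m_comm flip: F.smult_assoc1)
        also have "\<dots> = d n (c \<odot>\<^bsub>F (Suc n)\<^esub> v') \<oplus>\<^bsub>F n\<^esub> c \<odot>\<^bsub>F n\<^esub> h'"
          using v'h' c(2) d_closed sub_carrier by (simp add: F.smult_r_distr d_smult)
        also have "\<dots> \<in> bnd J n"
          using sub_colon[OF c(2) sub_carrier[OF v'h'(2)]] v'h' c(2) by (auto simp: bnd_def)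
        finally show ?thesis using u'(1) by blast
      next
        case False
        \<comment> \<open>Here R/(J : c) vanishes at p: an element outside p multiplies c into
          J.\<close>
        then obtain r where "r \<in> colon J c" "r \<notin> p" by blast
        then obtain u' where u': "u' \<in> carrier R - p" "u' \<otimes> c \<in> J"
          using c(2) by (auto simp: colon_def m_comm)
        then show ?thesis
          using smult_mem_sub[OF J u'(2) jx(2)] sub_subset_bnd[of J n] c(2) jx(2)
          by (intro bexI[of _ u']) (auto simp: F.smult_assoc1)
      qed
      then obtain u' where u': "u' \<in> carrier R - p" "u' \<odot>\<^bsub>F n\<^esub> (c \<odot>\<^bsub>F n\<^esub> x) \<in> bnd J n" by blast
      have "(u' \<otimes> u) \<odot>\<^bsub>F n\<^esub> w = u' \<odot>\<^bsub>F n\<^esub> (c \<odot>\<^bsub>F n\<^esub> x) \<oplus>\<^bsub>F n\<^esub> u' \<odot>\<^bsub>F n\<^esub> y"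
        using u u' wF uw c(2) jx(2) yF by (simp add: F.smult_assoc1 F.smult_r_distr)
      also have "\<dots> \<in> bnd J n" using closedJ(4,5) u' y by blast
      finally show ?thesis using unit_mult[OF u'(1) u(1)] by blast
    qed
  qed
qed

text \<open>Since the homology of \<open>p/J\<close> vanishes in degree \<open>n\<close> after localization at \<open>p\<close>, that of
  \<open>R/J\<close> maps onto that of \<open>R/p\<close> in degree \<open>n + 1\<close>.\<close>

lemma residue_acyclic_imp_lift:
  assumes "residue_acyclic p n" "minimal_prime_over p J" "f \<in> cyc p (Suc n)"
  shows "\<exists>u\<in>carrier R - p. \<exists>h\<in>sub p (Suc n). u \<odot>\<^bsub>F (Suc n)\<^esub> f \<oplus>\<^bsub>F (Suc n)\<^esub> h \<in> cyc J (Suc n)"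
proof -
  have "ideal J R" using assms(2) by (simp add: minimal_prime_over_def)
  then show ?thesis using assms(2)
  proof (induction J rule: noetherian_induct)
    case (step J)
    let ?F = "F (Suc n)"
    have p: "primeideal p R" "ideal p R" and Jp: "J \<subseteq> p"
      using step.prems(1) by (auto simp: minimal_prime_over_def primeideal.axioms(1))
    have fF: "f \<in> carrier ?F" using assms(3) by (simp add: cyc_def)
    note J = step.hyps
    note closedp = F.submoduleE[OF sub_submodule[OF p(2)]]
    note unit_mult = primeideal_unit_complement(2)[OF p(1)]
    show ?case
    proof (cases "J = p")
      case True
      then show ?thesis
        using assms(3) fF primeideal_unit_complement(1)[OF p(1)] F.zero_mem_submodule[OF sub_submodule[OF p(2)]]
        by (intro bexI[of _ \<one>] bexI[of _ "\<zero>\<^bsub>?F\<^esub>"]) auto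
    next
      case False
      obtain c where c: "c \<in> p" "c \<in> carrier R" "c \<notin> J" "\<not> colon J c \<subseteq> J"
        by (rule minimal_prime_over_step[OF step.prems(1) False])
      define K where "K = adjoin J c"
      have K: "ideal K R" "J \<subset> K" "K \<subseteq> p"
        using adjoin_ideal[OF J c(2)] adjoin_subset[OF c(2) ideal_closed(1)[OF J]]
          adjoin_mem[OF J c(2)] adjoin_least[OF p(2) Jp c(1)] c(3)
        by (auto simp: K_def)
      obtain u h where uh: "u \<in> carrier R - p" "h \<in> sub p (Suc n)"
        "u \<odot>\<^bsub>?F\<^esub> f \<oplus>\<^bsub>?F\<^esub> h \<in> cyc K (Suc n)"
        using step.IH[OF K(1,2) minimal_prime_over_larger[OF step.prems(1) K(1) _ K(3)]] K(2) by blast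
      define g where "g = u \<odot>\<^bsub>?F\<^esub> f \<oplus>\<^bsub>?F\<^esub> h"
      have g: "g \<in> carrier ?F" "d n g \<in> sub K n" using uh(3) by (auto simp: g_def cyc_def)
      obtain j x where jx: "j \<in> sub J n" "x \<in> carrier (F n)" "d n g = j \<oplus>\<^bsub>F n\<^esub> c \<odot>\<^bsub>F n\<^esub> x"
        using sub_adjoin[OF J c(2)] g(2) unfolding K_def by blast
      have "\<exists>u'\<in>carrier R - p. \<exists>h'\<in>sub p (Suc n). u' \<odot>\<^bsub>?F\<^esub> g \<oplus>\<^bsub>?F\<^esub> h' \<in> cyc J (Suc n)"
      proof (cases "colon J c \<subseteq> p")
        case True
        have C: "ideal (colon J c) R" "J \<subseteq> colon J c"
          using colon_ideal[OF J c(2)] colon_superset[OF J c(2)] by auto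
        have "c \<odot>\<^bsub>F n\<^esub> x \<in> cyc J n"
        proof (rule F.submodule_cancel[OF cyc_submodule[OF J]])
          show "j \<in> cyc J n" using jx sub_subset_cyc[OF J] by blast
          show "c \<odot>\<^bsub>F n\<^esub> x \<oplus>\<^bsub>F n\<^esub> j \<in> cyc J n"
            using d_mem_cyc[OF J g(1)] jx c(2) sub_carrier by (simp add: F.M.a_comm)
        qed (use c jx in simp)
        then have "x \<in> cyc (colon J c) n" using cyc_colon c(2) jx(2) by blast
        \<comment> \<open>The colon ideal is handled in degree n by the devissage just proved, while
          the induction hypothesis was spent on J + Rc in degree n + 1.\<close>
        then obtain u' where u': "u' \<in> carrier R - p" "u' \<odot>\<^bsub>F n\<^esub> x \<in> bnd (colon J c) n"
          using residue_acyclic_imp_bnd[OF assms(1) minimal_prime_over_larger[OF step.prems(1) C True]] by blast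
        then obtain v k where vk: "v \<in> carrier ?F" "k \<in> sub (colon J c) n"
          "u' \<odot>\<^bsub>F n\<^esub> x = d n v \<oplus>\<^bsub>F n\<^esub> k" by (auto simp: bnd_def)
        \<comment> \<open>Since u' dg = u' j + c (dv + k), subtracting c v from u' g leaves u' j + c
          k, which is in J F. The correction is invisible modulo p because c lies in p.\<close>
        define h' where "h' = (\<ominus> c) \<odot>\<^bsub>?F\<^esub> v"
        note cl = d_closed sub_carrier[OF jx(1)] sub_carrier[OF vk(2)] c(2) vk(1) u'(1) g(1) jx(2)
        have "d n (u' \<odot>\<^bsub>?F\<^esub> g \<oplus>\<^bsub>?F\<^esub> h') = u' \<odot>\<^bsub>F n\<^esub> d n g \<oplus>\<^bsub>F n\<^esub> \<ominus>\<^bsub>F n\<^esub> (c \<odot>\<^bsub>F n\<^esub> d n v)"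
          using cl unfolding h'_def by (simp add: d_add d_smult) (simp add: F.smult_l_minus)
        also have "u' \<odot>\<^bsub>F n\<^esub> d n g = u' \<odot>\<^bsub>F n\<^esub> j \<oplus>\<^bsub>F n\<^esub> c \<odot>\<^bsub>F n\<^esub> (u' \<odot>\<^bsub>F n\<^esub> x)"
          using cl by (simp add: jx(3) F.smult_r_distr m_comm flip: F.smult_assoc1)
        also have "\<dots> = u' \<odot>\<^bsub>F n\<^esub> j \<oplus>\<^bsub>F n\<^esub> (c \<odot>\<^bsub>F n\<^esub> d n v \<oplus>\<^bsub>F n\<^esub> c \<odot>\<^bsub>F n\<^esub> k)"
          using cl by (simp add: vk(3) F.smult_r_distr)
        also have "\<dots> \<oplus>\<^bsub>F n\<^esub> \<ominus>\<^bsub>F n\<^esub> (c \<odot>\<^bsub>F n\<^esub> d n v) = u' \<odot>\<^bsub>F n\<^esub> j \<oplus>\<^bsub>F n\<^esub> c \<odot>\<^bsub>F n\<^esub> k"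
          using cl by (simp add: F.M.a_ac F.M.r_neg)
        also have "\<dots> \<in> sub J n"
          using sub_colon[OF c(2) sub_carrier[OF vk(2)]] vk(2) jx(1) u'(1)
            F.submoduleE(4,5)[OF sub_submodule[OF J]] by simp
        finally have "u' \<odot>\<^bsub>?F\<^esub> g \<oplus>\<^bsub>?F\<^esub> h' \<in> cyc J (Suc n)"
          using cl by (simp add: cyc_def h'_def)
        moreover have "h' \<in> sub p (Suc n)"
          unfolding h'_def by (rule smult_mem_sub[OF p(2) ideal_closed(4)[OF p(2) c(1)] vk(1)])
        ultimately show ?thesis using u'(1) by blast
      next
        case False
        then obtain r where "r \<in> colon J c" "r \<notin> p" by blast
        then obtain u' where u': "u' \<in> carrier R - p" "u' \<otimes> c \<in> J"
          using c(2) by (auto simp: colon_def m_comm)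
        \<comment> \<open>The multiplier u' alone moves both parts of dg into J F, so the correction
          is zero.\<close>
        have "d n (u' \<odot>\<^bsub>?F\<^esub> g \<oplus>\<^bsub>?F\<^esub> \<zero>\<^bsub>?F\<^esub>) = u' \<odot>\<^bsub>F n\<^esub> j \<oplus>\<^bsub>F n\<^esub> (u' \<otimes> c) \<odot>\<^bsub>F n\<^esub> x"
          using u'(1) c(2) jx g(1) sub_carrier by (simp add: d_smult F.smult_r_distr F.smult_assoc1)
        also have "\<dots> \<in> sub J n"
          using smult_mem_sub[OF J u'(2) jx(2)] jx(1) u'(1) F.submoduleE(4,5)[OF sub_submodule[OF J]] by simp
        finally show ?thesis
          using u'(1) g(1) F.zero_mem_submodule[OF sub_submodule[OF p(2)]]
          by (intro bexI[of _ u'] bexI[of _ "\<zero>\<^bsub>?F\<^esub>"]) (auto simp: cyc_def)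
      qed
      then obtain u' h' where u'h': "u' \<in> carrier R - p" "h' \<in> sub p (Suc n)"
        "u' \<odot>\<^bsub>?F\<^esub> g \<oplus>\<^bsub>?F\<^esub> h' \<in> cyc J (Suc n)" by blast
      have "u' \<odot>\<^bsub>?F\<^esub> g \<oplus>\<^bsub>?F\<^esub> h' = (u' \<otimes> u) \<odot>\<^bsub>?F\<^esub> f \<oplus>\<^bsub>?F\<^esub> (u' \<odot>\<^bsub>?F\<^esub> h \<oplus>\<^bsub>?F\<^esub> h')"
        using uh(1,2) u'h'(1,2) fF sub_carrier
        by (simp add: g_def F.smult_r_distr F.smult_assoc1 F.M.a_assoc)
      moreover have "u' \<odot>\<^bsub>?F\<^esub> h \<oplus>\<^bsub>?F\<^esub> h' \<in> sub p (Suc n)"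
        using closedp(4,5) uh(2) u'h'(1,2) by simp
      ultimately show ?thesis using unit_mult[OF u'h'(1) uh(1)] u'h'(3) by metis
    qed
  qed
qed

theorem residue_acyclic_Suc:
  assumes "residue_acyclic p n" "set xs \<subseteq> p" "length xs \<le> n" "primeideal p R"
    and "\<And>P. primeideal P R \<Longrightarrow> set xs \<subseteq> P \<Longrightarrow> P \<subseteq> p \<Longrightarrow> P = p"
  shows "residue_acyclic p (Suc n)"
  unfolding residue_acyclic_def
proof
  fix f assume f: "f \<in> cyc p (Suc n)"
  let ?F = "F (Suc n)"
  have p: "ideal p R" using assms(4) by (rule primeideal.axioms(1))
  have c: "set xs \<subseteq> carrier R" using assms(2) ideal_closed(1)[OF p] by blast
  \<comment> \<open>Level 1 is a sufficient target because \<open>pow_ideal xs 1\<close> is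
    contained in p; the degree n + 1 exceeds the length of \<open>xs\<close>.\<close>
  obtain s where s: "s \<ge> 1" "cyc (pow_ideal xs s) (Suc n) \<subseteq> bnd (pow_ideal xs 1) (Suc n)"
    using pow_ideal_pro_vanishing[OF c, of "Suc n" 1] assms(3) by auto
  have "minimal_prime_over p (pow_ideal xs s)"
    using assms(2,4,5) pow_ideal_ideal[OF c] pow_ideal_subset_prime[OF _ c, of _ s] s(1)
    by (auto simp: minimal_prime_over_def)
  then obtain u h where uh: "u \<in> carrier R - p" "h \<in> sub p (Suc n)"
    "u \<odot>\<^bsub>?F\<^esub> f \<oplus>\<^bsub>?F\<^esub> h \<in> cyc (pow_ideal xs s) (Suc n)"
    using residue_acyclic_imp_lift[OF assms(1) _ f] by blast
  moreover have "pow_ideal xs 1 \<subseteq> p" using pow_ideal_subset_prime[OF assms(4) c, of 1] assms(2) by simp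
  ultimately have "u \<odot>\<^bsub>?F\<^esub> f \<oplus>\<^bsub>?F\<^esub> h \<in> bnd p (Suc n)" using s(2) bnd_mono by blast
  moreover have "h \<in> bnd p (Suc n)" "u \<odot>\<^bsub>?F\<^esub> f \<in> carrier ?F"
    using sub_subset_bnd uh(1,2) f by (auto simp: cyc_def)
  ultimately have "u \<odot>\<^bsub>?F\<^esub> f \<in> bnd p (Suc n)"
    using F.submodule_cancel[OF bnd_submodule[OF p]] by blast
  then show "\<exists>u\<in>carrier R - p. u \<odot>\<^bsub>?F\<^esub> f \<in> bnd p (Suc n)" using uh(1) by blast
qed

text \<open>One sequence of length n serves for all degrees i \<ge> n, as
  \<open>residue_acyclic_Suc\<close> asks for at most i elements.\<close>

theorem residue_acyclic_above:
  assumes "primeideal p R" and "\<not> prime_chain_below (Suc n) p"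
    and "residue_acyclic p n" and "n \<le> i"
  shows "residue_acyclic p i"
proof -
  obtain xs where xs: "length xs = n" "set xs \<subseteq> p"
    "\<And>P. primeideal P R \<Longrightarrow> set xs \<subseteq> P \<Longrightarrow> P \<subset> p \<Longrightarrow> prime_chain_below n P"
    using exists_height_raising_sequence[OF assms(1), of n] by blast
  \<comment> \<open>A prime over \<open>xs\<close> strictly below p would have height at least n,
    and p would then have height at least n + 1.\<close>
  have minimal: "P = p" if "primeideal P R" "set xs \<subseteq> P" "P \<subseteq> p" for P
    using prime_chain_below_Suc[OF xs(3)[OF that(1,2)] _ assms(1)] that(3) assms(2) by blast
  show ?thesis
    using assms(4)
  proof (induction i rule: dec_induct)
    case base
    show ?case by (rule assms(3))
  next
    case (step i)
    then show ?case using residue_acyclic_Suc[OF _ xs(2) _ assms(1) minimal, of i] xs(1) by auto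
  qed
qed

end

section \<open>Quotients, tensor products and homology\<close>

context module begin

lemma submodule_abelian_subgroup:
  assumes "submodule L R M" shows "abelian_subgroup L M"
proof (rule abelian_subgroupI3)
  show "additive_subgroup L M"
    using submodule.axioms(1)[OF assms] by (rule additive_subgroup.intro)
qed (rule M.abelian_group_axioms)

lemma quotient_module_carrier: "carrier (quotient_module M L) = (\<lambda>x. L +>\<^bsub>M\<^esub> x) ` carrier M"
  by (auto simp: quotient_module_def A_RCOSETS_def')

lemma coset_eq_iff:
  assumes "submodule L R M" "x \<in> carrier M" "y \<in> carrier M"
  shows "L +>\<^bsub>M\<^esub> x = L +>\<^bsub>M\<^esub> y \<longleftrightarrow> x \<ominus>\<^bsub>M\<^esub> y \<in> L"
proof -
  interpret L: abelian_subgroup L M by (rule submodule_abelian_subgroup) fact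
  show ?thesis
    using L.a_rcos_module[OF assms(3,2)] L.a_rcos_self[OF assms(2)] L.a_repr_independence'[OF _ assms(3)]
    by (auto simp: a_minus_def)
qed

lemma coset_zero_iff:
  assumes "submodule L R M" "x \<in> carrier M"
  shows "L +>\<^bsub>M\<^esub> x = L \<longleftrightarrow> x \<in> L"
proof -
  interpret L: abelian_subgroup L M by (rule submodule_abelian_subgroup) fact
  show ?thesis using L.a_rcos_self[OF assms(2)] L.a_rcos_const by blast
qed

lemma quotient_module_zero: "\<zero>\<^bsub>quotient_module M L\<^esub> = L"
  by (simp add: quotient_module_def)

lemma quotient_module_add:
  assumes "submodule L R M" "x \<in> carrier M" "y \<in> carrier M"
  shows "(L +>\<^bsub>M\<^esub> x) \<oplus>\<^bsub>quotient_module M L\<^esub> (L +>\<^bsub>M\<^esub> y) = L +>\<^bsub>M\<^esub> (x \<oplus>\<^bsub>M\<^esub> y)"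
proof -
  interpret L: abelian_subgroup L M by (rule submodule_abelian_subgroup) fact
  show ?thesis using L.a_rcos_sum[OF assms(2,3)] by (simp add: quotient_module_def)
qed

text \<open>Scalar multiplication on quotients and \<open>tensor_map\<close> are unions over all
  representatives; such a union is a single value once the summand is independent of the
  representative.\<close>

lemma coset_image_const:
  assumes "submodule L R M" "x \<in> carrier M" "\<And>y. y \<in> carrier M \<Longrightarrow> y \<ominus>\<^bsub>M\<^esub> x \<in> L \<Longrightarrow> f y = f x"
  shows "(\<Union>y\<in>L +>\<^bsub>M\<^esub> x. f y) = f x"
proof -
  interpret L: abelian_subgroup L M by (rule submodule_abelian_subgroup) fact
  have "f y = f x" if "y \<in> L +>\<^bsub>M\<^esub> x" for y
  proof -
    have y: "y \<in> carrier M" using L.a_elemrcos_carrier[OF assms(2) that] .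
    then show ?thesis using L.a_rcos_module[OF assms(2) y] that assms(3) by (simp add: a_minus_def)
  qed
  then show ?thesis using UN_constant_eq[OF L.a_rcos_self[OF assms(2)]] by blast
qed

lemma quotient_module_smult:
  assumes "submodule L R M" "r \<in> carrier R" "x \<in> carrier M"
  shows "r \<odot>\<^bsub>quotient_module M L\<^esub> (L +>\<^bsub>M\<^esub> x) = L +>\<^bsub>M\<^esub> (r \<odot>\<^bsub>M\<^esub> x)"
proof -
  have "L +>\<^bsub>M\<^esub> (r \<odot>\<^bsub>M\<^esub> y) = L +>\<^bsub>M\<^esub> (r \<odot>\<^bsub>M\<^esub> x)" if "y \<in> carrier M" "y \<ominus>\<^bsub>M\<^esub> x \<in> L" for y
  proof -
    have "r \<odot>\<^bsub>M\<^esub> y \<ominus>\<^bsub>M\<^esub> r \<odot>\<^bsub>M\<^esub> x = r \<odot>\<^bsub>M\<^esub> (y \<ominus>\<^bsub>M\<^esub> x)"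
      using that assms by (simp add: a_minus_def smult_r_distr smult_r_minus)
    then show ?thesis
      using coset_eq_iff[OF assms(1), of "r \<odot>\<^bsub>M\<^esub> y" "r \<odot>\<^bsub>M\<^esub> x"]
        submoduleE(4)[OF assms(1,2) that(2)] that(1) assms(2,3) by simp
  qed
  then show ?thesis
    using coset_image_const[OF assms(1,3), of "\<lambda>y. L +>\<^bsub>M\<^esub> (r \<odot>\<^bsub>M\<^esub> y)"]
    by (simp add: quotient_module_def)
qed

lemma quotient_module_module:
  assumes L: "submodule L R M" shows "module R (quotient_module M L)"
proof (rule moduleI)
  let ?Q = "quotient_module M L"
  note q = quotient_module_add[OF L] quotient_module_smult[OF L]
  have Lz: "L +>\<^bsub>M\<^esub> \<zero>\<^bsub>M\<^esub> = L" using coset_zero_iff[OF L] zero_mem_submodule[OF L] by simp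
  show "cring R" by (rule R.cring_axioms)
  have ex: "\<exists>y\<in>carrier ?Q. y \<oplus>\<^bsub>?Q\<^esub> x = \<zero>\<^bsub>?Q\<^esub>" if "x \<in> carrier ?Q" for x
  proof -
    obtain a where "x = L +>\<^bsub>M\<^esub> a" "a \<in> carrier M" using \<open>x \<in> carrier ?Q\<close> by (auto simp: quotient_module_carrier)
    then show "\<exists>y\<in>carrier ?Q. y \<oplus>\<^bsub>?Q\<^esub> x = \<zero>\<^bsub>?Q\<^esub>"
      by (intro bexI[of _ "L +>\<^bsub>M\<^esub> (\<ominus>\<^bsub>M\<^esub> a)"])
        (auto simp: quotient_module_carrier q M.l_neg Lz quotient_module_zero)
  qed
  have zero: "\<zero>\<^bsub>?Q\<^esub> = L +>\<^bsub>M\<^esub> \<zero>\<^bsub>M\<^esub>" by (simp add: Lz quotient_module_zero)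
  show "abelian_group ?Q"
    by (rule abelian_groupI)
      (use ex in \<open>auto simp: quotient_module_carrier q zero M.a_ac\<close>)
qed (auto simp: quotient_module_carrier quotient_module_add[OF L] quotient_module_smult[OF L]
    smult_l_distr smult_r_distr smult_assoc1)

lemma submodule_span_submodule:
  assumes "S \<subseteq> carrier M" shows "submodule (submodule_span R M S) R M"
proof (rule submodule_of_closed)
  show "submodule_span R M S \<subseteq> carrier M"
    using carrier_is_submodule assms by (auto simp: submodule_span_def)
qed (auto simp: submodule_span_def zero_mem_submodule submoduleE)

lemma submodule_span_least: "submodule H R M \<Longrightarrow> S \<subseteq> H \<Longrightarrow> submodule_span R M S \<subseteq> H"
  by (auto simp: submodule_span_def)

lemma lin_ext_zero: "lin_ext R M g (\<lambda>x. \<zero>) = \<zero>\<^bsub>M\<^esub>"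
  by (simp add: lin_ext_def)

lemma lin_ext_minus:
  assumes "f \<in> carrier (free_module R B)" "f' \<in> carrier (free_module R B)" "g \<in> B \<rightarrow> carrier M"
  shows "lin_ext R M g (f \<ominus>\<^bsub>free_module R B\<^esub> f') = lin_ext R M g f \<ominus>\<^bsub>M\<^esub> lin_ext R M g f'"
proof -
  interpret F: module R "free_module R B" by (rule free_module_module) (rule R.cring_axioms)
  have "\<ominus>\<^bsub>free_module R B\<^esub> f' = (\<ominus> \<one>) \<odot>\<^bsub>free_module R B\<^esub> f'"
    using assms by (simp add: F.smult_l_minus)
  then have "lin_ext R M g (\<ominus>\<^bsub>free_module R B\<^esub> f') = \<ominus>\<^bsub>M\<^esub> lin_ext R M g f'"
    using lin_ext_smult[OF assms(2) _ assms(3), of "\<ominus> \<one>"] lin_ext_closed[OF assms(2,3)]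
    by (simp add: smult_l_minus)
  then show ?thesis using lin_ext_add[OF assms(1) _ assms(3)] assms by (simp add: a_minus_def)
qed

lemma lin_ext_preimage_submodule:
  assumes L: "submodule L R M" and g: "g \<in> B \<rightarrow> carrier M"
  shows "submodule {f \<in> carrier (free_module R B). lin_ext R M g f \<in> L} R (free_module R B)"
proof -
  interpret F: module R "free_module R B" by (rule free_module_module) (rule R.cring_axioms)
  have "\<zero>\<^bsub>free_module R B\<^esub> = (\<lambda>x. \<zero>)" by (simp add: free_module_def)
  then show ?thesis
    using F.M.zero_closed lin_ext_add[OF _ _ g] lin_ext_smult[OF _ _ g] submoduleE(4,5)[OF L] zero_mem_submodule[OF L]
    by (intro F.submodule_of_closed) (auto simp: lin_ext_zero)
qed

end

subsection \<open>Tensor products\<close>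

locale tensor = N: module R N + E: module R E
  for R (structure) and N :: "('a, 'n, 'd) module_scheme" and E :: "('a, 'b, 'e) module_scheme"
begin

abbreviation T where "T \<equiv> tensor_free R N E"
abbreviation Q where "Q \<equiv> tensor_product R N E"

definition pure :: "'n \<Rightarrow> 'b \<Rightarrow> ('n \<times> 'b \<Rightarrow> 'a) set" where
  "pure x y = tensor_kernel R N E +>\<^bsub>T\<^esub> basis_elem R (x, y)"

lemma T_module: "module R T"
  unfolding tensor_free_def by (rule free_module_module) (rule N.R.cring_axioms)

sublocale T: module R T by (rule T_module)

lemma basis_elem_T: "x \<in> carrier N \<Longrightarrow> y \<in> carrier E \<Longrightarrow> basis_elem R (x, y) \<in> carrier T"
  unfolding tensor_free_def by (rule basis_elem_closed) (auto intro: N.R.cring_axioms)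

lemma tensor_relators_closed: "tensor_relators R N E \<subseteq> carrier T"
  by (auto simp: tensor_relators_def Let_def basis_elem_T T.M.minus_closed)

lemma tensor_kernel_submodule: "submodule (tensor_kernel R N E) R T"
  unfolding tensor_kernel_def by (rule T.submodule_span_submodule[OF tensor_relators_closed])

lemma Q_module: "module R Q"
  unfolding tensor_product_def by (rule T.quotient_module_module[OF tensor_kernel_submodule])

sublocale Q: module R Q by (rule Q_module)

lemma Q_carrier: "carrier Q = (\<lambda>c. tensor_kernel R N E +>\<^bsub>T\<^esub> c) ` carrier T"
  unfolding tensor_product_def by (rule T.quotient_module_carrier)

lemma Q_zero: "\<zero>\<^bsub>Q\<^esub> = tensor_kernel R N E"
  unfolding tensor_product_def by (rule T.quotient_module_zero)

lemmas Q_add = T.quotient_module_add[OF tensor_kernel_submodule, folded tensor_product_def]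
  and Q_smult = T.quotient_module_smult[OF tensor_kernel_submodule, folded tensor_product_def]
  and Q_eq_iff = T.coset_eq_iff[OF tensor_kernel_submodule]
  and Q_zero_iff = T.coset_zero_iff[OF tensor_kernel_submodule]

lemma pure_closed: "x \<in> carrier N \<Longrightarrow> y \<in> carrier E \<Longrightarrow> pure x y \<in> carrier Q"
  unfolding Q_carrier pure_def using basis_elem_T by blast

lemma relator_in_kernel: "c \<in> tensor_relators R N E \<Longrightarrow> c \<in> tensor_kernel R N E"
  by (auto simp: tensor_kernel_def submodule_span_def)

lemma kernel_relators:
  shows "\<And>x x' y. x \<in> carrier N \<Longrightarrow> x' \<in> carrier N \<Longrightarrow> y \<in> carrier E \<Longrightarrow>
      basis_elem R (x \<oplus>\<^bsub>N\<^esub> x', y) \<ominus>\<^bsub>T\<^esub> (basis_elem R (x, y) \<oplus>\<^bsub>T\<^esub> basis_elem R (x', y)) \<in> tensor_kernel R N E"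
    and "\<And>x y y'. x \<in> carrier N \<Longrightarrow> y \<in> carrier E \<Longrightarrow> y' \<in> carrier E \<Longrightarrow>
      basis_elem R (x, y \<oplus>\<^bsub>E\<^esub> y') \<ominus>\<^bsub>T\<^esub> (basis_elem R (x, y) \<oplus>\<^bsub>T\<^esub> basis_elem R (x, y')) \<in> tensor_kernel R N E"
    and "\<And>r x y. r \<in> carrier R \<Longrightarrow> x \<in> carrier N \<Longrightarrow> y \<in> carrier E \<Longrightarrow>
      basis_elem R (r \<odot>\<^bsub>N\<^esub> x, y) \<ominus>\<^bsub>T\<^esub> r \<odot>\<^bsub>T\<^esub> basis_elem R (x, y) \<in> tensor_kernel R N E"
    and "\<And>r x y. r \<in> carrier R \<Longrightarrow> x \<in> carrier N \<Longrightarrow> y \<in> carrier E \<Longrightarrow>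
      basis_elem R (x, r \<odot>\<^bsub>E\<^esub> y) \<ominus>\<^bsub>T\<^esub> r \<odot>\<^bsub>T\<^esub> basis_elem R (x, y) \<in> tensor_kernel R N E"
  by (rule relator_in_kernel; simp add: tensor_relators_def Let_def; blast)+

lemma pure_add_right:
  assumes "x \<in> carrier N" "y \<in> carrier E" "y' \<in> carrier E"
  shows "pure x (y \<oplus>\<^bsub>E\<^esub> y') = pure x y \<oplus>\<^bsub>Q\<^esub> pure x y'"
  using kernel_relators(2)[OF assms] assms unfolding pure_def
  by (subst Q_add) (auto simp: basis_elem_T Q_eq_iff)

lemma pure_smult_left:
  assumes "r \<in> carrier R" "x \<in> carrier N" "y \<in> carrier E"
  shows "pure (r \<odot>\<^bsub>N\<^esub> x) y = r \<odot>\<^bsub>Q\<^esub> pure x y"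
  using kernel_relators(3)[OF assms] assms unfolding pure_def
  by (subst Q_smult) (auto simp: basis_elem_T Q_eq_iff)

lemma pure_smult_right:
  assumes "r \<in> carrier R" "x \<in> carrier N" "y \<in> carrier E"
  shows "pure x (r \<odot>\<^bsub>E\<^esub> y) = r \<odot>\<^bsub>Q\<^esub> pure x y"
  using kernel_relators(4)[OF assms] assms unfolding pure_def
  by (subst Q_smult) (auto simp: basis_elem_T Q_eq_iff)

lemma pure_zero_right:
  assumes "x \<in> carrier N" shows "pure x \<zero>\<^bsub>E\<^esub> = \<zero>\<^bsub>Q\<^esub>"
  using pure_smult_right[OF N.R.zero_closed assms E.M.zero_closed] pure_closed[OF assms E.M.zero_closed]
  by (simp add: E.smult_l_null Q.smult_l_null)

lemma Q_induct [consumes 1, case_names zero step]: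
  assumes "U \<in> carrier Q"
    and "P \<zero>\<^bsub>Q\<^esub>"
    and "\<And>r x y V. r \<in> carrier R \<Longrightarrow> x \<in> carrier N \<Longrightarrow> y \<in> carrier E \<Longrightarrow> V \<in> carrier Q \<Longrightarrow> P V \<Longrightarrow>
      P (r \<odot>\<^bsub>Q\<^esub> pure x y \<oplus>\<^bsub>Q\<^esub> V)"
  shows "P U"
proof -
  obtain c where c: "c \<in> carrier T" "U = tensor_kernel R N E +>\<^bsub>T\<^esub> c" using assms(1) by (auto simp: Q_carrier)
  have cF: "c \<in> carrier (free_module R (carrier N \<times> carrier E))" using c(1) by (simp add: tensor_free_def)
  have cR: "c z \<in> carrier R" for z
    using cF by (cases z) (simp add: free_module_def)
  have "P (tensor_kernel R N E +>\<^bsub>T\<^esub> c)"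
    using N.R.cring_axioms cF cR
  proof (induction rule: free_module_ideal_induct)
    case zero
    have "tensor_kernel R N E +>\<^bsub>T\<^esub> \<zero>\<^bsub>T\<^esub> = \<zero>\<^bsub>Q\<^esub>"
      using Q_zero_iff[OF T.M.zero_closed] T.zero_mem_submodule[OF tensor_kernel_submodule] by (simp add: Q_zero)
    then show ?case using assms(2) by (simp add: tensor_free_def)
  next
    case (step r b g)
    obtain x y where b: "b = (x, y)" "x \<in> carrier N" "y \<in> carrier E" using step(3) by auto
    have g: "g \<in> carrier T" using step(4) by (simp add: tensor_free_def)
    have "tensor_kernel R N E +>\<^bsub>T\<^esub> (r \<odot>\<^bsub>T\<^esub> basis_elem R (x, y) \<oplus>\<^bsub>T\<^esub> g) =
      r \<odot>\<^bsub>Q\<^esub> pure x y \<oplus>\<^bsub>Q\<^esub> (tensor_kernel R N E +>\<^bsub>T\<^esub> g)"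
      unfolding pure_def using b step(2) g basis_elem_T by (simp add: Q_add Q_smult)
    then show ?case
      using assms(3)[OF step(2) b(2,3) _ step(5)] g by (simp add: b(1) Q_carrier flip: tensor_free_def)
  qed
  then show ?thesis using c by simp
qed

text \<open>The universal property for a map that is bilinear modulo L: the preimage of L is a
  submodule containing the relators. With L the kernel of another tensor product it makes induced
  maps well defined; with L zero it yields coefficient maps.\<close>

lemma tensor_kernel_lin_ext:
  assumes Y: "module R Y" and L: "submodule L R Y"
    and g: "g \<in> carrier N \<times> carrier E \<rightarrow> carrier Y"
    and "\<And>x x' y. x \<in> carrier N \<Longrightarrow> x' \<in> carrier N \<Longrightarrow> y \<in> carrier E \<Longrightarrow>
      g (x \<oplus>\<^bsub>N\<^esub> x', y) \<ominus>\<^bsub>Y\<^esub> (g (x, y) \<oplus>\<^bsub>Y\<^esub> g (x', y)) \<in> L"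
    and "\<And>x y y'. x \<in> carrier N \<Longrightarrow> y \<in> carrier E \<Longrightarrow> y' \<in> carrier E \<Longrightarrow>
      g (x, y \<oplus>\<^bsub>E\<^esub> y') \<ominus>\<^bsub>Y\<^esub> (g (x, y) \<oplus>\<^bsub>Y\<^esub> g (x, y')) \<in> L"
    and "\<And>r x y. r \<in> carrier R \<Longrightarrow> x \<in> carrier N \<Longrightarrow> y \<in> carrier E \<Longrightarrow>
      g (r \<odot>\<^bsub>N\<^esub> x, y) \<ominus>\<^bsub>Y\<^esub> r \<odot>\<^bsub>Y\<^esub> g (x, y) \<in> L"
    and "\<And>r x y. r \<in> carrier R \<Longrightarrow> x \<in> carrier N \<Longrightarrow> y \<in> carrier E \<Longrightarrow>
      g (x, r \<odot>\<^bsub>E\<^esub> y) \<ominus>\<^bsub>Y\<^esub> r \<odot>\<^bsub>Y\<^esub> g (x, y) \<in> L"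
    and "c \<in> tensor_kernel R N E"
  shows "lin_ext R Y g c \<in> L"
proof -
  interpret Y: module R Y by fact
  let ?H = "{c \<in> carrier T. lin_ext R Y g c \<in> L}"
  have "submodule ?H R T"
    using Y.lin_ext_preimage_submodule[OF L g] by (simp add: tensor_free_def)
  moreover have "tensor_relators R N E \<subseteq> ?H"
  proof
    fix c assume c: "c \<in> tensor_relators R N E"
    note eT = basis_elem_T[unfolded tensor_free_def]
    have le: "lin_ext R Y g (basis_elem R (x, y)) = g (x, y)" if "x \<in> carrier N" "y \<in> carrier E" for x y
      by (rule Y.lin_ext_basis_elem) (use g that in auto)
    have "module R (free_module R (carrier N \<times> carrier E))"
      using T_module by (simp add: tensor_free_def)
    then interpret FT: module R "free_module R (carrier N \<times> carrier E)" .
    have "lin_ext R Y g c \<in> L"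
      using c assms(4-7)
      by (auto simp: tensor_relators_def Let_def tensor_free_def Y.lin_ext_minus[OF _ _ g] eT le
          Y.lin_ext_add[OF _ _ g] Y.lin_ext_smult[OF _ _ g])
    then show "c \<in> ?H" using c tensor_relators_closed by auto
  qed
  ultimately show ?thesis
    using T.submodule_span_least[of ?H "tensor_relators R N E"] assms(8) by (auto simp: tensor_kernel_def)
qed

end

text \<open>The map on free modules carries one tensor kernel into the other, so every
  representative contributes the same coset to the union.\<close>

lemma tensor_map_coset:
  assumes "module R N" "module R E" "module R E'"
    and f: "\<And>x. x \<in> carrier E \<Longrightarrow> f x \<in> carrier E'"
      "\<And>x y. x \<in> carrier E \<Longrightarrow> y \<in> carrier E \<Longrightarrow> f (x \<oplus>\<^bsub>E\<^esub> y) = f x \<oplus>\<^bsub>E'\<^esub> f y"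
      "\<And>r x. r \<in> carrier R \<Longrightarrow> x \<in> carrier E \<Longrightarrow> f (r \<odot>\<^bsub>E\<^esub> x) = r \<odot>\<^bsub>E'\<^esub> f x"
    and c: "c \<in> carrier (tensor_free R N E)"
  shows "tensor_map R N E' f (tensor_kernel R N E +>\<^bsub>tensor_free R N E\<^esub> c) =
    tensor_kernel R N E' +>\<^bsub>tensor_free R N E'\<^esub>
      lin_ext R (tensor_free R N E') (\<lambda>(x, y). basis_elem R (x, f y)) c"
proof -
  interpret t: tensor R N E using assms(1,2) by (rule tensor.intro)
  interpret t': tensor R N E' using assms(1,3) by (rule tensor.intro)
  let ?g = "\<lambda>(x, y). basis_elem R (x, f y)"
  let ?h = "lin_ext R t'.T ?g"
  have g: "?g \<in> carrier N \<times> carrier E \<rightarrow> carrier t'.T" using t'.basis_elem_T f(1) by auto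
  have K: "?h a \<in> tensor_kernel R N E'" if "a \<in> tensor_kernel R N E" for a
    by (rule t.tensor_kernel_lin_ext[OF t'.T_module t'.tensor_kernel_submodule g _ _ _ _ that])
      (use f in \<open>simp_all add: t'.kernel_relators\<close>)
  have cl: "?h a \<in> carrier t'.T" if "a \<in> carrier t.T" for a
    using t'.T.lin_ext_closed[OF _ g] that by (simp add: tensor_free_def)
  have "tensor_kernel R N E' +>\<^bsub>t'.T\<^esub> ?h a = tensor_kernel R N E' +>\<^bsub>t'.T\<^esub> ?h c"
    if "a \<in> carrier t.T" "a \<ominus>\<^bsub>t.T\<^esub> c \<in> tensor_kernel R N E" for a
    using K[OF that(2)] t'.T.lin_ext_minus[OF _ _ g, of a c] that(1) c
    by (simp add: t'.Q_eq_iff cl flip: tensor_free_def[of R N E])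
  then show ?thesis
    unfolding tensor_map_def by (rule t.T.coset_image_const[OF t.tensor_kernel_submodule c])
qed

locale tensor_hom = tensor R N E + E': module R E'
  for R (structure) and N :: "('a, 'n, 'd) module_scheme" and E :: "('a, 'b, 'e) module_scheme"
    and E' :: "('a, 'b2, 'f) module_scheme" +
  fixes f :: "'b \<Rightarrow> 'b2"
  assumes f_closed: "\<And>x. x \<in> carrier E \<Longrightarrow> f x \<in> carrier E'"
    and f_add: "\<And>x y. x \<in> carrier E \<Longrightarrow> y \<in> carrier E \<Longrightarrow> f (x \<oplus>\<^bsub>E\<^esub> y) = f x \<oplus>\<^bsub>E'\<^esub> f y"
    and f_smult: "\<And>r x. r \<in> carrier R \<Longrightarrow> x \<in> carrier E \<Longrightarrow> f (r \<odot>\<^bsub>E\<^esub> x) = r \<odot>\<^bsub>E'\<^esub> f x"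
begin

sublocale cod: tensor R N E' ..

abbreviation tmap where "tmap \<equiv> tensor_map R N E' f"

lemmas tmap_coset = tensor_map_coset[OF N.module_axioms E.module_axioms E'.module_axioms f_closed f_add f_smult]

lemma cell_map: "(\<lambda>(x, y). basis_elem R (x, f y)) \<in> carrier N \<times> carrier E \<rightarrow> carrier cod.T"
  using cod.basis_elem_T f_closed by auto

lemma tmap_pure:
  assumes "x \<in> carrier N" "y \<in> carrier E" shows "tmap (pure x y) = cod.pure x (f y)"
  unfolding pure_def cod.pure_def
  using assms cod.basis_elem_T[OF assms(1) f_closed[OF assms(2)]]
  by (simp add: tmap_coset basis_elem_T cod.T.lin_ext_basis_elem)

abbreviation cmap where "cmap \<equiv> lin_ext R cod.T (\<lambda>(x, y). basis_elem R (x, f y))"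

lemma cmap_linear:
  shows "\<And>a. a \<in> carrier T \<Longrightarrow> cmap a \<in> carrier cod.T"
    and "\<And>a b. a \<in> carrier T \<Longrightarrow> b \<in> carrier T \<Longrightarrow> cmap (a \<oplus>\<^bsub>T\<^esub> b) = cmap a \<oplus>\<^bsub>cod.T\<^esub> cmap b"
    and "\<And>r a. r \<in> carrier R \<Longrightarrow> a \<in> carrier T \<Longrightarrow> cmap (r \<odot>\<^bsub>T\<^esub> a) = r \<odot>\<^bsub>cod.T\<^esub> cmap a"
  using cod.T.lin_ext_closed[OF _ cell_map] cod.T.lin_ext_add[OF _ _ cell_map]
    cod.T.lin_ext_smult[OF _ _ cell_map]
  by (simp_all add: tensor_free_def[of R N E])

lemma tmap_closed: "U \<in> carrier Q \<Longrightarrow> tmap U \<in> carrier cod.Q"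
  by (auto simp: Q_carrier cod.Q_carrier tmap_coset cmap_linear)

lemma tmap_add: "U \<in> carrier Q \<Longrightarrow> V \<in> carrier Q \<Longrightarrow> tmap (U \<oplus>\<^bsub>Q\<^esub> V) = tmap U \<oplus>\<^bsub>cod.Q\<^esub> tmap V"
  by (auto simp: Q_carrier tmap_coset Q_add cod.Q_add cmap_linear)

lemma tmap_smult: "r \<in> carrier R \<Longrightarrow> U \<in> carrier Q \<Longrightarrow> tmap (r \<odot>\<^bsub>Q\<^esub> U) = r \<odot>\<^bsub>cod.Q\<^esub> tmap U"
  by (auto simp: Q_carrier tmap_coset Q_smult cod.Q_smult cmap_linear)

end

subsection \<open>Homology\<close>

lemma zero_homology_iff:
  assumes C: "\<And>i. module R (C i)"
    and d: "\<And>i x. x \<in> carrier (C (Suc i)) \<Longrightarrow> d i x \<in> carrier (C i)"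
      "\<And>i x y. x \<in> carrier (C (Suc i)) \<Longrightarrow> y \<in> carrier (C (Suc i)) \<Longrightarrow>
        d i (x \<oplus>\<^bsub>C (Suc i)\<^esub> y) = d i x \<oplus>\<^bsub>C i\<^esub> d i y"
      "\<And>i r x. r \<in> carrier R \<Longrightarrow> x \<in> carrier (C (Suc i)) \<Longrightarrow>
        d i (r \<odot>\<^bsub>C (Suc i)\<^esub> x) = r \<odot>\<^bsub>C i\<^esub> d i x"
  shows "zero_module (homology C d n) \<longleftrightarrow> cycles C d n \<subseteq> boundaries C d n"
proof -
  interpret Cn: module R "C i" for i by (rule C)
  let ?Z = "cycles C d n" and ?B = "boundaries C d n"
  have d_zero: "d i \<zero>\<^bsub>C (Suc i)\<^esub> = \<zero>\<^bsub>C i\<^esub>" for i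
    using d(3)[of "\<zero>\<^bsub>R\<^esub>" "\<zero>\<^bsub>C (Suc i)\<^esub>" i] d(1)[of "\<zero>\<^bsub>C (Suc i)\<^esub>" i]
    by (simp add: Cn.smult_l_null)
  have B: "submodule ?B R (C n)"
  proof (rule Cn.submodule_of_closed)
    show "\<zero>\<^bsub>C n\<^esub> \<in> ?B" unfolding boundaries_def
      by (rule image_eqI[of _ _ "\<zero>\<^bsub>C (Suc n)\<^esub>"]) (auto simp: d_zero)
  qed (auto simp: boundaries_def d(1) simp flip: d(2,3))
  have Z: "?Z \<subseteq> carrier (C n)" "\<zero>\<^bsub>C n\<^esub> \<in> ?Z" by (cases n; auto simp: d_zero)+
  \<comment> \<open>Cosets depend on addition only, so cutting the carrier down to the cycles does
    not change them.\<close>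
  have coset: "?B +>\<^bsub>(C n)\<lparr>carrier := ?Z\<rparr>\<^esub> z = ?B +>\<^bsub>C n\<^esub> z" for z
    by (simp add: a_r_coset_def')
  have "carrier (homology C d n) = (\<lambda>z. ?B +>\<^bsub>C n\<^esub> z) ` ?Z"
    by (auto simp: homology_def quotient_module_def A_RCOSETS_def' coset)
  moreover have "\<zero>\<^bsub>homology C d n\<^esub> = ?B" by (simp add: homology_def quotient_module_def)
  moreover have "?B +>\<^bsub>C n\<^esub> z = ?B \<longleftrightarrow> z \<in> ?B" if "z \<in> ?Z" for z
    using Cn.coset_zero_iff[OF B] that Z(1) by blast
  moreover have "f ` ?Z = {?B} \<longleftrightarrow> (\<forall>z\<in>?Z. f z = ?B)" for f
    using Z(2) by blast
  ultimately show ?thesis unfolding zero_module_def by (simp add: subset_eq)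
qed

subsection \<open>Tensor products with a residue field\<close>

lemma (in module) smult_left_commute:
  assumes "a \<in> carrier R" "b \<in> carrier R" "x \<in> carrier M"
  shows "a \<odot>\<^bsub>M\<^esub> (b \<odot>\<^bsub>M\<^esub> x) = b \<odot>\<^bsub>M\<^esub> (a \<odot>\<^bsub>M\<^esub> x)"
  using assms by (simp add: R.m_comm flip: smult_assoc1)

text \<open>The properties of the \<open>R\<close>-module \<open>k(p)\<close>, with \<open>\<iota>\<close> its unit element, that describe
  the elements of \<open>k(p) \<otimes> E\<close> for a free module \<open>E\<close>.\<close>

locale residue_module = N: module R N
  for R (structure) and N :: "('a, 'n, 'd) module_scheme" +
  fixes p :: "'a set" and \<iota> :: 'n
  assumes prime: "primeideal p R"
    and unit_closed: "\<iota> \<in> carrier N"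
    and unit_annihilator: "\<And>a. a \<in> carrier R \<Longrightarrow> a \<odot>\<^bsub>N\<^esub> \<iota> = \<zero>\<^bsub>N\<^esub> \<longleftrightarrow> a \<in> p"
    and smult_inj: "\<And>u x. u \<in> carrier R - p \<Longrightarrow> x \<in> carrier N \<Longrightarrow> u \<odot>\<^bsub>N\<^esub> x = \<zero>\<^bsub>N\<^esub> \<Longrightarrow> x = \<zero>\<^bsub>N\<^esub>"
    and denominators: "\<And>x. x \<in> carrier N \<Longrightarrow>
      \<exists>u\<in>carrier R - p. \<exists>a\<in>carrier R. u \<odot>\<^bsub>N\<^esub> x = a \<odot>\<^bsub>N\<^esub> \<iota>"
    and unit_fraction: "\<And>u. u \<in> carrier R - p \<Longrightarrow> \<exists>w\<in>carrier N. u \<odot>\<^bsub>N\<^esub> w = \<iota>"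
begin

text \<open>\<open>w\<close> is the element 1/u of k(p).\<close>

definition unit_frac :: "'a \<Rightarrow> 'n \<Rightarrow> bool" where
  "unit_frac u w \<longleftrightarrow> u \<in> carrier R - p \<and> w \<in> carrier N \<and> u \<odot>\<^bsub>N\<^esub> w = \<iota>"

lemma smult_left_cancel:
  assumes "u \<in> carrier R - p" "x \<in> carrier N" "y \<in> carrier N" "u \<odot>\<^bsub>N\<^esub> x = u \<odot>\<^bsub>N\<^esub> y"
  shows "x = y"
proof -
  have "u \<odot>\<^bsub>N\<^esub> (x \<ominus>\<^bsub>N\<^esub> y) = \<zero>\<^bsub>N\<^esub>"
    using assms by (simp add: a_minus_def N.smult_r_distr N.smult_r_minus N.M.r_neg)
  then have "x \<ominus>\<^bsub>N\<^esub> y = \<zero>\<^bsub>N\<^esub>" using smult_inj assms by simp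
  then show ?thesis using assms(2,3) N.M.add.inv_solve_right'[of "\<zero>\<^bsub>N\<^esub>" x y] by (simp add: a_minus_def)
qed

lemma unit_frac_one: "unit_frac \<one> \<iota>"
  using N.R.primeideal_unit_complement(1)[OF prime] unit_closed by (simp add: unit_frac_def)

lemma unit_frac_annihilator:
  assumes "unit_frac u w" "a \<in> carrier R" shows "a \<odot>\<^bsub>N\<^esub> w = \<zero>\<^bsub>N\<^esub> \<longleftrightarrow> a \<in> p"
proof -
  have w: "u \<in> carrier R - p" "w \<in> carrier N" "u \<odot>\<^bsub>N\<^esub> w = \<iota>" using assms(1) by (auto simp: unit_frac_def)
  have "u \<odot>\<^bsub>N\<^esub> (a \<odot>\<^bsub>N\<^esub> w) = a \<odot>\<^bsub>N\<^esub> \<iota>"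
    using w assms(2) N.smult_left_commute[of u a w] by simp
  then have "a \<odot>\<^bsub>N\<^esub> w = \<zero>\<^bsub>N\<^esub> \<longleftrightarrow> a \<odot>\<^bsub>N\<^esub> \<iota> = \<zero>\<^bsub>N\<^esub>"
    using smult_inj[of u "a \<odot>\<^bsub>N\<^esub> w"] w assms(2) by (metis DiffE N.smult_closed N.smult_r_null)
  then show ?thesis using unit_annihilator assms(2) by simp
qed

lemma unit_frac_refine:
  assumes "unit_frac u w" "v \<in> carrier R - p"
  obtains w' where "unit_frac (u \<otimes> v) w'" "w = v \<odot>\<^bsub>N\<^esub> w'"
proof -
  have w: "u \<in> carrier R - p" "w \<in> carrier N" "u \<odot>\<^bsub>N\<^esub> w = \<iota>" using assms(1) by (auto simp: unit_frac_def)
  have uv: "u \<otimes> v \<in> carrier R - p"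
    using N.R.primeideal_unit_complement(2)[OF prime w(1) assms(2)] .
  then obtain w' where w': "w' \<in> carrier N" "(u \<otimes> v) \<odot>\<^bsub>N\<^esub> w' = \<iota>" using unit_fraction by blast
  have "u \<odot>\<^bsub>N\<^esub> w = u \<odot>\<^bsub>N\<^esub> (v \<odot>\<^bsub>N\<^esub> w')"
    using w w' assms(2) by (simp add: N.smult_assoc1)
  then have "w = v \<odot>\<^bsub>N\<^esub> w'" using smult_left_cancel[OF w(1,2)] w'(1) assms(2) by simp
  then show ?thesis using that uv w' by (simp add: unit_frac_def)
qed

text \<open>Common denominators: 1/u = v/(uv) and 1/v = u/(uv), with the same 1/(uv) since
  multiplication by uv is injective.\<close>

lemma unit_frac_common:
  assumes "unit_frac u w" "unit_frac v x"
  obtains y where "unit_frac (u \<otimes> v) y" "w = v \<odot>\<^bsub>N\<^esub> y" "x = u \<odot>\<^bsub>N\<^esub> y"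
proof -
  have uv: "u \<in> carrier R - p" "v \<in> carrier R - p" using assms by (auto simp: unit_frac_def)
  obtain y where y: "unit_frac (u \<otimes> v) y" "w = v \<odot>\<^bsub>N\<^esub> y"
    using unit_frac_refine[OF assms(1) uv(2)] .
  obtain y' where y': "unit_frac (v \<otimes> u) y'" "x = u \<odot>\<^bsub>N\<^esub> y'"
    using unit_frac_refine[OF assms(2) uv(1)] .
  have "y = y'"
    using smult_left_cancel[of "u \<otimes> v" y y'] y(1) y'(1) uv by (simp add: unit_frac_def N.R.m_comm)
  then show ?thesis using that y y'(2) by blast
qed

lemma multiple_of_unit_frac:
  assumes "x \<in> carrier N"
  obtains u w a where "unit_frac u w" "a \<in> carrier R" "x = a \<odot>\<^bsub>N\<^esub> w"
proof -
  obtain u a where u: "u \<in> carrier R - p" "a \<in> carrier R" "u \<odot>\<^bsub>N\<^esub> x = a \<odot>\<^bsub>N\<^esub> \<iota>"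
    using denominators[OF assms] by blast
  obtain w where w: "w \<in> carrier N" "u \<odot>\<^bsub>N\<^esub> w = \<iota>" using unit_fraction[OF u(1)] by blast
  have "u \<odot>\<^bsub>N\<^esub> x = u \<odot>\<^bsub>N\<^esub> (a \<odot>\<^bsub>N\<^esub> w)"
    using u w N.smult_left_commute[of u a w] by simp
  then have "x = a \<odot>\<^bsub>N\<^esub> w" using smult_left_cancel[OF u(1) assms] u w by simp
  then show ?thesis using that[of u w a] u w by (simp add: unit_frac_def)
qed

end

section \<open>Tensor products of k(p) with a free module\<close>

locale residue_tensor = residue_module R N p \<iota>
  for R (structure) and N :: "('a, 'n, 'd) module_scheme" and p \<iota> +
  fixes B :: "'x set"
begin

abbreviation E where "E \<equiv> free_module R B"

lemma E_module: "module R E"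
  by (rule free_module_module) (rule N.R.cring_axioms)

sublocale E: module R E by (rule E_module)

sublocale tensor R N E ..

lemma E_coeff: "f \<in> carrier E \<Longrightarrow> f b \<in> carrier R"
  by (simp add: free_module_def)

text \<open>A sum of tensors becomes a single tensor with first factor 1/u: bring the first factors
  to a common denominator and move the numerators across to the free module.\<close>

lemma Q_repr:
  assumes "U \<in> carrier Q"
  shows "\<exists>u w f. unit_frac u w \<and> f \<in> carrier E \<and> U = pure w f"
  using assms
proof (induction rule: Q_induct)
  case zero
  show ?case using unit_frac_one pure_zero_right[OF unit_closed] E.M.zero_closed by metis
next
  case (step r x y V)
  obtain u w f where V: "unit_frac u w" "f \<in> carrier E" "V = pure w f" using step by blast
  obtain v w' a where x: "unit_frac v w'" "a \<in> carrier R" "x = a \<odot>\<^bsub>N\<^esub> w'"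
    by (rule multiple_of_unit_frac[OF step(2)])
  obtain z where z: "unit_frac (u \<otimes> v) z" "w = v \<odot>\<^bsub>N\<^esub> z" "w' = u \<odot>\<^bsub>N\<^esub> z"
    by (rule unit_frac_common[OF V(1) x(1)])
  have c: "u \<in> carrier R" "v \<in> carrier R" "z \<in> carrier N" "w' \<in> carrier N"
    using V(1) x(1) z(1) by (auto simp: unit_frac_def)
  have "r \<odot>\<^bsub>Q\<^esub> pure x y = pure z ((r \<otimes> a \<otimes> u) \<odot>\<^bsub>E\<^esub> y)"
    using c step x(2,3) z(3)
    by (simp add: pure_smult_left pure_smult_right pure_closed Q.smult_assoc1)
  moreover have "V = pure z (v \<odot>\<^bsub>E\<^esub> f)"
    using c V(2,3) z(2) by (simp add: pure_smult_left pure_smult_right)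
  ultimately have "r \<odot>\<^bsub>Q\<^esub> pure x y \<oplus>\<^bsub>Q\<^esub> V = pure z ((r \<otimes> a \<otimes> u) \<odot>\<^bsub>E\<^esub> y \<oplus>\<^bsub>E\<^esub> v \<odot>\<^bsub>E\<^esub> f)"
    using c step x(2) V(2) by (simp add: pure_add_right)
  moreover have "(r \<otimes> a \<otimes> u) \<odot>\<^bsub>E\<^esub> y \<oplus>\<^bsub>E\<^esub> v \<odot>\<^bsub>E\<^esub> f \<in> carrier E"
    using c step x(2) V(2) by simp
  ultimately show ?case using z(1) by blast
qed

text \<open>The map \<open>x \<otimes> f \<mapsto> f(b) x\<close> detects the coefficient at \<open>b\<close>.\<close>

lemma pure_zero_imp_coeff:
  assumes "x \<in> carrier N" "f \<in> carrier E" "pure x f = \<zero>\<^bsub>Q\<^esub>"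
  shows "f b \<odot>\<^bsub>N\<^esub> x = \<zero>\<^bsub>N\<^esub>"
proof -
  let ?g = "\<lambda>(x, y). y b \<odot>\<^bsub>N\<^esub> x"
  have g: "?g \<in> carrier N \<times> carrier E \<rightarrow> carrier N" using E_coeff by auto
  have L: "submodule {\<zero>\<^bsub>N\<^esub>} R N" by (rule N.submodule_of_closed) auto
  have E_apply: "(f \<oplus>\<^bsub>E\<^esub> g) b = f b \<oplus> g b" "(r \<odot>\<^bsub>E\<^esub> f) b = r \<otimes> f b" for f g r
    by (simp_all add: free_module_def)
  have "basis_elem R (x, f) \<in> tensor_kernel R N E"
    using assms(3) Q_zero_iff[OF basis_elem_T[OF assms(1,2)]] by (simp add: pure_def Q_zero)
  then have "lin_ext R N ?g (basis_elem R (x, f)) \<in> {\<zero>\<^bsub>N\<^esub>}"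
  proof (rule tensor_kernel_lin_ext[OF N.module_axioms L g, rotated -1])
    show "?g (r \<odot>\<^bsub>N\<^esub> x, y) \<ominus>\<^bsub>N\<^esub> r \<odot>\<^bsub>N\<^esub> ?g (x, y) \<in> {\<zero>\<^bsub>N\<^esub>}"
      if "r \<in> carrier R" "x \<in> carrier N" "y \<in> carrier E" for r x y
      using that E_coeff[OF that(3)] by (simp add: N.R.m_comm N.M.r_neg a_minus_def flip: N.smult_assoc1)
  qed (use E_coeff in \<open>simp_all add: E_apply N.smult_r_distr N.smult_l_distr N.smult_assoc1 a_minus_def N.M.r_neg\<close>)
  then show ?thesis
    using N.lin_ext_basis_elem[of ?g "(x, f)"] assms E_coeff by simp
qed

text \<open>Both directions use that p is the annihilator of 1/u: a zero tensor forces each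
  coefficient to kill 1/u, and conversely a coefficient in p can be moved across, where it kills
  1/u.\<close>

lemma pure_zero_iff:
  assumes "unit_frac u w" "f \<in> carrier E"
  shows "pure w f = \<zero>\<^bsub>Q\<^esub> \<longleftrightarrow> (\<forall>b. f b \<in> p)"
proof
  have w: "w \<in> carrier N" using assms(1) by (simp add: unit_frac_def)
  assume "pure w f = \<zero>\<^bsub>Q\<^esub>"
  then show "\<forall>b. f b \<in> p"
    using pure_zero_imp_coeff[OF w assms(2)] unit_frac_annihilator[OF assms(1)] E_coeff[OF assms(2)] by blast
next
  have w: "w \<in> carrier N" using assms(1) by (simp add: unit_frac_def)
  assume "\<forall>b. f b \<in> p"
  then have p: "f b \<in> p" for b by blast
  show "pure w f = \<zero>\<^bsub>Q\<^esub>"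
    using N.R.cring_axioms assms(2) p
  proof (induction rule: free_module_ideal_induct)
    case zero
    show ?case by (rule pure_zero_right[OF w])
  next
    case (step r b g)
    have e: "basis_elem R b \<in> carrier E" by (rule basis_elem_closed[OF N.R.cring_axioms step(3)])
    have "r \<odot>\<^bsub>N\<^esub> w = \<zero>\<^bsub>N\<^esub>" using unit_frac_annihilator[OF assms(1) step(2)] step(1) by simp
    then have "pure w (r \<odot>\<^bsub>E\<^esub> basis_elem R b) = \<zero> \<odot>\<^bsub>Q\<^esub> pure w (basis_elem R b)"
      using pure_smult_right[OF step(2) w e] pure_smult_left[OF step(2) w e]
        pure_smult_left[OF N.R.zero_closed w e] w by simp
    then have "pure w (r \<odot>\<^bsub>E\<^esub> basis_elem R b) = \<zero>\<^bsub>Q\<^esub>"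
      using pure_closed[OF w e] by (simp add: Q.smult_l_null)
    then show ?case using step e w by (simp add: pure_add_right)
  qed
qed

end

locale residue_complex = free_complex R B d + residue_module R N p \<iota>
  for R :: "('a, 'c) ring_scheme" (structure) and B :: "nat \<Rightarrow> 'x set" and d
    and N :: "('a, 'n, 'd) module_scheme" and p \<iota>
begin

lemma homology_zero_iff:
  "zero_module (homology (\<lambda>i. tensor_product R N (F i)) (\<lambda>i. tensor_map R N (F i) (d i)) n) \<longleftrightarrow>
    (\<forall>f\<in>cyc p n. \<exists>u\<in>carrier R - p. u \<odot>\<^bsub>F n\<^esub> f \<in> bnd p n)"
proof -
  let ?C = "\<lambda>i. tensor_product R N (F i)" and ?D = "\<lambda>i. tensor_map R N (F i) (d i)"
  interpret t: residue_tensor R N p \<iota> "B i" for i ..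
  have "tensor_hom R N (F (Suc i)) (F i) (d i)" for i
    by unfold_locales (rule d_closed d_add d_smult; assumption)+
  then interpret th: tensor_hom R N "F (Suc i)" "F i" "d i" for i .
  have p: "ideal p R" using prime by (rule primeideal.axioms(1))
  have zero_iff: "t.pure i w f = \<zero>\<^bsub>?C i\<^esub> \<longleftrightarrow> f \<in> sub p i" if "unit_frac u w" "f \<in> carrier (F i)" for u w f i
    using t.pure_zero_iff[OF that] that(2) by (simp add: sub_def)
  have cycle_iff: "t.pure i w f \<in> cycles ?C ?D i \<longleftrightarrow> f \<in> cyc p i"
    if "unit_frac u w" "f \<in> carrier (F i)" for u w f i
  proof (cases i)
    case 0
    then show ?thesis using that t.pure_closed[of w f 0] by (simp add: cyc_def unit_frac_def)
  next
    case (Suc k)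
    have w: "w \<in> carrier N" using that(1) by (simp add: unit_frac_def)
    have f: "f \<in> carrier (F (Suc k))" using that(2) Suc by simp
    have "t.pure (Suc k) w f \<in> cycles ?C ?D (Suc k) \<longleftrightarrow> t.pure k w (d k f) = \<zero>\<^bsub>?C k\<^esub>"
      using th.tmap_pure[OF w f] t.pure_closed[OF w f] by simp
    then show ?thesis using zero_iff[OF that(1) d_closed[OF f]] f by (simp add: Suc cyc_def)
  qed
  have "cycles ?C ?D n \<subseteq> boundaries ?C ?D n \<longleftrightarrow>
    (\<forall>f\<in>cyc p n. \<exists>u\<in>carrier R - p. u \<odot>\<^bsub>F n\<^esub> f \<in> bnd p n)"
  proof (intro iffI ballI subsetI)
    fix f assume sub: "cycles ?C ?D n \<subseteq> boundaries ?C ?D n" and f: "f \<in> cyc p n"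
    have fF: "f \<in> carrier (F n)" using f by (simp add: cyc_def)
    have "t.pure n \<iota> f \<in> boundaries ?C ?D n" using cycle_iff[OF unit_frac_one fF] f sub by blast
    then obtain U where U: "U \<in> carrier (?C (Suc n))" "t.pure n \<iota> f = ?D n U"
      by (auto simp: boundaries_def)
    obtain u w g where w: "unit_frac u w" and g: "g \<in> carrier (F (Suc n))" and Uw: "U = t.pure (Suc n) w g"
      using t.Q_repr[OF U(1)] by blast
    have c: "u \<in> carrier R - p" "w \<in> carrier N" "u \<odot>\<^bsub>N\<^esub> w = \<iota>" using w by (auto simp: unit_frac_def)
    have m: "(\<ominus> \<one>) \<odot>\<^bsub>F n\<^esub> d n g \<in> carrier (F n)" using d_closed[OF g] by simp
    \<comment> \<open>As \<open>\<iota>\<close> = u w, the factor u moves to f; so u f and d g have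
      the same tensor with w and differ by an element of p F. The multiplier sought is the
      denominator of the preimage \<open>U\<close>.\<close>
    have "t.pure n w (u \<odot>\<^bsub>F n\<^esub> f) = t.pure n w (d n g)"
      using t.pure_smult_left[of u w f n] t.pure_smult_right[of u w f n] c fF U(2) Uw th.tmap_pure[OF c(2) g]
      by simp
    then have "t.pure n w (u \<odot>\<^bsub>F n\<^esub> f \<oplus>\<^bsub>F n\<^esub> (\<ominus> \<one>) \<odot>\<^bsub>F n\<^esub> d n g) =
      t.pure n w (d n g \<oplus>\<^bsub>F n\<^esub> (\<ominus> \<one>) \<odot>\<^bsub>F n\<^esub> d n g)"
      using c fF d_closed[OF g] m by (simp add: t.pure_add_right)
    also have "\<dots> = \<zero>\<^bsub>?C n\<^esub>"
      using d_closed[OF g] t.pure_zero_right[OF c(2), of n] by (simp add: F.smult_l_minus F.M.r_neg)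
    finally have h: "u \<odot>\<^bsub>F n\<^esub> f \<oplus>\<^bsub>F n\<^esub> (\<ominus> \<one>) \<odot>\<^bsub>F n\<^esub> d n g \<in> sub p n"
      using zero_iff[OF w] c fF m by simp
    have "u \<odot>\<^bsub>F n\<^esub> f = d n g \<oplus>\<^bsub>F n\<^esub> (u \<odot>\<^bsub>F n\<^esub> f \<oplus>\<^bsub>F n\<^esub> (\<ominus> \<one>) \<odot>\<^bsub>F n\<^esub> d n g)"
      using c fF d_closed[OF g] F.M.a_lcomm[of "d n g" n "u \<odot>\<^bsub>F n\<^esub> f" "\<ominus>\<^bsub>F n\<^esub> d n g"]
      by (simp add: F.smult_l_minus F.M.r_neg)
    then show "\<exists>u\<in>carrier R - p. u \<odot>\<^bsub>F n\<^esub> f \<in> bnd p n"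
      using c(1) g h unfolding bnd_def by blast
  next
    fix U assume acyclic: "\<forall>f\<in>cyc p n. \<exists>u\<in>carrier R - p. u \<odot>\<^bsub>F n\<^esub> f \<in> bnd p n"
      and U: "U \<in> cycles ?C ?D n"
    have "U \<in> carrier (?C n)" using U by (cases n) auto
    then obtain u w f where w: "unit_frac u w" and f: "f \<in> carrier (F n)" and Uw: "U = t.pure n w f"
      using t.Q_repr by blast
    have "f \<in> cyc p n" using cycle_iff[OF w f] U Uw by simp
    then obtain v where v: "v \<in> carrier R - p" "v \<odot>\<^bsub>F n\<^esub> f \<in> bnd p n" using acyclic by blast
    then obtain g h where g: "g \<in> carrier (F (Suc n))" and h: "h \<in> sub p n"
      and vf: "v \<odot>\<^bsub>F n\<^esub> f = d n g \<oplus>\<^bsub>F n\<^esub> h" by (auto simp: bnd_def)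
    \<comment> \<open>Enlarging the denominator to uv frees a factor v, which then moves to f, where
      v f is known to be a boundary modulo p.\<close>
    obtain x where x: "unit_frac (u \<otimes> v) x" "w = v \<odot>\<^bsub>N\<^esub> x" by (rule unit_frac_refine[OF w v(1)])
    have xN: "x \<in> carrier N" using x(1) by (simp add: unit_frac_def)
    have "U = t.pure n x (d n g \<oplus>\<^bsub>F n\<^esub> h)"
      using v(1) xN f by (simp add: Uw x(2) t.pure_smult_left flip: vf t.pure_smult_right)
    also have "\<dots> = t.pure n x (d n g)"
      using zero_iff[OF x(1) sub_carrier[OF h]] h xN d_closed[OF g] sub_carrier[OF h]
      by (simp add: t.pure_add_right t.pure_closed)
    also have "\<dots> = ?D n (t.pure (Suc n) x g)" using th.tmap_pure[OF xN g] by simp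
    finally show "U \<in> boundaries ?C ?D n"
      using t.pure_closed[OF xN g] by (auto simp: boundaries_def)
  qed
  then show ?thesis
    using zero_homology_iff[of R ?C ?D n, OF t.Q_module th.tmap_closed th.tmap_add th.tmap_smult] by simp
qed

end

section \<open>Localization and the residue field\<close>

locale localized_ring = cring R for R (structure) +
  fixes S :: "'a set"
  assumes S_subset: "S \<subseteq> carrier R" and S_one: "\<one> \<in> S"
    and S_mult: "\<And>s t. s \<in> S \<Longrightarrow> t \<in> S \<Longrightarrow> s \<otimes> t \<in> S"
begin

abbreviation fr where "fr \<equiv> fraction R S"
abbreviation L where "L \<equiv> localization R S"

text \<open>Equality of the fractions a/s and b/t, without the membership conditions built into
  \<open>fraction_rel\<close>.\<close>

definition frac_eq :: "'a \<Rightarrow> 'a \<Rightarrow> 'a \<Rightarrow> 'a \<Rightarrow> bool" where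
  "frac_eq a s b t \<longleftrightarrow> (\<exists>u\<in>S. u \<otimes> (t \<otimes> a \<ominus> s \<otimes> b) = \<zero>)"

lemma S_carrier: "s \<in> S \<Longrightarrow> s \<in> carrier R"
  using S_subset by blast

lemma frac_eqI:
  assumes "a \<in> carrier R" "b \<in> carrier R" "s \<in> S" "t \<in> S" "t \<otimes> a = s \<otimes> b"
  shows "frac_eq a s b t"
  unfolding frac_eq_def using assms S_one S_carrier by (intro bexI[of _ \<one>]) auto

lemma frac_eq_sym:
  assumes "a \<in> carrier R" "b \<in> carrier R" "s \<in> S" "t \<in> S" "frac_eq a s b t"
  shows "frac_eq b t a s"
proof -
  obtain u where u: "u \<in> S" "u \<otimes> (t \<otimes> a \<ominus> s \<otimes> b) = \<zero>" using assms by (auto simp: frac_eq_def)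
  note c = assms(1,2) S_carrier[OF assms(3)] S_carrier[OF assms(4)] S_carrier[OF u(1)]
  have "u \<otimes> (s \<otimes> b \<ominus> t \<otimes> a) = \<ominus> (u \<otimes> (t \<otimes> a \<ominus> s \<otimes> b))" using c by algebra
  then show ?thesis using u unfolding frac_eq_def by auto
qed

lemma frac_eq_trans:
  assumes "a \<in> carrier R" "b \<in> carrier R" "c \<in> carrier R" "s \<in> S" "t \<in> S" "r \<in> S"
    and "frac_eq a s b t" "frac_eq b t c r"
  shows "frac_eq a s c r"
proof -
  obtain u where u: "u \<in> S" "u \<otimes> (t \<otimes> a \<ominus> s \<otimes> b) = \<zero>" using assms by (auto simp: frac_eq_def)
  obtain v where v: "v \<in> S" "v \<otimes> (r \<otimes> b \<ominus> t \<otimes> c) = \<zero>" using assms by (auto simp: frac_eq_def)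
  note cl = assms(1-3) S_carrier[OF assms(4)] S_carrier[OF assms(5)] S_carrier[OF assms(6)]
    S_carrier[OF u(1)] S_carrier[OF v(1)]
  \<comment> \<open>The extra factor t makes it possible to eliminate b between the two
    relations.\<close>
  have "u \<otimes> v \<otimes> t \<otimes> (r \<otimes> a \<ominus> s \<otimes> c) =
    r \<otimes> v \<otimes> (u \<otimes> (t \<otimes> a \<ominus> s \<otimes> b)) \<oplus> s \<otimes> u \<otimes> (v \<otimes> (r \<otimes> b \<ominus> t \<otimes> c))"
    using cl by algebra
  also have "\<dots> = \<zero>" using cl by (simp add: u(2) v(2))
  finally show ?thesis unfolding frac_eq_def using S_mult u(1) v(1) assms(5) by blast
qed

lemma fr_mem_iff:
  assumes "a \<in> carrier R" "s \<in> S"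
  shows "x \<in> fr a s \<longleftrightarrow> (\<exists>b t. x = (b, t) \<and> b \<in> carrier R \<and> t \<in> S \<and> frac_eq a s b t)"
  using assms by (auto simp: fraction_def fraction_rel_def frac_eq_def)

lemma fr_eq_iff:
  assumes "a \<in> carrier R" "b \<in> carrier R" "s \<in> S" "t \<in> S"
  shows "fr a s = fr b t \<longleftrightarrow> frac_eq a s b t"
proof
  assume "fr a s = fr b t"
  moreover have "(b, t) \<in> fr b t"
    using fr_mem_iff[OF assms(2,4)] frac_eqI[of b b t t] assms by auto
  ultimately have "(b, t) \<in> fr a s" by simp
  then show "frac_eq a s b t" using fr_mem_iff[OF assms(1,3)] by blast
next
  assume e: "frac_eq a s b t"
  have "frac_eq a s c r \<longleftrightarrow> frac_eq b t c r" if "c \<in> carrier R" "r \<in> S" for c r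
    using frac_eq_trans[OF assms(1,2) that(1) assms(3,4) that(2) e]
      frac_eq_trans[OF assms(2,1) that(1) assms(4,3) that(2) frac_eq_sym[OF assms e]] by blast
  then have "x \<in> fr a s \<longleftrightarrow> x \<in> fr b t" for x
    unfolding fr_mem_iff[OF assms(1,3)] fr_mem_iff[OF assms(2,4)] by blast
  then show "fr a s = fr b t" by blast
qed

lemma fr_eqI:
  assumes "a \<in> carrier R" "b \<in> carrier R" "s \<in> S" "t \<in> S" "t \<otimes> a = s \<otimes> b"
  shows "fr a s = fr b t"
  using fr_eq_iff frac_eqI assms by blast

lemma L_carrier: "carrier L = {fr a s | a s. a \<in> carrier R \<and> s \<in> S}"
  by (auto simp: localization_def quotient_def fraction_def)

lemma fr_closed: "a \<in> carrier R \<Longrightarrow> s \<in> S \<Longrightarrow> fr a s \<in> carrier L"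
  unfolding L_carrier by blast

lemma L_zero: "\<zero>\<^bsub>L\<^esub> = fr \<zero> \<one>" and L_one: "\<one>\<^bsub>L\<^esub> = fr \<one> \<one>"
  by (simp_all add: localization_def)

text \<open>The operations of \<open>localization\<close> are unions over representatives of both
  arguments; independence of the representatives collapses them to one class.\<close>

lemma fr_binop:
  assumes "a \<in> carrier R" "s \<in> S" "b \<in> carrier R" "t \<in> S"
    and "\<And>a' s' b' t'. a' \<in> carrier R \<Longrightarrow> s' \<in> S \<Longrightarrow> b' \<in> carrier R \<Longrightarrow> t' \<in> S \<Longrightarrow>
      frac_eq a s a' s' \<Longrightarrow> frac_eq b t b' t' \<Longrightarrow> h (a', s') (b', t') = h (a, s) (b, t)"
  shows "(\<Union>x\<in>fr a s. \<Union>y\<in>fr b t. h x y) = h (a, s) (b, t)"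
proof -
  have self: "(a, s) \<in> fr a s" "(b, t) \<in> fr b t"
    using fr_mem_iff frac_eqI[of a a s s] frac_eqI[of b b t t] assms(1-4) by auto
  have "(\<Union>y\<in>fr b t. h x y) = h (a, s) (b, t)" if "x \<in> fr a s" for x
  proof (rule UN_constant_eq[OF self(2)], rule ballI)
    fix y assume "y \<in> fr b t"
    then show "h x y = h (a, s) (b, t)"
      using that fr_mem_iff[OF assms(1,2)] fr_mem_iff[OF assms(3,4)] assms(5) by auto
  qed
  then show ?thesis by (intro UN_constant_eq[OF self(1)] ballI)
qed

lemma L_mult:
  assumes "a \<in> carrier R" "s \<in> S" "b \<in> carrier R" "t \<in> S"
  shows "fr a s \<otimes>\<^bsub>L\<^esub> fr b t = fr (a \<otimes> b) (s \<otimes> t)"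
proof -
  have "fr (a' \<otimes> b') (s' \<otimes> t') = fr (a \<otimes> b) (s \<otimes> t)"
    if e: "a' \<in> carrier R" "s' \<in> S" "b' \<in> carrier R" "t' \<in> S" "frac_eq a s a' s'" "frac_eq b t b' t'"
    for a' s' b' t'
  proof -
    obtain u where u: "u \<in> S" "u \<otimes> (s' \<otimes> a \<ominus> s \<otimes> a') = \<zero>" using e(5) by (auto simp: frac_eq_def)
    obtain v where v: "v \<in> S" "v \<otimes> (t' \<otimes> b \<ominus> t \<otimes> b') = \<zero>" using e(6) by (auto simp: frac_eq_def)
    note cl = assms(1,3) that(1,3) S_carrier[OF assms(2)] S_carrier[OF assms(4)]
      S_carrier[OF that(2)] S_carrier[OF that(4)] S_carrier[OF u(1)] S_carrier[OF v(1)]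
    \<comment> \<open>The representatives are exchanged one factor at a time, first a/s and then
      b/t.\<close>
    have "u \<otimes> v \<otimes> (s' \<otimes> t' \<otimes> (a \<otimes> b) \<ominus> s \<otimes> t \<otimes> (a' \<otimes> b')) =
      t' \<otimes> b \<otimes> v \<otimes> (u \<otimes> (s' \<otimes> a \<ominus> s \<otimes> a')) \<oplus> s \<otimes> a' \<otimes> u \<otimes> (v \<otimes> (t' \<otimes> b \<ominus> t \<otimes> b'))"
      using cl by algebra
    also have "\<dots> = \<zero>" using cl by (simp add: u(2) v(2))
    finally have "frac_eq (a \<otimes> b) (s \<otimes> t) (a' \<otimes> b') (s' \<otimes> t')"
      unfolding frac_eq_def using S_mult[OF u(1) v(1)] by blast
    then show ?thesis using fr_eq_iff[of "a \<otimes> b" "a' \<otimes> b'" "s \<otimes> t" "s' \<otimes> t'"] that assms S_mult by auto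
  qed
  then show ?thesis
    using fr_binop[OF assms, of "\<lambda>x y. fr (fst x \<otimes> fst y) (snd x \<otimes> snd y)"]
    by (simp add: localization_def)
qed

lemma L_add:
  assumes "a \<in> carrier R" "s \<in> S" "b \<in> carrier R" "t \<in> S"
  shows "fr a s \<oplus>\<^bsub>L\<^esub> fr b t = fr (a \<otimes> t \<oplus> b \<otimes> s) (s \<otimes> t)"
proof -
  have "fr (a' \<otimes> t' \<oplus> b' \<otimes> s') (s' \<otimes> t') = fr (a \<otimes> t \<oplus> b \<otimes> s) (s \<otimes> t)"
    if e: "a' \<in> carrier R" "s' \<in> S" "b' \<in> carrier R" "t' \<in> S" "frac_eq a s a' s'" "frac_eq b t b' t'"
    for a' s' b' t'
  proof -
    obtain u where u: "u \<in> S" "u \<otimes> (s' \<otimes> a \<ominus> s \<otimes> a') = \<zero>" using e(5) by (auto simp: frac_eq_def)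
    obtain v where v: "v \<in> S" "v \<otimes> (t' \<otimes> b \<ominus> t \<otimes> b') = \<zero>" using e(6) by (auto simp: frac_eq_def)
    note cl = assms(1,3) that(1,3) S_carrier[OF assms(2)] S_carrier[OF assms(4)]
      S_carrier[OF that(2)] S_carrier[OF that(4)] S_carrier[OF u(1)] S_carrier[OF v(1)]
    have "u \<otimes> v \<otimes> (s' \<otimes> t' \<otimes> (a \<otimes> t \<oplus> b \<otimes> s) \<ominus> s \<otimes> t \<otimes> (a' \<otimes> t' \<oplus> b' \<otimes> s')) =
      t \<otimes> t' \<otimes> v \<otimes> (u \<otimes> (s' \<otimes> a \<ominus> s \<otimes> a')) \<oplus> s \<otimes> s' \<otimes> u \<otimes> (v \<otimes> (t' \<otimes> b \<ominus> t \<otimes> b'))"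
      using cl by algebra
    also have "\<dots> = \<zero>" using cl by (simp add: u(2) v(2))
    finally have "frac_eq (a \<otimes> t \<oplus> b \<otimes> s) (s \<otimes> t) (a' \<otimes> t' \<oplus> b' \<otimes> s') (s' \<otimes> t')"
      unfolding frac_eq_def using S_mult[OF u(1) v(1)] by blast
    then show ?thesis
      using fr_eq_iff[of "a \<otimes> t \<oplus> b \<otimes> s" "a' \<otimes> t' \<oplus> b' \<otimes> s'" "s \<otimes> t" "s' \<otimes> t'"] cl that assms S_mult by auto
  qed
  then show ?thesis
    using fr_binop[OF assms, of "\<lambda>x y. fr (fst x \<otimes> snd y \<oplus> fst y \<otimes> snd x) (snd x \<otimes> snd y)"]
    by (simp add: localization_def)
qed

lemma L_cring: "cring L"
proof (rule cringI)
  note ops = L_add L_mult L_zero L_one S_one S_mult S_carrier fr_closed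
  have el: "\<exists>a s. x = fr a s \<and> a \<in> carrier R \<and> s \<in> S" if "x \<in> carrier L" for x
    using that by (auto simp: L_carrier)
  show "abelian_group L"
  proof (rule abelian_groupI)
    fix x assume "x \<in> carrier L"
    then obtain a s where x: "x = fr a s" "a \<in> carrier R" "s \<in> S" using el by blast
    note s = S_carrier[OF x(3)]
    show "\<zero>\<^bsub>L\<^esub> \<oplus>\<^bsub>L\<^esub> x = x" using x s by (simp add: ops)
    show "\<exists>y\<in>carrier L. y \<oplus>\<^bsub>L\<^esub> x = \<zero>\<^bsub>L\<^esub>"
    proof
      have "\<ominus> a \<otimes> s \<oplus> a \<otimes> s = \<zero>" using x s by algebra
      then show "fr (\<ominus> a) s \<oplus>\<^bsub>L\<^esub> x = \<zero>\<^bsub>L\<^esub>"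
        using x s by (simp add: ops) (rule fr_eqI; simp add: ops)
    qed (use x in \<open>simp add: ops\<close>)
    fix y assume "y \<in> carrier L"
    then obtain b t where y: "y = fr b t" "b \<in> carrier R" "t \<in> S" using el by blast
    note t = S_carrier[OF y(3)]
    show "x \<oplus>\<^bsub>L\<^esub> y \<in> carrier L" using x y s t by (simp add: ops)
    show "x \<oplus>\<^bsub>L\<^esub> y = y \<oplus>\<^bsub>L\<^esub> x" using x y s t by (simp add: ops a_comm m_comm)
    fix z assume "z \<in> carrier L"
    then obtain c r where z: "z = fr c r" "c \<in> carrier R" "r \<in> S" using el by blast
    note r = S_carrier[OF z(3)]
    have "(a \<otimes> t \<oplus> b \<otimes> s) \<otimes> r \<oplus> c \<otimes> (s \<otimes> t) = a \<otimes> (t \<otimes> r) \<oplus> (b \<otimes> r \<oplus> c \<otimes> t) \<otimes> s"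
      using x y z s t r by algebra
    then show "x \<oplus>\<^bsub>L\<^esub> y \<oplus>\<^bsub>L\<^esub> z = x \<oplus>\<^bsub>L\<^esub> (y \<oplus>\<^bsub>L\<^esub> z)" using x y z s t r by (simp add: ops m_assoc)
  qed (simp add: ops)
  show "comm_monoid L"
  proof (rule comm_monoidI)
    fix x assume "x \<in> carrier L"
    then obtain a s where x: "x = fr a s" "a \<in> carrier R" "s \<in> S" using el by blast
    note s = S_carrier[OF x(3)]
    show "\<one>\<^bsub>L\<^esub> \<otimes>\<^bsub>L\<^esub> x = x" using x s by (simp add: ops)
    fix y assume "y \<in> carrier L"
    then obtain b t where y: "y = fr b t" "b \<in> carrier R" "t \<in> S" using el by blast
    note t = S_carrier[OF y(3)]
    show "x \<otimes>\<^bsub>L\<^esub> y \<in> carrier L" using x y s t by (simp add: ops)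
    show "x \<otimes>\<^bsub>L\<^esub> y = y \<otimes>\<^bsub>L\<^esub> x" using x y s t by (simp add: ops m_comm)
    fix z assume "z \<in> carrier L"
    then obtain c r where z: "z = fr c r" "c \<in> carrier R" "r \<in> S" using el by blast
    note r = S_carrier[OF z(3)]
    show "x \<otimes>\<^bsub>L\<^esub> y \<otimes>\<^bsub>L\<^esub> z = x \<otimes>\<^bsub>L\<^esub> (y \<otimes>\<^bsub>L\<^esub> z)" using x y z s t r by (simp add: ops m_assoc)
  qed (simp add: ops)
  fix x y z assume "x \<in> carrier L" "y \<in> carrier L" "z \<in> carrier L"
  then obtain a s b t c r where e: "x = fr a s" "y = fr b t" "z = fr c r"
    and c: "a \<in> carrier R" "b \<in> carrier R" "c \<in> carrier R" "s \<in> S" "t \<in> S" "r \<in> S"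
    using el by meson
  note S = c(4-6)[THEN S_carrier]
  have "s \<otimes> r \<otimes> (t \<otimes> r) \<otimes> ((a \<otimes> t \<oplus> b \<otimes> s) \<otimes> c) =
    s \<otimes> t \<otimes> r \<otimes> (a \<otimes> c \<otimes> (t \<otimes> r) \<oplus> b \<otimes> c \<otimes> (s \<otimes> r))"
    using c(1-3) S by algebra
  then show "(x \<oplus>\<^bsub>L\<^esub> y) \<otimes>\<^bsub>L\<^esub> z = x \<otimes>\<^bsub>L\<^esub> z \<oplus>\<^bsub>L\<^esub> y \<otimes>\<^bsub>L\<^esub> z"
    using c S by (simp add: e ops) (rule fr_eqI; simp add: ops)
qed

lemma fr_one_ring_hom: "(\<lambda>a. fr a \<one>) \<in> ring_hom R L"
  by (rule ring_hom_memI) (simp_all add: fr_closed L_mult L_add L_one S_one)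

section \<open>Prime ideals of the localization\<close>

definition loc_ideal :: "'a set \<Rightarrow> ('a \<times> 'a) set set" where
  "loc_ideal P = {fr a s | a s. a \<in> P \<and> s \<in> S}"

text \<open>If a/s = b/t with b in P, then u t a lies in P for some u in S, and u t is not in P. So
  membership can be tested on any representative, which gives primality and strict inclusions
  below.\<close>

lemma fr_mem_loc_ideal:
  assumes "primeideal P R" "P \<inter> S = {}" "a \<in> carrier R" "s \<in> S"
  shows "fr a s \<in> loc_ideal P \<longleftrightarrow> a \<in> P"
proof
  note P = ideal_closed[OF primeideal.axioms(1)[OF assms(1)]]
  assume "fr a s \<in> loc_ideal P"
  then obtain b t where b: "b \<in> P" "t \<in> S" "fr a s = fr b t" by (auto simp: loc_ideal_def)
  have bR: "b \<in> carrier R" using b P(1) by blast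
  obtain u where u: "u \<in> S" "u \<otimes> (t \<otimes> a \<ominus> s \<otimes> b) = \<zero>"
    using b fr_eq_iff[OF assms(3) bR assms(4) b(2)] by (auto simp: frac_eq_def)
  note c = assms(3) bR S_carrier[OF assms(4)] S_carrier[OF b(2)] S_carrier[OF u(1)]
  have "u \<otimes> t \<otimes> a = u \<otimes> (t \<otimes> a \<ominus> s \<otimes> b) \<oplus> u \<otimes> s \<otimes> b" using c by algebra
  also have "\<dots> = u \<otimes> s \<otimes> b" using c by (simp add: u(2))
  also have "\<dots> \<in> P" using P(5)[OF b(1)] c by simp
  finally have "u \<otimes> t \<otimes> a \<in> P" .
  then have "u \<otimes> t \<in> P \<or> a \<in> P" using primeideal.I_prime[OF assms(1)] c by simp
  then show "a \<in> P" using S_mult[OF u(1) b(2)] assms(2) by blast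
qed (use assms(4) in \<open>auto simp: loc_ideal_def\<close>)

lemma loc_ideal_prime:
  assumes P: "primeideal P R" "P \<inter> S = {}"
  shows "primeideal (loc_ideal P) L"
proof -
  interpret L: cring L by (rule L_cring)
  note Pc = ideal_closed[OF primeideal.axioms(1)[OF P(1)]]
  note mem = fr_mem_loc_ideal[OF P]
  have sub: "loc_ideal P \<subseteq> carrier L" using Pc(1) fr_closed by (auto simp: loc_ideal_def)
  have el: "\<exists>a s. x = fr a s \<and> a \<in> carrier R \<and> s \<in> S" if "x \<in> carrier L" for x
    using that by (auto simp: L_carrier)
  note ops = L_add L_mult S_one S_mult S_carrier fr_closed mem
  have "ideal (loc_ideal P) L"
  proof (rule L.ideal_of_closed[OF sub])
    show "\<zero>\<^bsub>L\<^esub> \<in> loc_ideal P" using Pc(2) by (simp add: L_zero ops)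
    fix x assume x: "x \<in> loc_ideal P"
    then obtain a s where a: "x = fr a s" "a \<in> carrier R" "s \<in> S" using el[OF subsetD[OF sub x]] by blast
    then have aP: "a \<in> P" using x mem by blast
    {
      fix y assume y: "y \<in> loc_ideal P"
      then obtain b t where b: "y = fr b t" "b \<in> carrier R" "t \<in> S" using el[OF subsetD[OF sub y]] by blast
      then have bP: "b \<in> P" using y mem by blast
      have "t \<otimes> a \<oplus> s \<otimes> b \<in> P" using Pc(3,5) aP bP a b S_carrier by simp
      then show "x \<oplus>\<^bsub>L\<^esub> y \<in> loc_ideal P" using a b by (simp add: ops m_comm)
    }
    fix y assume "y \<in> carrier L"
    then obtain b t where b: "y = fr b t" "b \<in> carrier R" "t \<in> S" using el by blast
    then show "y \<otimes>\<^bsub>L\<^esub> x \<in> loc_ideal P" using a Pc(5)[OF aP] by (simp add: ops)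
  qed
  moreover have "carrier L \<noteq> loc_ideal P"
  proof -
    have "\<one>\<^bsub>L\<^esub> \<notin> loc_ideal P" using P(2) S_one by (auto simp: L_one mem)
    then show ?thesis using L.one_closed by blast
  qed
  moreover have "x \<in> loc_ideal P \<or> y \<in> loc_ideal P"
    if xy: "x \<in> carrier L" "y \<in> carrier L" "x \<otimes>\<^bsub>L\<^esub> y \<in> loc_ideal P" for x y
  proof -
    obtain a s where a: "x = fr a s" "a \<in> carrier R" "s \<in> S" using el[OF xy(1)] by blast
    obtain b t where b: "y = fr b t" "b \<in> carrier R" "t \<in> S" using el[OF xy(2)] by blast
    have "a \<otimes> b \<in> P" using xy(3) a b by (simp add: ops)
    then show ?thesis using primeideal.I_prime[OF P(1) a(2) b(2)] a b mem by blast
  qed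
  ultimately show ?thesis using L_cring by (intro primeidealI) auto
qed

lemma loc_ideal_strict_mono:
  assumes "primeideal P R" "P \<inter> S = {}" "primeideal P' R" "P' \<inter> S = {}" "P \<subset> P'"
  shows "loc_ideal P \<subset> loc_ideal P'"
proof -
  obtain a where a: "a \<in> P'" "a \<notin> P" using assms(5) by blast
  have "a \<in> carrier R" using a ideal_closed(1)[OF primeideal.axioms(1)[OF assms(3)]] by blast
  then have "fr a \<one> \<in> loc_ideal P' - loc_ideal P"
    using a fr_mem_loc_ideal[OF assms(1,2)] fr_mem_loc_ideal[OF assms(3,4)] S_one by auto
  moreover have "loc_ideal P \<subseteq> loc_ideal P'" using assms(5) by (auto simp: loc_ideal_def)
  ultimately show ?thesis by blast
qed

end

lemma (in cring) localized_at_prime: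
  assumes "primeideal p R" shows "localized_ring R (carrier R - p)"
  using primeideal_unit_complement[OF assms] cring_axioms
  by (intro localized_ring.intro localized_ring_axioms.intro) auto

text \<open>Primes in a chain ending at p avoid the complement of p, so their extensions form a
  strict chain of primes of the local ring.\<close>

lemma (in cring) prime_chain_below_le_krull_dim:
  assumes "primeideal p R" "prime_chain_below k p"
  shows "enat k \<le> krull_dim (local_ring_at R p)"
proof -
  interpret l: localized_ring R "carrier R - p" by (rule localized_at_prime) fact
  obtain P where P: "\<And>i. i \<le> k \<Longrightarrow> primeideal (P i) R" "\<And>i. i < k \<Longrightarrow> P i \<subset> P (Suc i)" "P k = p"
    using assms(2) by (auto simp: prime_chain_below_def)
  have le: "P i \<subseteq> p" if "i \<le> k" for i
    using that
  proof (induction i rule: inc_induct)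
    case base
    show ?case using P(3) by simp
  next
    case (step i)
    then show ?case using P(2)[of i] by auto
  qed
  then have disj: "P i \<inter> (carrier R - p) = {}" if "i \<le> k" for i using that by blast
  have "\<exists>P. (\<forall>i\<le>k. primeideal (P i) l.L) \<and> (\<forall>i<k. P i \<subset> P (Suc i))"
    using P(1,2) disj l.loc_ideal_prime l.loc_ideal_strict_mono
    by (intro exI[of _ "\<lambda>i. l.loc_ideal (P i)"]) auto
  then show ?thesis
    unfolding krull_dim_def local_ring_at_def by (intro Sup_upper) blast
qed

section \<open>The residue field as an R-module\<close>

lemma restrict_scalars_module:
  assumes "cring R" "cring A" "h \<in> ring_hom R A"
  shows "module R (restrict_scalars h A)"
proof -
  interpret A: cring A by fact
  interpret R: cring R by fact
  interpret h: ring_hom_ring R A h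
    using assms by (intro ring_hom_ringI2) (auto intro: R.ring_axioms A.ring_axioms)
  have neg: "\<exists>y\<in>carrier A. y \<oplus>\<^bsub>A\<^esub> x = \<zero>\<^bsub>A\<^esub>" if "x \<in> carrier A" for x
    using that by (intro bexI[of _ "\<ominus>\<^bsub>A\<^esub> x"]) (auto simp: A.l_neg)
  show ?thesis
  proof (rule moduleI)
    show "abelian_group (restrict_scalars h A)"
      by (rule abelian_groupI) (auto simp: restrict_scalars_def A.a_ac neg)
  qed (auto simp: restrict_scalars_def A.l_distr A.r_distr A.m_assoc intro: assms(1))
qed

text \<open>An element u outside p acts invertibly, the inverse being the class of 1/u; this gives
  injectivity and fractions of the unit. The annihilator of the unit is p because the extended ideal
  contracts to p.\<close>

lemma residue_field_residue_module:
  fixes R (structure)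
  assumes "cring R" "primeideal p R"
  shows "residue_module R (residue_field_module R p) p \<one>\<^bsub>residue_field R p\<^esub>"
proof -
  interpret cring R by fact
  interpret l: localized_ring R "carrier R - p" by (rule localized_at_prime) fact
  interpret L: cring l.L by (rule l.L_cring)
  define I where "I = extended_ideal R p"
  have pc: "p \<subseteq> carrier R" using ideal_closed(1)[OF primeideal.axioms(1)[OF assms(2)]] .
  have I_def': "I = Idl\<^bsub>l.L\<^esub> ((\<lambda>a. l.fr a \<one>) ` p)"
    unfolding I_def extended_ideal_def local_ring_at_def
    by (rule arg_cong2[where f = genideal]) (auto simp: to_local_ring_at_def)
  have gens: "(\<lambda>a. l.fr a \<one>) ` p \<subseteq> carrier l.L" using pc l.fr_closed l.S_one by blast
  have I: "ideal I l.L" unfolding I_def' by (rule L.genideal_ideal[OF gens])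
  then interpret I: ideal I l.L .
  \<comment> \<open>The extended ideal is only given by generators; this inclusion shows that a/1
    belongs to it only when a is in p.\<close>
  have "I \<subseteq> l.loc_ideal p"
    unfolding I_def' using l.loc_ideal_prime[OF assms(2)] l.S_one
    by (intro L.genideal_minimal) (auto simp: primeideal.axioms(1) l.loc_ideal_def)
  then have mem_I: "l.fr a \<one> \<in> I \<longleftrightarrow> a \<in> p" if "a \<in> carrier R" for a
    using l.fr_mem_loc_ideal[OF assms(2) _ that l.S_one] L.genideal_self[OF gens]
    unfolding I_def'[symmetric] by blast
  define A where "A = residue_field R p"
  define q where "q x = I +>\<^bsub>l.L\<^esub> x" for x
  have A: "A = l.L Quot I" by (simp add: A_def residue_field_def local_ring_at_def I_def)
  interpret A: cring A unfolding A by (rule I.quotient_is_cring) (rule l.L_cring)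
  have q: "q \<in> ring_hom l.L A" unfolding A q_def using I.rcos_ring_hom by simp
  interpret q: ring_hom_ring l.L A q
    using q by (intro ring_hom_ringI2) (auto intro: L.ring_axioms A.ring_axioms)
  have q_surj: "x \<in> carrier A \<Longrightarrow> \<exists>a\<in>carrier R. \<exists>s\<in>carrier R - p. x = q (l.fr a s)" for x
    unfolding A q_def by (auto simp: FactRing_def A_RCOSETS_def' l.L_carrier)
  have q_zero: "q x = \<zero>\<^bsub>A\<^esub> \<longleftrightarrow> x \<in> I" if "x \<in> carrier l.L" for x
    using L.a_rcos_zero[OF I] I.rcos_const_imp_mem[OF that] by (auto simp: q_def A FactRing_def)
  define h where "h a = q (l.fr a \<one>)" for a
  have N: "residue_field_module R p = restrict_scalars h A"
  proof -
    have "h = (\<lambda>r. extended_ideal R p +>\<^bsub>local_ring_at R p\<^esub> to_local_ring_at R p r)"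
      by (simp add: fun_eq_iff h_def q_def I_def local_ring_at_def to_local_ring_at_def)
    then show ?thesis by (simp only: residue_field_module_def A_def)
  qed
  have h: "h \<in> ring_hom R A"
    using ring_hom_trans[OF l.fr_one_ring_hom q] by (simp add: h_def[abs_def] comp_def)
  then interpret h: ring_hom_ring R A h
    by (intro ring_hom_ringI2) (auto intro: ring_axioms A.ring_axioms)
  have fields: "carrier (restrict_scalars h A) = carrier A" "\<zero>\<^bsub>restrict_scalars h A\<^esub> = \<zero>\<^bsub>A\<^esub>"
    "a \<odot>\<^bsub>restrict_scalars h A\<^esub> x = h a \<otimes>\<^bsub>A\<^esub> x" for a x
    by (simp_all add: restrict_scalars_def)
  have inv: "q (l.fr \<one> u) \<in> carrier A" "h u \<otimes>\<^bsub>A\<^esub> q (l.fr \<one> u) = \<one>\<^bsub>A\<^esub>" if "u \<in> carrier R - p" for u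
  proof -
    have c: "l.fr u \<one> \<in> carrier l.L" "l.fr \<one> u \<in> carrier l.L"
      using that l.fr_closed l.S_one by auto
    have "l.fr u \<one> \<otimes>\<^bsub>l.L\<^esub> l.fr \<one> u = \<one>\<^bsub>l.L\<^esub>"
      using that l.S_one by (simp add: l.L_mult l.L_one) (rule l.fr_eqI; simp)
    then show "h u \<otimes>\<^bsub>A\<^esub> q (l.fr \<one> u) = \<one>\<^bsub>A\<^esub>"
      unfolding h_def using q.hom_mult[OF c] q.hom_one by simp
    show "q (l.fr \<one> u) \<in> carrier A" using c by simp
  qed
  show ?thesis
    unfolding N A_def[symmetric]
  proof (intro residue_module.intro residue_module_axioms.intro, unfold fields)
    show "module R (restrict_scalars h A)" by (rule restrict_scalars_module) (fact assms A.cring_axioms h)+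
    show "primeideal p R" by fact
    show "\<one>\<^bsub>A\<^esub> \<in> carrier A" by simp
    show "h a \<otimes>\<^bsub>A\<^esub> \<one>\<^bsub>A\<^esub> = \<zero>\<^bsub>A\<^esub> \<longleftrightarrow> a \<in> p" if "a \<in> carrier R" for a
      using that q_zero[OF l.fr_closed[OF that l.S_one]] mem_I[OF that] by (simp add: h_def[symmetric])
    show "x = \<zero>\<^bsub>A\<^esub>" if u: "u \<in> carrier R - p" "x \<in> carrier A" "h u \<otimes>\<^bsub>A\<^esub> x = \<zero>\<^bsub>A\<^esub>" for u x
    proof -
      have "x = h u \<otimes>\<^bsub>A\<^esub> q (l.fr \<one> u) \<otimes>\<^bsub>A\<^esub> x" using inv[OF u(1)] u(2) by simp
      also have "\<dots> = q (l.fr \<one> u) \<otimes>\<^bsub>A\<^esub> (h u \<otimes>\<^bsub>A\<^esub> x)"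
        using inv(1)[OF u(1)] u(1,2) by (simp add: A.m_ac)
      finally show ?thesis using inv(1)[OF u(1)] u(3) by simp
    qed
    show "\<exists>u\<in>carrier R - p. \<exists>a\<in>carrier R. h u \<otimes>\<^bsub>A\<^esub> x = h a \<otimes>\<^bsub>A\<^esub> \<one>\<^bsub>A\<^esub>" if "x \<in> carrier A" for x
    proof -
      obtain a s where x: "a \<in> carrier R" "s \<in> carrier R - p" "x = q (l.fr a s)" using q_surj[OF \<open>x \<in> carrier A\<close>] by blast
      have c: "l.fr s \<one> \<in> carrier l.L" "l.fr a s \<in> carrier l.L"
        using x l.fr_closed l.S_one by auto
      have "l.fr s \<one> \<otimes>\<^bsub>l.L\<^esub> l.fr a s = l.fr a \<one>"
        using x l.S_one by (simp add: l.L_mult) (rule l.fr_eqI; simp)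
      then have "h s \<otimes>\<^bsub>A\<^esub> x = h a" using q.hom_mult[OF c] by (simp add: h_def x(3))
      then show ?thesis using x(1,2) by (intro bexI[of _ s] bexI[of _ a]) simp_all
    qed
    show "\<exists>w\<in>carrier A. h u \<otimes>\<^bsub>A\<^esub> w = \<one>\<^bsub>A\<^esub>" if "u \<in> carrier R - p" for u
      by (intro bexI[of _ "q (l.fr \<one> u)"] inv that)
  qed
qed

theorem theorem1p1:
  fixes R :: "('a, 'c) ring_scheme"
    and M :: "('a, 'b, 'd) module_scheme"
    and p :: "'a set"
    and n :: nat
  assumes "cring R" and "noetherian_ring R"
    and "primeideal p R"
    and "module R M"
    and "enat n \<ge> krull_dim (local_ring_at R p)"
    and "zero_module (Tor R n (residue_field_module R p) M)"
  shows "\<forall>i\<ge>n. zero_module (Tor R i (residue_field_module R p) M)"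
proof -
  interpret noetherian_cring R using assms(1,2) by (rule noetherian_cring.intro)
  have F: "module R (res_module R M i)" for i
    unfolding res_module_def by (rule free_module_module) fact
  note linear = module.lin_ext_closed[OF F] module.lin_ext_add[OF F] module.lin_ext_smult[OF F]
  note bd = cell_boundary_closed[OF assms(1), of M]
  have "free_complex R (res_basis R M) (res_differential R M)"
    using linear(1)[OF _ bd] linear(2,3)[OF _ _ bd] res_exact_Suc[OF assms(4)]
    by (intro free_complex.intro free_complex_axioms.intro assms(1))
      (simp_all add: res_differential_def res_module_def)
  then interpret noetherian_free_complex R "res_basis R M" "res_differential R M"
    by (intro noetherian_free_complex.intro noetherian_cring_axioms)
  interpret residue_complex R "res_basis R M" "res_differential R M"
    "residue_field_module R p" p "\<one>\<^bsub>residue_field R p\<^esub>"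
    by (intro residue_complex.intro free_complex_axioms residue_field_residue_module assms)
  have Tor_zero: "zero_module (Tor R i (residue_field_module R p) M) \<longleftrightarrow> residue_acyclic p i" for i
    unfolding Tor_def res_module_def residue_acyclic_def by (rule homology_zero_iff)
  \<comment> \<open>The dimension hypothesis enters here: a chain of n + 1 strict inclusions ending
    at p would make the dimension of the local ring at least n + 1.\<close>
  have "\<not> prime_chain_below (Suc n) p"
    using prime_chain_below_le_krull_dim[OF assms(3), of "Suc n"] assms(5)
    by (metis enat_ord_simps(1) not_less_eq_eq order_refl order_trans)
  then show ?thesis
    using residue_acyclic_above[OF assms(3)] assms(6) unfolding Tor_zero by blast
qed

end
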